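(* Let $p>1$, $p'=p/(p-1)$, $m\in\mathbb{N}$, $m\ge2$, let $\Omega\subset\mathbb{R}^N$ ($N\ge1$) be a bounded domain, $h\in L^{p'}(\Omega)\setminus\{0\}$, and let $\phi\in L^1(\Omega)$ be such that $K=\{v\in W_0^{m,p}(\Omega):\ v\ge\phi\ \text{a.e. in }\Omega\}\ne\emptyset$. Let $u\in K$ be the unique function satisfying $\langle\Delta_p^mu-h,w-u\rangle\ge0$ for all $w\in K$. Then for any $v\in K$: (a) if $p\ge2$, $$2^{2-p}\|\mathcal{D}_m(u-v)\|_p^{p-1}+\frac{\langle\Delta_p^mu-h,v-u\rangle}{\|\mathcal{D}_m(u-v)\|_p}\le\|\Delta_p^mv-h\|_{*,K};$$ if $p<2$, $$\frac{(p-1)\,2^{\frac{p-2}{p}}}{\left(C_3^p+\|\mathcal{D}_mv\|_p^p\right)^{\frac{2-p}{p}}}\|\mathcal{D}_m(u-v)\|_p+\frac{\langle\Delta_p^mu-h,v-u\rangle}{\|\mathcal{D}_m(u-v)\|_p}\le\|\Delta_p^mv-h\|_{*,K},$$ where, for an arbitrary fixed $w\in K$, $$C_3:=\max\Bigl\{(p\,C_{F,m}\|h\|_{p'}+1)^{\frac{1}{p-1}},\ \|\mathcal{D}_mw\|_p^p-p\int_\Omega hw\,dx\Bigr\}.$$ (b) Moreover, if $m=2k$, then $$\|\Delta_p^mv-h\|_{*,K}\le\inf_{\eta^*\in Q^*_m}\Bigl(\|\tau^*-\eta^*\|_{p'}+C_{F,m}\|\Delta^k\eta^*-h\|_{p',\Omega_0^v}+C_{F,m}\|(\Delta^k\eta^*-h)_+\|_{p',\Omega_\phi^v}\Bigr),$$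 where $\tau^*:=|\Delta^kv|^{p-2}\Delta^kv$; while if $m=2k+1$, then $$\|\Delta_p^mv-h\|_{*,K}\le\inf_{\eta^*\in Q^*_m}\Bigl(\|\tau^*-\eta^*\|_{p'}+C_{F,m}\|\Delta^k(\mathrm{div}\,\eta^* )+h\|_{p',\Omega_0^v}+C_{F,m}\|(\Delta^k(\mathrm{div}\,\eta^* )+h)_+\|_{p',\Omega_\phi^v}\Bigr),$$ where $\tau^*:=|\nabla(\Delta^kv)|^{p-2}\nabla(\Delta^kv)$. (c) In particular, since $\langle\Delta_p^mu-h,v-u\rangle\ge0$, $$\|\mathcal{D}_m(u-v)\|_p\le C\,\|\Delta_p^mv-h\|_{*,K}^{\frac{1}{\max\{1,p-1\}}},\qquad C=\begin{cases}2^{\frac{p-2}{p-1}},& p\ge2,\\ (p-1)^{-1}\,2^{\frac{2-p}{p}}\left(C_3^p+\|\mathcal{D}_mv\|_p^p\right)^{\frac{2-p}{p}},& p<2.\end{cases}$$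
   Context: $\|\cdot\|_q$ is the norm of $L^q(\Omega)$ and $\|\cdot\|_{q,D}$ that of $L^q(D)$; $a_+=\max\{a,0\}$; $|a|^{p-2}a:=0$ for $a=0$. $W_0^{m,p}(\Omega)$ is the closure of $C_0^\infty(\Omega)$ in $W^{m,p}(\Omega)$. For $k\in\mathbb{N}$, $$\mathcal{D}_mu=\begin{cases}\Delta^ku,& m=2k,\\ \nabla(\Delta^ku),& m=2k+1.\end{cases}$$ It is known that $\|\mathcal{D}_m(\cdot)\|_p$ is a norm on $W_0^{m,p}(\Omega)$ equivalent to the standard one. $C_{F,m}$ is the (optimal) constant of the embedding $W_0^{m,p}(\Omega)\subset L^p(\Omega)$, i.e. the best constant in $\|w\|_p\le C_{F,m}\|\mathcal{D}_mw\|_p$. The polyharmonic operator $\Delta_p^m$ (for smooth functions $\Delta^k(|\Delta^ku|^{p-2}\Delta^ku)$ if $m=2k$ and $-\Delta^k\mathrm{div}(|\nabla\Delta^ku|^{p-2}\nabla\Delta^ku)$ if $m=2k+1$) is understood weakly: $$\langle\Delta_p^mv-h,\xi\rangle=\int_\Omega|\mathcal{D}_mv|^{p-2}\mathcal{D}_mv\cdot\mathcal{D}_m\xi\,dx-\int_\Omega h\xi\,dx,\qquad v,\xi\in W_0^{m,p}(\Omega).$$ For $v\in K$, $$\|\Delta_p^mv-h\|_{*,K}=\sup_{w\in K\setminus\{v\}}\frac{(-\langle\Delta_p^mv-h,w-v\rangle)_+}{\|\mathcal{D}_m(w-v)\|_p},\qquad \Omega_\phi^v=\{x\in\Omega:\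 v(x)=\phi(x)\},\quad\Omega_0^v=\Omega\setminus\Omega_\phi^v.$$ The space $Q_m^*$ is $\{\eta\in L^{p'}(\Omega):\Delta^k\eta\in L^{p'}(\Omega)\}$ if $m=2k$, and $\{\eta\in L^{p'}(\Omega;\mathbb{R}^N):\Delta^k(\mathrm{div}\,\eta)\in L^{p'}(\Omega)\}$ if $m=2k+1$ (distributional derivatives). Convention: when $v=u$, the quotient $\langle\Delta_p^mu-h,v-u\rangle/\|\mathcal{D}_m(u-v)\|_p$ is taken to be zero.
   Formalization: In (b) for m=2k the last term is proved with (h−Δ^kη* )_+ in place of the printed (Δ^kη*−h)_+; as printed the bound fails, e.g. for φ=v=η*=0, h=1, where the right side is 0 but the left side is positive. *)

theory Defs
  imports "HOL-Analysis.Analysis"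
begin

section \<open>Classical derivatives and test functions\<close>

definition partial :: "'a::euclidean_space \<Rightarrow> ('a \<Rightarrow> real) \<Rightarrow> 'a \<Rightarrow> real" where
  "partial b f x = frechet_derivative f (at x) b"

text \<open>A list \<open>[b\<^sub>1, \<dots>, b\<^sub>j]\<close> of basis vectors stands for the operator
  \<open>\<partial>\<^sub>b\<^sub>1 \<dots> \<partial>\<^sub>b\<^sub>j\<close>.\<close>

definition partials :: "'a::euclidean_space list \<Rightarrow> ('a \<Rightarrow> real) \<Rightarrow> 'a \<Rightarrow> real" where
  "partials bs f = foldr partial bs f"

definition grad :: "('a::euclidean_space \<Rightarrow> real) \<Rightarrow> 'a \<Rightarrow> 'a" where
  "grad f x = (\<Sum>b\<in>Basis. partial b f x *\<^sub>R b)"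

definition laplace :: "('a::euclidean_space \<Rightarrow> real) \<Rightarrow> 'a \<Rightarrow> real" where
  "laplace f x = (\<Sum>b\<in>Basis. partial b (partial b f) x)"

text \<open>If every iterated partial derivative is (totally) differentiable, then all of them are
  continuous, so this is \<open>C\<^sup>\<infinity>\<close>.\<close>

definition smooth :: "('a::euclidean_space \<Rightarrow> real) \<Rightarrow> bool" where
  "smooth f \<longleftrightarrow> (\<forall>bs. set bs \<subseteq> Basis \<longrightarrow> partials bs f differentiable_on UNIV)"

definition test_functions :: "'a::euclidean_space set \<Rightarrow> ('a \<Rightarrow> real) set" where
  "test_functions \<Omega> =
     {\<psi>. smooth \<psi> \<and> compact (closure {x. \<psi> x \<noteq> 0}) \<and> closure {x. \<psi> x \<noteq> 0} \<subseteq> \<Omega>}"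


section \<open>Lebesgue spaces\<close>

text \<open>Elements of function spaces are represented by functions, equality being almost everywhere
  equality on \<open>\<Omega>\<close>; values outside \<open>\<Omega>\<close> are irrelevant.\<close>

definition Lp :: "real \<Rightarrow> 'a::euclidean_space set \<Rightarrow> ('a \<Rightarrow> 'b::euclidean_space) set" where
  "Lp q \<Omega> = {f. f \<in> borel_measurable (lebesgue_on \<Omega>) \<and>
                integrable (lebesgue_on \<Omega>) (\<lambda>x. norm (f x) powr q)}"

definition Lp_norm ::
  "real \<Rightarrow> 'a::euclidean_space set \<Rightarrow> ('a \<Rightarrow> 'b::euclidean_space) \<Rightarrow> real" where
  "Lp_norm q D f = (LINT x|lebesgue_on D. norm (f x) powr q) powr (1 / q)"

definition locally_integrable ::
  "'a::euclidean_space set \<Rightarrow> ('a \<Rightarrow> 'b::euclidean_space) \<Rightarrow> bool" where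
  "locally_integrable \<Omega> f \<longleftrightarrow>
     (\<forall>C. compact C \<and> C \<subseteq> \<Omega> \<longrightarrow> f absolutely_integrable_on C)"


section \<open>Distributional derivatives\<close>

text \<open>\<open>T\<close> is the formal adjoint, acting on test functions, of the differential operator \<open>P\<close> to be
  defined; the predicate says that \<open>P u = g\<close> in the sense of distributions on \<open>\<Omega>\<close>.\<close>

definition distributionally ::
  "'a::euclidean_space set \<Rightarrow> (('a \<Rightarrow> real) \<Rightarrow> 'a \<Rightarrow> 'b::euclidean_space)
     \<Rightarrow> ('a \<Rightarrow> 'b) \<Rightarrow> ('a \<Rightarrow> real) \<Rightarrow> bool" where
  "distributionally \<Omega> T u g \<longleftrightarrow>
     locally_integrable \<Omega> u \<and> locally_integrable \<Omega> g \<and>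
     (\<forall>\<psi>\<in>test_functions \<Omega>.
        (LINT x|lebesgue_on \<Omega>. u x \<bullet> T \<psi> x) = (LINT x|lebesgue_on \<Omega>. g x * \<psi> x))"

definition has_weak_partials ::
  "'a::euclidean_space set \<Rightarrow> 'a list \<Rightarrow> ('a \<Rightarrow> real) \<Rightarrow> ('a \<Rightarrow> real) \<Rightarrow> bool" where
  "has_weak_partials \<Omega> bs =
     distributionally \<Omega> (\<lambda>\<psi> x. (- 1) ^ length bs * partials bs \<psi> x)"

definition has_weak_laplace_power ::
  "'a::euclidean_space set \<Rightarrow> nat \<Rightarrow> ('a \<Rightarrow> real) \<Rightarrow> ('a \<Rightarrow> real) \<Rightarrow> bool" where
  "has_weak_laplace_power \<Omega> k = distributionally \<Omega> (\<lambda>\<psi>. (laplace ^^ k) \<psi>)"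

text \<open>\<open>\<Delta>\<^sup>k (div \<eta>) = g\<close>; only the composite has to be a function, \<open>div \<eta>\<close> need not be one.\<close>

definition has_weak_laplace_power_div ::
  "'a::euclidean_space set \<Rightarrow> nat \<Rightarrow> ('a \<Rightarrow> 'a) \<Rightarrow> ('a \<Rightarrow> real) \<Rightarrow> bool" where
  "has_weak_laplace_power_div \<Omega> k =
     distributionally \<Omega> (\<lambda>\<psi> x. - grad ((laplace ^^ k) \<psi>) x)"

text \<open>The derivatives as functions. They are determined up to null sets of \<open>\<Omega>\<close> whenever they
  exist, and are used only in that case.\<close>

definition weak_partials ::
  "'a::euclidean_space set \<Rightarrow> 'a list \<Rightarrow> ('a \<Rightarrow> real) \<Rightarrow> 'a \<Rightarrow> real" where
  "weak_partials \<Omega> bs u = (SOME g. has_weak_partials \<Omega> bs u g)"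

definition weak_grad :: "'a::euclidean_space set \<Rightarrow> ('a \<Rightarrow> real) \<Rightarrow> 'a \<Rightarrow> 'a" where
  "weak_grad \<Omega> u x = (\<Sum>b\<in>Basis. weak_partials \<Omega> [b] u x *\<^sub>R b)"

definition weak_laplace_power ::
  "'a::euclidean_space set \<Rightarrow> nat \<Rightarrow> ('a \<Rightarrow> real) \<Rightarrow> 'a \<Rightarrow> real" where
  "weak_laplace_power \<Omega> k u = (SOME g. has_weak_laplace_power \<Omega> k u g)"

definition weak_laplace_power_div ::
  "'a::euclidean_space set \<Rightarrow> nat \<Rightarrow> ('a \<Rightarrow> 'a) \<Rightarrow> 'a \<Rightarrow> real" where
  "weak_laplace_power_div \<Omega> k \<eta> = (SOME g. has_weak_laplace_power_div \<Omega> k \<eta> g)"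


section \<open>Sobolev spaces\<close>

definition Sobolev :: "nat \<Rightarrow> real \<Rightarrow> 'a::euclidean_space set \<Rightarrow> ('a \<Rightarrow> real) set" where
  "Sobolev m p \<Omega> =
     {u \<in> Lp p \<Omega>. \<forall>bs. set bs \<subseteq> Basis \<and> length bs \<le> m \<longrightarrow>
                   (\<exists>g\<in>Lp p \<Omega>. has_weak_partials \<Omega> bs u g)}"

text \<open>Summing over lists rather than multi-indices counts mixed derivatives several times, which
  gives an equivalent norm and hence the same closure below.\<close>

definition Sobolev_norm ::
  "nat \<Rightarrow> real \<Rightarrow> 'a::euclidean_space set \<Rightarrow> ('a \<Rightarrow> real) \<Rightarrow> real" where
  "Sobolev_norm m p \<Omega> u =
     (\<Sum>bs | set bs \<subseteq> Basis \<and> length bs \<le> m. Lp_norm p \<Omega> (weak_partials \<Omega> bs u) powr p)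
       powr (1 / p)"

definition Sobolev0 :: "nat \<Rightarrow> real \<Rightarrow> 'a::euclidean_space set \<Rightarrow> ('a \<Rightarrow> real) set" where
  "Sobolev0 m p \<Omega> =
     {u \<in> Sobolev m p \<Omega>.
        \<forall>e>0. \<exists>\<psi>\<in>test_functions \<Omega>. Sobolev_norm m p \<Omega> (\<lambda>x. u x - \<psi> x) < e}"


section \<open>The polyharmonic operator\<close>

text \<open>\<open>\<D>\<^sub>m u\<close> is scalar for even and vector valued for odd \<open>m\<close>. Both cases are embedded isometrically
  in \<open>\<real> \<times> 'a\<close>, so that norms and inner products are those of \<open>\<Delta>\<^sup>k u\<close>, respectively of
  \<open>\<nabla>(\<Delta>\<^sup>k u)\<close>, where \<open>k = m div 2\<close>.\<close>

definition Dm ::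
  "'a::euclidean_space set \<Rightarrow> nat \<Rightarrow> ('a \<Rightarrow> real) \<Rightarrow> 'a \<Rightarrow> real \<times> 'a" where
  "Dm \<Omega> m u x =
     (if even m then (weak_laplace_power \<Omega> (m div 2) u x, 0)
      else (0, weak_grad \<Omega> (weak_laplace_power \<Omega> (m div 2) u) x))"

definition Dm_norm ::
  "'a::euclidean_space set \<Rightarrow> nat \<Rightarrow> real \<Rightarrow> ('a \<Rightarrow> real) \<Rightarrow> real" where
  "Dm_norm \<Omega> m p u = Lp_norm p \<Omega> (Dm \<Omega> m u)"

text \<open>\<open>|a|\<^sup>p\<^sup>-\<^sup>2 a\<close>, which is \<open>0\<close> for \<open>a = 0\<close>.\<close>

definition pow_dual :: "real \<Rightarrow> 'b::euclidean_space \<Rightarrow> 'b" where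
  "pow_dual p a = (norm a powr (p - 2)) *\<^sub>R a"

text \<open>\<open>\<langle>\<Delta>\<^sub>p\<^sup>m v - h, \<xi>\<rangle>\<close>\<close>

definition residual ::
  "'a::euclidean_space set \<Rightarrow> nat \<Rightarrow> real \<Rightarrow> ('a \<Rightarrow> real) \<Rightarrow> ('a \<Rightarrow> real) \<Rightarrow> ('a \<Rightarrow> real) \<Rightarrow> real"
  where
  "residual \<Omega> m p h v \<xi> =
     (LINT x|lebesgue_on \<Omega>. pow_dual p (Dm \<Omega> m v x) \<bullet> Dm \<Omega> m \<xi> x)
     - (LINT x|lebesgue_on \<Omega>. h x * \<xi> x)"

text \<open>The best constant in \<open>\<parallel>w\<parallel>\<^sub>p \<le> C \<parallel>\<D>\<^sub>m w\<parallel>\<^sub>p\<close>, \<open>w \<in> W\<^sub>0\<^sup>m\<^sup>,\<^sup>p(\<Omega>)\<close>.\<close>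

definition embedding_const :: "'a::euclidean_space set \<Rightarrow> nat \<Rightarrow> real \<Rightarrow> real" where
  "embedding_const \<Omega> m p =
     Inf {C. 0 \<le> C \<and> (\<forall>w\<in>Sobolev0 m p \<Omega>. Lp_norm p \<Omega> w \<le> C * Dm_norm \<Omega> m p w)}"


section \<open>The obstacle problem\<close>

definition admissible ::
  "'a::euclidean_space set \<Rightarrow> nat \<Rightarrow> real \<Rightarrow> ('a \<Rightarrow> real) \<Rightarrow> ('a \<Rightarrow> real) set" where
  "admissible \<Omega> m p \<phi> = {v \<in> Sobolev0 m p \<Omega>. AE x in lebesgue_on \<Omega>. \<phi> x \<le> v x}"

text \<open>The supremum is a real one: for \<open>v \<in> K\<close> and \<open>h \<in> L\<^sup>p\<^sup>'(\<Omega>)\<close> the quotients are bounded by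
  Hoelder's inequality, and \<open>K\<close> is never a singleton as it contains \<open>v + \<psi>\<close> for all test functions
  \<open>\<psi> \<ge> 0\<close>.\<close>

definition dual_residual_norm ::
  "'a::euclidean_space set \<Rightarrow> nat \<Rightarrow> real \<Rightarrow> ('a \<Rightarrow> real) \<Rightarrow> ('a \<Rightarrow> real) \<Rightarrow> ('a \<Rightarrow> real) \<Rightarrow> real"
  where
  "dual_residual_norm \<Omega> m p \<phi> h v =
     (SUP w\<in>{w \<in> admissible \<Omega> m p \<phi>. \<not> (AE x in lebesgue_on \<Omega>. w x = v x)}.
        max 0 (- residual \<Omega> m p h v (\<lambda>x. w x - v x)) / Dm_norm \<Omega> m p (\<lambda>x. w x - v x))"

definition contact_set ::
  "'a::euclidean_space set \<Rightarrow> ('a \<Rightarrow> real) \<Rightarrow> ('a \<Rightarrow> real) \<Rightarrow> 'a set" where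
  "contact_set \<Omega> \<phi> v = {x \<in> \<Omega>. v x = \<phi> x}"

definition noncontact_set ::
  "'a::euclidean_space set \<Rightarrow> ('a \<Rightarrow> real) \<Rightarrow> ('a \<Rightarrow> real) \<Rightarrow> 'a set" where
  "noncontact_set \<Omega> \<phi> v = \<Omega> - contact_set \<Omega> \<phi> v"

text \<open>\<open>Q\<^sub>m\<^sup>*\<close> for \<open>m = 2 k\<close> and for \<open>m = 2 k + 1\<close>, with \<open>q = p'\<close>.\<close>

definition Q_even :: "'a::euclidean_space set \<Rightarrow> nat \<Rightarrow> real \<Rightarrow> ('a \<Rightarrow> real) set" where
  "Q_even \<Omega> k q = {\<eta> \<in> Lp q \<Omega>. \<exists>g\<in>Lp q \<Omega>. has_weak_laplace_power \<Omega> k \<eta> g}"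

definition Q_odd :: "'a::euclidean_space set \<Rightarrow> nat \<Rightarrow> real \<Rightarrow> ('a \<Rightarrow> 'a) set" where
  "Q_odd \<Omega> k q = {\<eta> \<in> Lp q \<Omega>. \<exists>g\<in>Lp q \<Omega>. has_weak_laplace_power_div \<Omega> k \<eta> g}"

definition C3 ::
  "'a::euclidean_space set \<Rightarrow> nat \<Rightarrow> real \<Rightarrow> real \<Rightarrow> ('a \<Rightarrow> real) \<Rightarrow> ('a \<Rightarrow> real) \<Rightarrow> real" where
  "C3 \<Omega> m p q h w =
     max ((p * embedding_const \<Omega> m p * Lp_norm q \<Omega> h + 1) powr (1 / (p - 1)))
         (Dm_norm \<Omega> m p w powr p - p * (LINT x|lebesgue_on \<Omega>. h x * w x))"

end

theory Submission
  imports Defs "HOL-Real_Asymp.Real_Asymp"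
begin

text \<open>Testing the dual norm with \<open>w = u\<close> gives
  \<open>-\<langle>\<Delta>\<^sub>p\<^sup>m v - h, u - v\<rangle> = \<langle>\<Delta>\<^sub>p\<^sup>m u - h, v - u\<rangle> + \<langle>\<Delta>\<^sub>p\<^sup>m u - \<Delta>\<^sub>p\<^sup>m v, u - v\<rangle>\<close>, and the last term is bounded below
  by the pointwise strong monotonicity of \<open>a \<mapsto> |a|\<^sup>p\<^sup>-\<^sup>2 a\<close>. For \<open>p < 2\<close> this pointwise bound carries the
  weight \<open>max(|a|, |b|)\<^sup>p\<^sup>-\<^sup>2\<close>, which Hoelder's inequality turns into \<open>(\<parallel>\<D>\<^sub>m u\<parallel>\<^sup>p + \<parallel>\<D>\<^sub>m v\<parallel>\<^sup>p)\<close> to a negative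
  power; \<open>\<parallel>\<D>\<^sub>m u\<parallel> \<le> C\<^sub>3\<close> because \<open>u\<close> minimises the energy. The upper bounds follow by inserting
  \<open>\<eta>\<^sup>*\<close>, moving the derivatives onto \<open>\<eta>\<^sup>*\<close>, and using that \<open>w - v \<ge> 0\<close> on the contact set.

  The embedding inequality is needed only with some constant. For a test function \<open>\<psi>\<close> and a convex
  \<open>\<Phi>\<close> with \<open>\<Phi>(0) = 0\<close>, integrating \<open>\<Delta>(\<Phi> \<circ> \<psi>) \<ge> \<Phi>'(\<psi>) \<Delta>\<psi>\<close> against \<open>R\<^sup>2 - (x \<bullet> b)\<^sup>2\<close> bounds
  \<open>2 \<integral> \<Phi>(\<psi>)\<close> by \<open>R\<^sup>2 \<integral> |\<Phi>'(\<psi>)| |\<Delta>\<psi>|\<close>; with \<open>\<Phi>\<close> close to \<open>|t|\<^sup>p\<close> this is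
  \<open>\<parallel>\<psi>\<parallel>\<^sub>p \<le> C \<parallel>\<Delta>\<psi>\<parallel>\<^sub>p\<close>.\<close>

text \<open>Weak derivatives are picked by \<open>SOME\<close>, each one separately, so nothing
  about \<open>Dm\<close> holds pointwise; even its linearity is an almost-everywhere fact. The
  fundamental lemma identifies every choice with an explicit representative, a sum of weak partials
  over finitely many lists, and measurability, L^p membership and linearity are then transferred
  along null sets. Facts about W_0 are proved for test functions by classical calculus and carried
  over by density; boundary terms never appear, because the integral of a derivative of a compactly
  supported function vanishes by translation invariance. The weight R^2 - (x . b)^2 is chosen
  because it is nonnegative on the support and has Laplacian -2. Real suprema, infima and quotients
  have conventional values in degenerate cases; hence the separate care for bounded quotients,
  nonempty index sets and a vanishing \<open>Dm_norm\<close>. The vector inequalities behind the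
  lower bounds reduce to scalar ones: with both norms fixed only the angle varies, and the two
  extreme angles suffice.\<close>

section \<open>Scalar inequalities for real powers\<close>

lemma powr_add_superadditive:
  fixes x y r :: real
  assumes "x \<ge> 0" "y \<ge> 0" "r \<ge> 1"
  shows "x powr r + y powr r \<le> (x + y) powr r"
proof (cases "x + y = 0")
  case False
  then have pos: "x + y > 0" using assms by linarith
  \<comment> \<open>The ratio z / (x + y) lies in [0, 1], where raising to a power r >= 1 decreases;
    the ratios for x and y add up to 1.\<close>
  have *: "z powr r \<le> z / (x + y) * (x + y) powr r" if "z \<ge> 0" "z \<le> x + y" for z
  proof -
    have "(z / (x + y)) powr r \<le> (z / (x + y)) powr 1"
      using that pos assms(3) by (intro powr_mono') auto
    then show ?thesis
      using that pos by (simp add: powr_divide field_simps)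
  qed
  have "x powr r + y powr r \<le> (x / (x + y) + y / (x + y)) * (x + y) powr r"
    using *[of x] *[of y] assms by (simp add: distrib_right)
  then show ?thesis
    using pos by (simp flip: add_divide_distrib)
qed (use assms in \<open>simp add: add_nonneg_eq_0_iff\<close>)

text \<open>Convexity is applied to positive arguments; if one argument is 0, the claim reduces to
  \<open>\<mu> powr r \<le> \<mu>\<close> for a weight in [0, 1].\<close>

lemma powr_convex_nonneg:
  fixes x y r \<theta> :: real
  assumes "x \<ge> 0" "y \<ge> 0" "r \<ge> 1" "0 \<le> \<theta>" "\<theta> \<le> 1"
  shows "(\<theta> * x + (1 - \<theta>) * y) powr r \<le> \<theta> * x powr r + (1 - \<theta>) * y powr r"
proof -
  have scale: "(\<mu> * z) powr r \<le> \<mu> * z powr r" if "0 \<le> \<mu>" "\<mu> \<le> 1" "z \<ge> 0" for \<mu> z :: real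
  proof -
    have "\<mu> powr r \<le> \<mu> powr 1" using that assms(3) by (intro powr_mono') auto
    then show ?thesis using that by (simp add: powr_mult mult_right_mono)
  qed
  consider "x = 0" | "y = 0" | "x > 0" "y > 0" using assms by fastforce
  then show ?thesis
  proof cases
    case 1 with scale[of "1 - \<theta>" y] assms show ?thesis by simp
  next
    case 2 with scale[of \<theta> x] assms show ?thesis by simp
  next
    case 3
    then show ?thesis
      using convex_onD[OF powr_convex[OF assms(3)], of "1 - \<theta>" x y] assms by simp
  qed
qed

subsection \<open>Hoelder's and Minkowski's inequalities\<close>

text \<open>Young's inequality for F and G divided by their norms is integrated; a vanishing norm
  makes the product null a.e. and is treated apart. The measure is arbitrary because both
  \<open>lebesgue_on D\<close> and \<open>lborel\<close> occur later.\<close>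

lemma Hoelder_nonneg:
  fixes F G :: "'a \<Rightarrow> real"
  assumes pq: "P > 1" "Q > 1" "1 / P + 1 / Q = 1"
    and [measurable]: "F \<in> borel_measurable M" "G \<in> borel_measurable M"
    and nn: "\<And>x. F x \<ge> 0" "\<And>x. G x \<ge> 0"
    and int: "integrable M (\<lambda>x. F x powr P)" "integrable M (\<lambda>x. G x powr Q)"
  shows "integrable M (\<lambda>x. F x * G x)"
    and "(LINT x|M. F x * G x) \<le> (LINT x|M. F x powr P) powr (1 / P) * (LINT x|M. G x powr Q) powr (1 / Q)"
proof -
  show i: "integrable M (\<lambda>x. F x * G x)"
  proof (rule Bochner_Integration.integrable_bound)
    show "integrable M (\<lambda>x. F x powr P / P + G x powr Q / Q)" using int by simp
    show "AE x in M. norm (F x * G x) \<le> norm (F x powr P / P + G x powr Q / Q)"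
      using Youngs_inequality[OF pq nn(1) nn(2)] nn pq by (auto intro!: AE_I2)
  qed simp
  define A B where "A = (LINT x|M. F x powr P)" and "B = (LINT x|M. G x powr Q)"
  have AB: "A \<ge> 0" "B \<ge> 0" unfolding A_def B_def by simp_all
  show "(LINT x|M. F x * G x) \<le> A powr (1 / P) * B powr (1 / Q)"
  proof (cases "A = 0 \<or> B = 0")
    case True
    have "AE x in M. F x * G x = 0"
    proof (cases "A = 0")
      case True
      then have "AE x in M. F x powr P = 0"
        using integral_nonneg_eq_0_iff_AE[OF int(1)] unfolding A_def by simp
      then show ?thesis by eventually_elim auto
    next
      case False
      with \<open>A = 0 \<or> B = 0\<close> have "AE x in M. G x powr Q = 0"
        using integral_nonneg_eq_0_iff_AE[OF int(2)] unfolding B_def by simp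
      then show ?thesis by eventually_elim auto
    qed
    then have "(LINT x|M. F x * G x) = (LINT x|M. 0)" by (intro integral_cong_AE) auto
    then show ?thesis by simp
  next
    case False
    define a b where "a = A powr (1 / P)" and "b = B powr (1 / Q)"
    have ab: "a > 0" "b > 0" "a powr P = A" "b powr Q = B"
      using False AB pq by (auto simp: a_def b_def powr_powr)
    \<comment> \<open>The majorant integrates to a b (1/P + 1/Q) = a b.\<close>
    have "(LINT x|M. F x * G x) \<le> (LINT x|M. a * b * (F x powr P / (P * A) + G x powr Q / (Q * B)))"
    proof (rule integral_mono[OF i])
      show "F x * G x \<le> a * b * (F x powr P / (P * A) + G x powr Q / (Q * B))" for x
        using Youngs_inequality[OF pq, of "F x / a" "G x / b"] nn ab pq AB False
        by (simp add: powr_divide field_simps)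
    qed (use int in simp)
    also have "\<dots> = a * b * (A / (P * A) + B / (Q * B))"
      using int by (simp add: A_def B_def)
    also have "\<dots> = a * b" using False pq by simp
    finally show ?thesis by (simp add: a_def b_def)
  qed
qed

lemma conjugate_exponent:
  fixes p q :: real
  assumes "p > 1" "q = p / (p - 1)"
  shows "q > 1" "1 / q + 1 / p = 1" "(p - 1) * q = p" "(q - 1) * p = q"
  unfolding assms(2) using assms(1) by (auto simp: field_simps)

context
  fixes D :: "'a::euclidean_space set"
begin

lemma LpD:
  assumes "f \<in> Lp q D"
  shows "f \<in> borel_measurable (lebesgue_on D)" "integrable (lebesgue_on D) (\<lambda>x. norm (f x) powr q)"
  using assms by (auto simp: Lp_def)

lemma Lp_norm_nonneg [simp]: "Lp_norm q D f \<ge> 0"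
  by (simp add: Lp_norm_def)

lemma Lp_norm_powr: "q > 0 \<Longrightarrow> Lp_norm q D f powr q = (LINT x|lebesgue_on D. norm (f x) powr q)"
  by (simp add: Lp_norm_def powr_powr)

lemma Lp_cong_AE:
  assumes "f \<in> Lp q D" "AE x in lebesgue_on D. f x = g x" "g \<in> borel_measurable (lebesgue_on D)"
  shows "g \<in> Lp q D"
proof -
  note LpD[OF assms(1), measurable] assms(3)[measurable]
  have "integrable (lebesgue_on D) (\<lambda>x. norm (g x) powr q)
      \<longleftrightarrow> integrable (lebesgue_on D) (\<lambda>x. norm (f x) powr q)"
    using assms(2) by (intro Bochner_Integration.integrable_cong_AE) auto
  then show ?thesis using assms LpD(2)[OF assms(1)] by (simp add: Lp_def)
qed

lemma Lp_norm_cong_AE: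
  assumes "AE x in lebesgue_on D. norm (f x) = norm (g x)"
    "f \<in> borel_measurable (lebesgue_on D)" "g \<in> borel_measurable (lebesgue_on D)"
  shows "Lp_norm q D f = Lp_norm q D g"
  unfolding Lp_norm_def using assms
  by (intro arg_cong2[where f = "(powr)"] integral_cong_AE) auto

lemma Lp_norm_minus [simp]: "Lp_norm q D (\<lambda>x. - f x) = Lp_norm q D f"
  by (simp add: Lp_norm_def)

lemma Lp_norm_eq_0_iff:
  assumes "f \<in> Lp q D"
  shows "Lp_norm q D f = 0 \<longleftrightarrow> (AE x in lebesgue_on D. f x = 0)"
  using integral_nonneg_eq_0_iff_AE[OF LpD(2)[OF assms]] by (simp add: Lp_norm_def)

lemma Lp_scaleR:
  assumes "f \<in> Lp q D" shows "(\<lambda>x. c *\<^sub>R f x) \<in> Lp q D"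
  using assms by (auto simp: Lp_def powr_mult)

lemma Lp_zero [simp]: "(\<lambda>x. 0) \<in> Lp q D"
  by (simp add: Lp_def)

lemma Lp_norm_zero [simp]: "Lp_norm q D (\<lambda>x. 0) = 0"
  by (simp add: Lp_norm_def)

lemma Lp_add:
  assumes "q \<ge> 1" and f: "f \<in> Lp q D" and g: "g \<in> Lp q D"
  shows "(\<lambda>x. f x + g x) \<in> Lp q D"
proof -
  note [measurable] = LpD(1)[OF f] LpD(1)[OF g]
  have "norm (f x + g x) powr q \<le> 2 powr q * (norm (f x) powr q + norm (g x) powr q)" for x
  proof -
    have "norm (f x + g x) powr q \<le> (norm (f x) + norm (g x)) powr q"
      using assms(1) by (intro powr_mono2) (auto intro: norm_triangle_ineq)
    also have "\<dots> = 2 powr q * (1/2 * norm (f x) + (1 - 1/2) * norm (g x)) powr q"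
      unfolding powr_mult[symmetric] by (rule arg_cong[where f = "\<lambda>x. x powr q"]) simp
    also have "\<dots> \<le> 2 powr q * (1/2 * norm (f x) powr q + (1 - 1/2) * norm (g x) powr q)"
      using assms(1) by (intro mult_left_mono powr_convex_nonneg) auto
    also have "\<dots> \<le> 2 powr q * (norm (f x) powr q + norm (g x) powr q)"
      using powr_ge_zero[of "norm (f x)" q] powr_ge_zero[of "norm (g x)" q]
      by (intro mult_left_mono) (simp_all add: field_simps)
    finally show ?thesis .
  qed
  then have "integrable (lebesgue_on D) (\<lambda>x. norm (f x + g x) powr q)"
    using LpD(2)[OF f] LpD(2)[OF g]
    by (intro Bochner_Integration.integrable_bound[where g = "\<lambda>x. norm (f x + g x) powr q"
          and f = "\<lambda>x. 2 powr q * (norm (f x) powr q + norm (g x) powr q)"] AE_I2) auto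
  then show ?thesis by (simp add: Lp_def)
qed

lemma Lp_diff:
  assumes "q \<ge> 1" "f \<in> Lp q D" "g \<in> Lp q D"
  shows "(\<lambda>x. f x - g x) \<in> Lp q D"
  using Lp_add[OF assms(1,2) Lp_scaleR[OF assms(3), of "-1"]] by simp

lemma Lp_minus: "f \<in> Lp q D \<Longrightarrow> (\<lambda>x. - f x) \<in> Lp q D"
  by (simp add: Lp_def)

lemma Lp_sum:
  assumes "q \<ge> 1" "\<And>i. i \<in> I \<Longrightarrow> f i \<in> Lp q D"
  shows "(\<lambda>x. \<Sum>i\<in>I. f i x) \<in> Lp q D"
  using assms(2)
  by (induction I rule: infinite_finite_induct) (auto intro!: Lp_add[OF assms(1)])

text \<open>With A and B the two norms and s = A + B, the sum f + g is s times the convex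
  combination of f / A and g / B with weights A / s and B / s. Convexity of the q-th power is
  applied pointwise and integrated. A function of norm 0 is null a.e. and is treated apart.\<close>

lemma Minkowski:
  assumes "q \<ge> 1" and f: "f \<in> Lp q D" and g: "g \<in> Lp q D"
  shows "Lp_norm q D (\<lambda>x. f x + g x) \<le> Lp_norm q D f + Lp_norm q D g"
proof -
  note [measurable] = LpD(1)[OF f] LpD(1)[OF g]
  let ?A = "Lp_norm q D f" and ?B = "Lp_norm q D g"
  consider "?A = 0" | "?B = 0" | "?A > 0" "?B > 0"
    by (metis Lp_norm_nonneg order_le_less)
  then show ?thesis
  proof cases
    case 1
    then have "AE x in lebesgue_on D. f x = 0" using Lp_norm_eq_0_iff[OF f] by simp
    then have "Lp_norm q D (\<lambda>x. f x + g x) = ?B" by (intro Lp_norm_cong_AE) auto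
    with 1 show ?thesis by simp
  next
    case 2
    then have "AE x in lebesgue_on D. g x = 0" using Lp_norm_eq_0_iff[OF g] by simp
    then have "Lp_norm q D (\<lambda>x. f x + g x) = ?A" by (intro Lp_norm_cong_AE) auto
    with 2 show ?thesis by simp
  next
    case 3
    define s where "s = ?A + ?B"
    have s: "s > 0" using 3 by (simp add: s_def)
    have le: "norm (f x + g x) powr q \<le> s powr q * (?A / s * (norm (f x) powr q / ?A powr q) + ?B / s * (norm (g x) powr q / ?B powr q))"
      for x
    proof -
      have B: "1 - ?A / s = ?B / s" using s by (simp add: s_def field_simps)
      have "norm (f x + g x) powr q \<le> (s * (?A / s * (norm (f x) / ?A) + (1 - ?A / s) * (norm (g x) / ?B))) powr q"
        unfolding B using assms(1) 3 s
        by (intro powr_mono2) (auto intro: norm_triangle_ineq simp: distrib_left)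
      also have "\<dots> \<le> s powr q * (?A / s * (norm (f x) / ?A) powr q + (1 - ?A / s) * (norm (g x) / ?B) powr q)"
        unfolding powr_mult using assms(1) 3 s
        by (intro mult_left_mono powr_convex_nonneg) (auto simp: s_def)
      finally show ?thesis unfolding B using 3 by (simp add: powr_divide)
    qed
    have "(LINT x|lebesgue_on D. norm (f x + g x) powr q) \<le>
      (LINT x|lebesgue_on D. s powr q * (?A / s * (norm (f x) powr q / ?A powr q) + ?B / s * (norm (g x) powr q / ?B powr q)))"
      using le LpD(2)[OF f] LpD(2)[OF g] LpD(2)[OF Lp_add[OF assms]]
      by (intro integral_mono) auto
    also have "\<dots> = s powr q * (?A / s * (?A powr q / ?A powr q) + ?B / s * (?B powr q / ?B powr q))"
      using LpD(2)[OF f] LpD(2)[OF g] assms(1) by (simp add: Lp_norm_powr)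
    also have "\<dots> = s powr q"
      using 3 s by (simp add: s_def flip: add_divide_distrib)
    finally have "Lp_norm q D (\<lambda>x. f x + g x) \<le> (s powr q) powr (1 / q)"
      unfolding Lp_norm_def using assms(1) by (intro powr_mono2) auto
    then show ?thesis using s assms(1) by (simp add: powr_powr s_def)
  qed
qed

lemma Lp_norm_diff_le:
  assumes "q \<ge> 1" "f \<in> Lp q D" "g \<in> Lp q D"
  shows "Lp_norm q D (\<lambda>x. f x - g x) \<le> Lp_norm q D f + Lp_norm q D g"
  using Minkowski[OF assms(1,2) Lp_minus[OF assms(3)]] by simp

lemma Lp_norm_sum_le:
  assumes "q \<ge> 1" "\<And>i. i \<in> I \<Longrightarrow> f i \<in> Lp q D"
  shows "Lp_norm q D (\<lambda>x. \<Sum>i\<in>I. f i x) \<le> (\<Sum>i\<in>I. Lp_norm q D (f i))"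
  using assms(2)
proof (induction I rule: infinite_finite_induct)
  case (insert i I)
  then show ?case
    using Minkowski[OF assms(1), of "f i" "\<lambda>x. \<Sum>i\<in>I. f i x"] Lp_sum[OF assms(1), of I f] by force
qed auto

lemma Hoelder:
  assumes "p > 1" "q = p / (p - 1)" and f: "f \<in> Lp q D" and g: "g \<in> Lp p D"
  shows "integrable (lebesgue_on D) (\<lambda>x. norm (f x) * norm (g x))"
    and "(LINT x|lebesgue_on D. norm (f x) * norm (g x)) \<le> Lp_norm q D f * Lp_norm p D g"
  unfolding Lp_norm_def
  using conjugate_exponent[OF assms(1,2)] assms(1) LpD[OF f] LpD[OF g]
  by (auto intro!: Hoelder_nonneg[of q p "\<lambda>x. norm (f x)" "lebesgue_on D" "\<lambda>x. norm (g x)"])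

lemma Hoelder_inner:
  fixes f g :: "'a \<Rightarrow> 'b::euclidean_space"
  assumes "p > 1" "q = p / (p - 1)" and f: "f \<in> Lp q D" and g: "g \<in> Lp p D"
  shows "integrable (lebesgue_on D) (\<lambda>x. f x \<bullet> g x)"
    and "\<bar>LINT x|lebesgue_on D. f x \<bullet> g x\<bar> \<le> Lp_norm q D f * Lp_norm p D g"
proof -
  note [measurable] = LpD(1)[OF f] LpD(1)[OF g]
  show i: "integrable (lebesgue_on D) (\<lambda>x. f x \<bullet> g x)"
    by (rule Bochner_Integration.integrable_bound[OF Hoelder(1)[OF assms]])
      (auto intro!: AE_I2 Cauchy_Schwarz_ineq2)
  have "\<bar>LINT x|lebesgue_on D. f x \<bullet> g x\<bar> \<le> (LINT x|lebesgue_on D. \<bar>f x \<bullet> g x\<bar>)"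
    using integral_norm_bound[of "lebesgue_on D" "\<lambda>x. f x \<bullet> g x"] by simp
  also have "\<dots> \<le> (LINT x|lebesgue_on D. norm (f x) * norm (g x))"
    using i Hoelder(1)[OF assms] by (intro integral_mono) (auto intro: Cauchy_Schwarz_ineq2)
  finally show "\<bar>LINT x|lebesgue_on D. f x \<bullet> g x\<bar> \<le> Lp_norm q D f * Lp_norm p D g"
    using Hoelder(2)[OF assms] by linarith
qed

text \<open>The map raises norms to the power p - 1, and (p - 1) q = p.\<close>

lemma pow_dual_Lp:
  fixes f :: "'a \<Rightarrow> 'b::euclidean_space"
  assumes "p > 1" "q = p / (p - 1)" and f: "f \<in> Lp p D"
  shows "(\<lambda>x. pow_dual p (f x)) \<in> Lp q D"
    and "Lp_norm q D (\<lambda>x. pow_dual p (f x)) = Lp_norm p D f powr (p - 1)"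
proof -
  note [measurable] = LpD(1)[OF f]
  have n: "norm (pow_dual p a) = norm a powr (p - 1)" for a :: 'b
  proof (cases "a = 0")
    case False
    have "norm a powr (p - 1) = norm a powr (p - 2) * norm a powr 1"
      unfolding powr_add[symmetric] by simp
    with False show ?thesis by (simp add: pow_dual_def)
  qed (use assms in \<open>simp add: pow_dual_def\<close>)
  have nq: "norm (pow_dual p a) powr q = norm a powr p" for a :: 'b
    unfolding n using conjugate_exponent(3)[OF assms(1,2)] by (simp add: powr_powr)
  have [measurable]: "(\<lambda>x. pow_dual p (f x)) \<in> borel_measurable (lebesgue_on D)"
    unfolding pow_dual_def by measurable
  show "(\<lambda>x. pow_dual p (f x)) \<in> Lp q D"
    using LpD(2)[OF f] by (simp add: Lp_def nq)
  have "1 / q = (p - 1) / p" using assms by simp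
  then show "Lp_norm q D (\<lambda>x. pow_dual p (f x)) = Lp_norm p D f powr (p - 1)"
    by (simp add: Lp_norm_def nq powr_powr)
qed

end

subsection \<open>Monotonicity of the duality map\<close>

text \<open>The weight \<theta> locates \<open>a \<bullet> b\<close> between its Cauchy-Schwarz
  extremes. With the norms fixed, |a - b|^2 is affine in \<open>a \<bullet> b\<close>, so the same
  weight interpolates it between the parallel and the antiparallel value.\<close>

lemma norm_diff_convex_combination:
  fixes a b :: "'b::euclidean_space"
  obtains \<theta> where "0 \<le> \<theta>" "\<theta> \<le> 1"
    "a \<bullet> b = \<theta> * (norm a * norm b) - (1 - \<theta>) * (norm a * norm b)"
    "(norm (a - b))\<^sup>2 = \<theta> * (norm a - norm b)\<^sup>2 + (1 - \<theta>) * (norm a + norm b)\<^sup>2"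
proof -
  define d where "d = norm a * norm b"
  \<comment> \<open>If one vector is 0 the two extremes coincide, and any weight would do.\<close>
  define \<theta> where "\<theta> = (if d = 0 then 1 else (a \<bullet> b + d) / (2 * d))"
  have cs: "\<bar>a \<bullet> b\<bar> \<le> d" unfolding d_def by (rule Cauchy_Schwarz_ineq2)
  have d: "d \<ge> 0" by (simp add: d_def)
  have 1: "0 \<le> \<theta>" "\<theta> \<le> 1" "a \<bullet> b = \<theta> * d - (1 - \<theta>) * d"
    using cs d by (auto simp: \<theta>_def field_simps abs_le_iff)
  have "(norm (a - b))\<^sup>2 = (norm a)\<^sup>2 + (norm b)\<^sup>2 - 2 * (a \<bullet> b)"
    by (simp add: power2_norm_eq_inner inner_diff inner_commute)
  also have "\<dots> = \<theta> * (norm a - norm b)\<^sup>2 + (1 - \<theta>) * (norm a + norm b)\<^sup>2"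
    unfolding 1(3) d_def by (simp add: power2_eq_square algebra_simps)
  finally show thesis using that 1 unfolding d_def by blast
qed

text \<open>For fixed norms of \<open>a\<close> and \<open>b\<close> this is affine in \<open>a \<bullet> b\<close>, so that its lower bounds need only
  be checked for parallel and for antiparallel vectors.\<close>

lemma pow_dual_diff_inner:
  fixes a b :: "'b::euclidean_space"
  assumes "p > 1" "a \<bullet> b = \<theta> * (norm a * norm b) - (1 - \<theta>) * (norm a * norm b)"
  shows "(pow_dual p a - pow_dual p b) \<bullet> (a - b) =
    \<theta> * ((norm a powr (p - 1) - norm b powr (p - 1)) * (norm a - norm b))
      + (1 - \<theta>) * ((norm a powr (p - 1) + norm b powr (p - 1)) * (norm a + norm b))"
proof -
  have e: "s powr (p - 1) = s powr (p - 2) * s" if "s \<ge> 0" for s :: real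
    using that powr_add[of s "p - 2" 1] by (cases "s = 0") auto
  have "(pow_dual p a - pow_dual p b) \<bullet> (a - b) = norm a powr (p - 2) * (norm a)\<^sup>2 + norm b powr (p - 2) * (norm b)\<^sup>2
      - (norm a powr (p - 2) + norm b powr (p - 2)) * (a \<bullet> b)"
    by (simp add: pow_dual_def inner_diff power2_norm_eq_inner inner_commute algebra_simps)
  then show ?thesis
    unfolding assms(2) by (simp add: e power2_eq_square algebra_simps)
qed

text \<open>The left side is convex and the right side affine in the weight \<theta>, so the
  extremes decide. Parallel vectors admit the constant 1; the antiparallel pair b = -a gives
  equality with 2^(2-p).\<close>

lemma pow_dual_monotone_ge_2:
  fixes a b :: "'b::euclidean_space"
  assumes "p \<ge> 2"
  shows "2 powr (2 - p) * norm (a - b) powr p \<le> (pow_dual p a - pow_dual p b) \<bullet> (a - b)"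
proof -
  obtain \<theta> where l: "0 \<le> \<theta>" "\<theta> \<le> 1"
    "a \<bullet> b = \<theta> * (norm a * norm b) - (1 - \<theta>) * (norm a * norm b)"
    "(norm (a - b))\<^sup>2 = \<theta> * (norm a - norm b)\<^sup>2 + (1 - \<theta>) * (norm a + norm b)\<^sup>2"
    by (rule norm_diff_convex_combination)
  define s t where "s = norm a" and "t = norm b"
  have st: "s \<ge> 0" "t \<ge> 0" by (auto simp: s_def t_def)
  have sq: "(x\<^sup>2) powr (p / 2) = \<bar>x\<bar> powr p" for x :: real
  proof -
    have "x\<^sup>2 = \<bar>x\<bar> powr 2" by simp
    then show ?thesis by (simp only: powr_powr) simp
  qed
  \<comment> \<open>The norm is written as a power p / 2 >= 1 of its square, so that the convex
    combination of squares can be pulled apart.\<close>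
  have "norm (a - b) powr p = (\<theta> * (s - t)\<^sup>2 + (1 - \<theta>) * (s + t)\<^sup>2) powr (p / 2)"
    unfolding s_def t_def l(4)[symmetric] sq by simp
  also have "\<dots> \<le> \<theta> * \<bar>s - t\<bar> powr p + (1 - \<theta>) * \<bar>s + t\<bar> powr p"
    using powr_convex_nonneg[of "(s - t)\<^sup>2" "(s + t)\<^sup>2" "p / 2" \<theta>] assms l unfolding sq by simp
  finally have "2 powr (2 - p) * norm (a - b) powr p \<le>
      \<theta> * (2 powr (2 - p) * \<bar>s - t\<bar> powr p) + (1 - \<theta>) * (2 powr (2 - p) * \<bar>s + t\<bar> powr p)"
    by (smt (verit, ccfv_SIG) distrib_left mult.left_commute mult_left_mono powr_ge_zero)
  also have "\<dots> \<le> \<theta> * ((s powr (p - 1) - t powr (p - 1)) * (s - t))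
      + (1 - \<theta>) * ((s powr (p - 1) + t powr (p - 1)) * (s + t))"
  proof (intro add_mono mult_left_mono)
    have e: "z powr p = z powr (p - 1) * z" if "z \<ge> 0" for z :: real
      using that powr_add[of z "p - 1" 1] by (cases "z = 0") auto
    \<comment> \<open>Parallel vectors: superadditivity of the power p - 1 >= 1 for t and s -
      t.\<close>
    have *: "\<bar>s - t\<bar> powr p \<le> (s powr (p - 1) - t powr (p - 1)) * (s - t)" if "s \<ge> t" "t \<ge> 0" for s t
    proof -
      have "(s - t) powr (p - 1) \<le> s powr (p - 1) - t powr (p - 1)"
        using powr_add_superadditive[of t "s - t" "p - 1"] that assms by simp
      then show ?thesis using that by (simp add: e mult_right_mono)
    qed
    have **: "\<bar>s - t\<bar> powr p \<le> (s powr (p - 1) - t powr (p - 1)) * (s - t)"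
      using *[of t s] *[of s t] st by (cases "s \<ge> t") (auto simp: algebra_simps abs_minus_commute)
    have "2 powr (2 - p) * \<bar>s - t\<bar> powr p \<le> 1 * \<bar>s - t\<bar> powr p"
      using assms powr_mono[of "2 - p" 0 2] by (intro mult_right_mono) auto
    with ** show "2 powr (2 - p) * \<bar>s - t\<bar> powr p \<le> (s powr (p - 1) - t powr (p - 1)) * (s - t)"
      by linarith
    \<comment> \<open>Antiparallel vectors: midpoint convexity of the power p - 1 is the origin of
      the factor 2^(2-p).\<close>
    have "((s + t) / 2) powr (p - 1) \<le> 1/2 * s powr (p - 1) + 1/2 * t powr (p - 1)"
      using powr_convex_nonneg[of s t "p - 1" "1/2"] st assms by (simp add: add_divide_distrib)
    then have "2 * (((s + t) / 2) powr (p - 1)) * (s + t) \<le> (s powr (p - 1) + t powr (p - 1)) * (s + t)"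
      using st by (intro mult_right_mono) auto
    moreover have "2 * (((s + t) / 2) powr (p - 1)) = 2 powr (2 - p) * (s + t) powr (p - 1)"
    proof -
      have "2 powr (2 - p) * 2 powr (p - 1) = (2::real)" unfolding powr_add[symmetric] by simp
      then show ?thesis using st by (simp add: powr_divide field_simps)
    qed
    ultimately show "2 powr (2 - p) * \<bar>s + t\<bar> powr p \<le> (s powr (p - 1) + t powr (p - 1)) * (s + t)"
      using st by (simp add: e)
  qed (use l in auto)
  finally show ?thesis
    using pow_dual_diff_inner[OF _ l(3), of p] assms unfolding s_def t_def by simp
qed

text \<open>For p < 2 the map flattens out at infinity, so a decaying weight is unavoidable. By
  symmetry |b| <= |a| may be assumed; both sides are then affine in \<open>a \<bullet> b\<close>,
  and fact A settles parallel, fact B antiparallel vectors.\<close>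

lemma pow_dual_monotone_less_2:
  fixes a b :: "'b::euclidean_space"
  assumes "1 < p" "p < 2"
  shows "(p - 1) * (max (norm a) (norm b) powr (p - 2) * (norm (a - b))\<^sup>2)
    \<le> (pow_dual p a - pow_dual p b) \<bullet> (a - b)"
proof -
  have *: "(p - 1) * (norm a powr (p - 2) * (norm (a - b))\<^sup>2) \<le> (pow_dual p a - pow_dual p b) \<bullet> (a - b)"
    if "norm b \<le> norm a" for a b :: 'b
  proof (cases "a = 0")
    case True
    then show ?thesis using that assms by simp
  next
    case False
    obtain \<theta> where l: "0 \<le> \<theta>" "\<theta> \<le> 1"
      "a \<bullet> b = \<theta> * (norm a * norm b) - (1 - \<theta>) * (norm a * norm b)"
      "(norm (a - b))\<^sup>2 = \<theta> * (norm a - norm b)\<^sup>2 + (1 - \<theta>) * (norm a + norm b)\<^sup>2"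
      by (rule norm_diff_convex_combination)
    define s t where "s = norm a" and "t = norm b"
    have st: "s > 0" "t \<ge> 0" "t \<le> s" using False that by (auto simp: s_def t_def)
    have es: "s powr (p - 1) = s powr (p - 2) * s" using st powr_add[of s "p - 2" 1] by auto
    \<comment> \<open>Concavity of the power p - 1 < 1: its graph lies below the tangent at 1,
      evaluated at t / s. The tangent bound is Young's inequality with weights p - 1 and 2 -
      p.\<close>
    have A: "(p - 1) * s powr (p - 2) * (s - t) \<le> s powr (p - 1) - t powr (p - 1)"
    proof -
      have "(t / s) powr (p - 1) \<le> (p - 1) * (t / s) + (2 - p)"
      proof (cases "t = 0")
        case False
        then show ?thesis
          using Youngs_inequality_0[of "p - 1" "2 - p" "t / s" 1] assms st by simp
      qed (use assms in simp)
      then have "s powr (p - 1) * (t powr (p - 1) / s powr (p - 1)) \<le> s powr (p - 1) * ((p - 1) * (t / s) + (2 - p))"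
        using st by (intro mult_left_mono) (auto simp: powr_divide)
      moreover have "s powr (p - 1) * ((p - 1) * (t / s) + (2 - p))
          = s powr (p - 2) * ((p - 1) * t + (2 - p) * s)"
        using st by (simp add: es field_simps)
      ultimately show ?thesis using st by (simp add: es algebra_simps)
    qed
    \<comment> \<open>The exponent p - 2 is negative, so t <= s makes the (p-2)nd power of t the
      larger one.\<close>
    have B: "(p - 1) * s powr (p - 2) * (s + t) \<le> s powr (p - 1) + t powr (p - 1)"
    proof -
      have "t * s powr (p - 2) \<le> t powr (p - 1)"
      proof (cases "t = 0")
        case False
        then have "s powr (p - 2) \<le> t powr (p - 2)" using st assms by (intro powr_mono2') auto
        then show ?thesis using False st powr_add[of t "p - 2" 1] by (simp add: mult.commute mult_left_mono)
      qed simp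
      then have "s powr (p - 2) * (s + t) \<le> s powr (p - 1) + t powr (p - 1)"
        by (simp add: es algebra_simps)
      moreover have "(p - 1) * (s powr (p - 2) * (s + t)) \<le> 1 * (s powr (p - 2) * (s + t))"
        using assms st by (intro mult_right_mono) auto
      ultimately show ?thesis by (simp add: mult.assoc)
    qed
    have "(p - 1) * (s powr (p - 2) * (norm (a - b))\<^sup>2) =
      \<theta> * ((p - 1) * s powr (p - 2) * (s - t) * (s - t)) + (1 - \<theta>) * ((p - 1) * s powr (p - 2) * (s + t) * (s + t))"
      unfolding l(4) s_def[symmetric] t_def[symmetric] by (simp add: power2_eq_square algebra_simps)
    also have "\<dots> \<le> \<theta> * ((s powr (p - 1) - t powr (p - 1)) * (s - t))
      + (1 - \<theta>) * ((s powr (p - 1) + t powr (p - 1)) * (s + t))"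
      using l st A B by (intro add_mono mult_left_mono mult_right_mono) auto
    finally show ?thesis
      unfolding pow_dual_diff_inner[OF assms(1) l(3)] s_def t_def by simp
  qed
  show ?thesis
  proof (cases "norm b \<le> norm a")
    case True
    with *[of b a] show ?thesis by (simp add: max_absorb1)
  next
    case False
    then have "(p - 1) * (max (norm a) (norm b) powr (p - 2) * (norm (a - b))\<^sup>2)
        \<le> (pow_dual p b - pow_dual p a) \<bullet> (b - a)"
      using *[of a b] by (simp add: max_absorb2 norm_minus_commute)
    also have "\<dots> = (pow_dual p a - pow_dual p b) \<bullet> (a - b)" by (simp add: inner_diff)
    finally show ?thesis .
  qed
qed

text \<open>Let \<sigma> be the larger norm and d the norm of the difference. Hoelder's inequality
  with exponents 2/(2-p) and 2/p is applied to d^p, split into \<sigma>^(p(2-p)/2) and the power p/2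
  of \<sigma>^(p-2) d^2; the pointwise monotonicity controls the integral of the latter
  expression.\<close>

lemma integral_pow_dual_monotone_less_2:
  fixes f g :: "'a::euclidean_space \<Rightarrow> 'b::euclidean_space"
  assumes p: "1 < p" "p < 2" and f: "f \<in> Lp p D" and g: "g \<in> Lp p D"
  shows "(p - 1) * (Lp_norm p D (\<lambda>x. f x - g x))\<^sup>2
    \<le> (Lp_norm p D f powr p + Lp_norm p D g powr p) powr ((2 - p) / p) *
      (LINT x|lebesgue_on D. (pow_dual p (f x) - pow_dual p (g x)) \<bullet> (f x - g x))"
proof -
  let ?M = "lebesgue_on D"
  note [measurable] = LpD(1)[OF f] LpD(1)[OF g]
  define \<sigma> where "\<sigma> x = max (norm (f x)) (norm (g x))" for x
  define d where "d x = norm (f x - g x)" for x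
  define I where "I = (LINT x|?M. (pow_dual p (f x) - pow_dual p (g x)) \<bullet> (f x - g x))"
  have [measurable]: "\<sigma> \<in> borel_measurable ?M" "d \<in> borel_measurable ?M"
    unfolding \<sigma>_def d_def by measurable
  have s0: "\<sigma> x \<ge> 0" for x by (auto simp: \<sigma>_def le_max_iff_disj)
  have sle: "\<sigma> x powr p \<le> norm (f x) powr p + norm (g x) powr p" for x
    by (auto simp: \<sigma>_def max_def)
  have si: "integrable ?M (\<lambda>x. \<sigma> x powr p)"
  proof (rule Bochner_Integration.integrable_bound)
    show "integrable ?M (\<lambda>x. norm (f x) powr p + norm (g x) powr p)"
      using LpD(2)[OF f] LpD(2)[OF g] by simp
    show "AE x in ?M. norm (\<sigma> x powr p) \<le> norm (norm (f x) powr p + norm (g x) powr p)"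
      using sle by (intro AE_I2) (simp only: real_norm_def abs_of_nonneg[OF powr_ge_zero]
          abs_of_nonneg[OF add_nonneg_nonneg[OF powr_ge_zero powr_ge_zero]])
  qed simp
  have Sle: "(LINT x|?M. \<sigma> x powr p) \<le> Lp_norm p D f powr p + Lp_norm p D g powr p"
    using integral_mono[OF si _ sle] LpD(2)[OF f] LpD(2)[OF g] p by (simp add: Lp_norm_powr)
  note pd = pow_dual_Lp(1)[OF p(1) refl f] pow_dual_Lp(1)[OF p(1) refl g]
  have mon: "(p - 1) * (\<sigma> x powr (p - 2) * (d x)\<^sup>2) \<le> (pow_dual p (f x) - pow_dual p (g x)) \<bullet> (f x - g x)" for x
    unfolding \<sigma>_def d_def by (rule pow_dual_monotone_less_2[OF p])
  have ii: "integrable ?M (\<lambda>x. (pow_dual p (f x) - pow_dual p (g x)) \<bullet> (f x - g x))"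
    using p conjugate_exponent(1)[OF p(1) refl]
    by (intro Hoelder_inner(1)[OF p(1) refl] Lp_diff pd f g) auto
  have di': "integrable ?M (\<lambda>x. (p - 1) * (\<sigma> x powr (p - 2) * (d x)\<^sup>2))"
    using mon p by (intro Bochner_Integration.integrable_bound[OF ii]) (auto intro!: AE_I2 order_trans[OF _ abs_ge_self])
  then have di: "integrable ?M (\<lambda>x. \<sigma> x powr (p - 2) * (d x)\<^sup>2)"
    using p integrable_mult_right[OF di', of "inverse (p - 1)"] by simp
  define J where "J = (LINT x|?M. \<sigma> x powr (p - 2) * (d x)\<^sup>2)"
  have JI: "(p - 1) * J \<le> I"
    using integral_mono[OF di' ii mon] by (simp add: I_def J_def)
  have J0: "J \<ge> 0" by (simp add: J_def)
  have exps: "p * (2 - p) / 2 * (2 / (2 - p)) = p" "p / 2 * (2 / p) = 1"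
    and exps': "(2 - p) / 2 * (2 / p) = (2 - p) / p"
    using p by (auto simp: field_simps)
  have "(LINT x|?M. (\<sigma> x powr (p * (2 - p) / 2)) * ((\<sigma> x powr (p - 2) * (d x)\<^sup>2) powr (p / 2)))
    \<le> (LINT x|?M. (\<sigma> x powr (p * (2 - p) / 2)) powr (2 / (2 - p))) powr (1 / (2 / (2 - p)))
      * (LINT x|?M. ((\<sigma> x powr (p - 2) * (d x)\<^sup>2) powr (p / 2)) powr (2 / p)) powr (1 / (2 / p))"
    using p si di s0 by (intro Hoelder_nonneg(2)) (simp_all add: powr_powr exps, simp add: field_simps)
  also have "(\<lambda>x. (\<sigma> x powr (p * (2 - p) / 2)) * ((\<sigma> x powr (p - 2) * (d x)\<^sup>2) powr (p / 2))) = (\<lambda>x. d x powr p)"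
  proof
    fix x
    show "(\<sigma> x powr (p * (2 - p) / 2)) * ((\<sigma> x powr (p - 2) * (d x)\<^sup>2) powr (p / 2)) = d x powr p"
    \<comment> \<open>Where \<sigma> vanishes, so do f, g and d, and \<open>powr\<close> with base 0
      gives 0; elsewhere the powers of \<sigma> cancel.\<close>
    proof (cases "\<sigma> x = 0")
      case True
      then have "f x = 0" "g x = 0"
        by (metis \<sigma>_def max.cobounded1 max.cobounded2 norm_le_zero_iff)+
      then show ?thesis using True p by (simp add: d_def)
    next
      case False
      have "(\<sigma> x powr (p - 2) * (d x)\<^sup>2) powr (p / 2) = \<sigma> x powr ((p - 2) * (p / 2)) * d x powr p"
        by (simp add: d_def powr_mult powr_powr flip: powr_numeral)
      moreover have "\<sigma> x powr (p * (2 - p) / 2) * \<sigma> x powr ((p - 2) * (p / 2)) = 1"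
        using False p by (simp flip: powr_add add: field_simps)
      ultimately show ?thesis by (simp flip: mult.assoc)
    qed
  qed
  also have "(\<lambda>x. (\<sigma> x powr (p * (2 - p) / 2)) powr (2 / (2 - p))) = (\<lambda>x. \<sigma> x powr p)"
    by (simp only: powr_powr exps)
  also have "(\<lambda>x. ((\<sigma> x powr (p - 2) * (d x)\<^sup>2) powr (p / 2)) powr (2 / p)) = (\<lambda>x. \<sigma> x powr (p - 2) * (d x)\<^sup>2)"
    using p by (simp add: powr_powr exps)
  finally have H: "(LINT x|?M. d x powr p) \<le> (LINT x|?M. \<sigma> x powr p) powr ((2 - p) / 2) * J powr (p / 2)"
    by (simp add: J_def)
  have "(Lp_norm p D (\<lambda>x. f x - g x))\<^sup>2 = (LINT x|?M. d x powr p) powr (2 / p)"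
    by (simp add: Lp_norm_def d_def powr_powr flip: powr_numeral)
  also have "\<dots> \<le> ((LINT x|?M. \<sigma> x powr p) powr ((2 - p) / 2) * J powr (p / 2)) powr (2 / p)"
    using H p by (intro powr_mono2) auto
  also have "\<dots> = (LINT x|?M. \<sigma> x powr p) powr ((2 - p) / p) * J"
    using p J0 by (simp add: powr_mult powr_powr exps exps' del: times_divide_eq_right times_divide_eq_left)
  also have "\<dots> \<le> (Lp_norm p D f powr p + Lp_norm p D g powr p) powr ((2 - p) / p) * J"
    using Sle p J0 by (intro mult_right_mono powr_mono2) auto
  finally have "(p - 1) * (Lp_norm p D (\<lambda>x. f x - g x))\<^sup>2 \<le>
      (Lp_norm p D f powr p + Lp_norm p D g powr p) powr ((2 - p) / p) * ((p - 1) * J)"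
    using p by (simp add: mult_left_mono mult.left_commute)
  also have "\<dots> \<le> (Lp_norm p D f powr p + Lp_norm p D g powr p) powr ((2 - p) / p) * I"
    using JI by (intro mult_left_mono) auto
  finally show ?thesis by (simp add: I_def)
qed

subsection \<open>Smooth functions\<close>

lemma has_derivative_partial:
  assumes "(f has_derivative f') (at x)"
  shows "partial b f x = f' b"
  using frechet_derivative_at[OF assms] by (simp add: partial_def)

lemma differentiable_at_frechet:
  assumes "f differentiable_on UNIV"
  shows "(f has_derivative frechet_derivative f (at x)) (at x)"
  using assms by (simp add: differentiable_on_def frechet_derivative_works)

lemma partial_add:
  assumes "f differentiable_on UNIV" "g differentiable_on UNIV"
  shows "partial b (\<lambda>x. f x + g x) = (\<lambda>x. partial b f x + partial b g x)"
  by (rule ext, rule has_derivative_partial[THEN trans])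
    (auto intro!: has_derivative_add differentiable_at_frechet assms simp: partial_def)

lemma partial_mult:
  assumes "f differentiable_on UNIV" "g differentiable_on UNIV"
  shows "partial b (\<lambda>x. f x * g x) = (\<lambda>x. f x * partial b g x + partial b f x * g x)"
  by (rule ext, rule has_derivative_partial[THEN trans])
    (auto intro!: has_derivative_mult differentiable_at_frechet assms simp: partial_def)

lemma partial_const: "partial b (\<lambda>x. c) = (\<lambda>x. 0)"
  by (rule ext, rule has_derivative_partial) (rule has_derivative_const)

lemma partials_snoc: "partials (bs @ [b]) f = partials bs (partial b f)"
  by (simp add: partials_def)

lemma partials_Cons: "partials (b # bs) f = partial b (partials bs f)"
  by (simp add: partials_def)

lemma partials_Nil [simp]: "partials [] f = f"
  by (simp add: partials_def)

section \<open>Closure properties of smooth functions\<close>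

inductive_set function_algebra :: "('a::euclidean_space \<Rightarrow> real) set \<Rightarrow> ('a \<Rightarrow> real) set"
  for G where
    gen: "g \<in> G \<Longrightarrow> g \<in> function_algebra G"
  | const: "(\<lambda>x. c) \<in> function_algebra G"
  | add: "f \<in> function_algebra G \<Longrightarrow> g \<in> function_algebra G \<Longrightarrow> (\<lambda>x. f x + g x) \<in> function_algebra G"
  | mult: "f \<in> function_algebra G \<Longrightarrow> g \<in> function_algebra G \<Longrightarrow> (\<lambda>x. f x * g x) \<in> function_algebra G"

text \<open>The sum and product rules keep partial derivatives inside the algebra once those of the
  generators are there, so every iterated partial stays inside and is differentiable. The generators
  are later all smooth functions, which gives closure under sums and products, or the functions
  \<open>flat\<close> composed with affine maps.\<close>

lemma function_algebra_smooth:
  assumes diff: "\<And>g. g \<in> G \<Longrightarrow> g differentiable_on UNIV"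
    and part: "\<And>g b. g \<in> G \<Longrightarrow> b \<in> Basis \<Longrightarrow> partial b g \<in> function_algebra G"
    and f: "f \<in> function_algebra G"
  shows "smooth f"
proof -
  have d: "g differentiable_on UNIV" if "g \<in> function_algebra G" for g
    using that by induction (auto intro: diff differentiable_on_add differentiable_on_mult)
  have p: "partial b g \<in> function_algebra G" if "g \<in> function_algebra G" "b \<in> Basis" for b g
    using that
  proof induction
    case (mult f g)
    then show ?case unfolding partial_mult[OF mult(1,2)[THEN d]]
      by (intro function_algebra.add function_algebra.mult)
  next
    case (add f g)
    then show ?case unfolding partial_add[OF add(1,2)[THEN d]]
      by (intro function_algebra.add)
  qed (auto simp: partial_const intro: part function_algebra.const)
  have "partials bs f \<in> function_algebra G" if "set bs \<subseteq> Basis" for bs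
    using that by (induction bs) (auto simp: partials_Cons intro: p f)
  then show ?thesis unfolding smooth_def using d by blast
qed

lemma smooth_partial:
  assumes "smooth f" "b \<in> Basis"
  shows "smooth (partial b f)"
  using assms unfolding smooth_def by (auto simp flip: partials_snoc)

lemma smooth_differentiable:
  assumes "smooth f"
  shows "f differentiable_on UNIV"
  using assms unfolding smooth_def by (metis empty_set empty_subsetI partials_Nil)

lemma smooth_continuous:
  assumes "smooth f"
  shows "continuous_on S f"
  using smooth_differentiable[OF assms] differentiable_imp_continuous_on continuous_on_subset by blast

lemma smooth_DERIV:
  assumes "smooth f"
  shows "((\<lambda>t. f (x + t *\<^sub>R b)) has_real_derivative partial b f (x + t *\<^sub>R b)) (at t)"
proof -
  have "((\<lambda>t. f (x + t *\<^sub>R b)) has_derivative (\<lambda>h. frechet_derivative f (at (x + t *\<^sub>R b)) (h *\<^sub>R b))) (at t)"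
    by (rule has_derivative_compose[OF _ differentiable_at_frechet[OF smooth_differentiable[OF assms]]])
      (auto intro!: derivative_eq_intros)
  moreover have "linear (frechet_derivative f (at y))" for y
    using differentiable_at_frechet[OF smooth_differentiable[OF assms]] has_derivative_linear by blast
  ultimately show ?thesis
    by (simp add: has_field_derivative_def partial_def linear_cmul mult_commute_abs)
qed

lemma smooth_algebra:
  assumes "f \<in> function_algebra (Collect smooth)"
  shows "smooth f"
  using assms
  by (intro function_algebra_smooth) (auto intro: smooth_differentiable smooth_partial function_algebra.gen)

lemma smooth_const [simp]: "smooth (\<lambda>x. c)"
  by (intro smooth_algebra function_algebra.intros)

lemma smooth_add: "smooth f \<Longrightarrow> smooth g \<Longrightarrow> smooth (\<lambda>x. f x + g x)"
  by (intro smooth_algebra function_algebra.intros) auto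

lemma smooth_mult: "smooth f \<Longrightarrow> smooth g \<Longrightarrow> smooth (\<lambda>x. f x * g x)"
  by (intro smooth_algebra function_algebra.intros) auto

lemma smooth_sum: "(\<And>i. i \<in> I \<Longrightarrow> smooth (f i)) \<Longrightarrow> smooth (\<lambda>x. \<Sum>i\<in>I. f i x)"
  by (induction I rule: infinite_finite_induct) (auto intro: smooth_add)

lemma smooth_prod: "(\<And>i. i \<in> I \<Longrightarrow> smooth (f i)) \<Longrightarrow> smooth (\<lambda>x. \<Prod>i\<in>I. f i x)"
  by (induction I rule: infinite_finite_induct) (auto intro: smooth_mult)

lemma smooth_partials: "smooth f \<Longrightarrow> set bs \<subseteq> Basis \<Longrightarrow> smooth (partials bs f)"
  by (induction bs) (auto simp: partials_Cons smooth_partial)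

lemma partial_sum:
  assumes "\<And>i. i \<in> I \<Longrightarrow> smooth (f i)"
  shows "partial b (\<lambda>x. \<Sum>i\<in>I. f i x) = (\<lambda>x. \<Sum>i\<in>I. partial b (f i) x)"
  using assms
  by (induction I rule: infinite_finite_induct)
    (auto simp: partial_const partial_add smooth_differentiable smooth_sum)

lemma smooth_laplace:
  assumes "smooth f" shows "smooth (laplace f)"
proof -
  have "laplace f = (\<lambda>x. \<Sum>b\<in>Basis. partial b (partial b f) x)"
    by (simp add: laplace_def fun_eq_iff)
  then show ?thesis using assms by (auto intro!: smooth_sum smooth_partial)
qed

lemma smooth_laplace_power: "smooth f \<Longrightarrow> smooth ((laplace ^^ k) f)"
  by (induction k) (auto intro: smooth_laplace)

subsection \<open>Test functions\<close>

text \<open>A compact superset of the support replaces the closure itself; for sums and products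
  such sets are read off at once.\<close>

lemma test_functions_iff:
  "\<psi> \<in> test_functions U \<longleftrightarrow> smooth \<psi> \<and> (\<exists>K. compact K \<and> K \<subseteq> U \<and> (\<forall>x. x \<notin> K \<longrightarrow> \<psi> x = 0))"
proof (intro iffI conjI)
  assume *: "smooth \<psi> \<and> (\<exists>K. compact K \<and> K \<subseteq> U \<and> (\<forall>x. x \<notin> K \<longrightarrow> \<psi> x = 0))"
  then obtain K where K: "compact K" "K \<subseteq> U" "{x. \<psi> x \<noteq> 0} \<subseteq> K" by blast
  then have "closure {x. \<psi> x \<noteq> 0} \<subseteq> K" by (simp add: closure_minimal compact_imp_closed)
  with K * show "\<psi> \<in> test_functions U"
    using compact_Int_closed[of K "closure {x. \<psi> x \<noteq> 0}"] by (auto simp: test_functions_def Int_absorb1)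
next
  assume "\<psi> \<in> test_functions U"
  then show "\<exists>K. compact K \<and> K \<subseteq> U \<and> (\<forall>x. x \<notin> K \<longrightarrow> \<psi> x = 0)"
    using closure_subset[of "{x. \<psi> x \<noteq> 0}"]
    by (intro exI[of _ "closure {x. \<psi> x \<noteq> 0}"]) (auto simp: test_functions_def)
qed (simp add: test_functions_def)

lemma test_functionsE:
  assumes "\<psi> \<in> test_functions U"
  obtains K where "smooth \<psi>" "compact K" "K \<subseteq> U" "\<And>x. x \<notin> K \<Longrightarrow> \<psi> x = 0"
  using assms unfolding test_functions_iff by blast

lemma test_functions_smooth: "\<psi> \<in> test_functions U \<Longrightarrow> smooth \<psi>"
  by (simp add: test_functions_def)

lemma partial_outside_support:
  assumes "closed K" "\<And>x. x \<notin> K \<Longrightarrow> f x = 0" "x \<notin> K"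
  shows "partial b f x = 0"
proof -
  have "((\<lambda>x. 0::real) has_derivative (\<lambda>h. 0)) (at x)" by simp
  then have "(f has_derivative (\<lambda>h. 0)) (at x)"
    by (rule has_derivative_transform_within_open[of _ _ _ _ "- K"]) (use assms in auto)
  then show ?thesis by (simp add: has_derivative_partial)
qed

lemma test_functions_zero [simp]: "(\<lambda>x. 0) \<in> test_functions U"
  by (auto simp: test_functions_def)

lemma test_functions_add:
  assumes "f \<in> test_functions U" "g \<in> test_functions U"
  shows "(\<lambda>x. f x + g x) \<in> test_functions U"
proof -
  obtain K L where "smooth f" "compact K" "K \<subseteq> U" "\<And>x. x \<notin> K \<Longrightarrow> f x = 0"
    "smooth g" "compact L" "L \<subseteq> U" "\<And>x. x \<notin> L \<Longrightarrow> g x = 0"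
    using assms by (elim test_functionsE) blast
  then show ?thesis unfolding test_functions_iff
    by (intro conjI smooth_add exI[of _ "K \<union> L"]) auto
qed

lemma test_functions_mult:
  assumes "smooth f" "g \<in> test_functions U"
  shows "(\<lambda>x. f x * g x) \<in> test_functions U"
  using assms unfolding test_functions_iff by (auto intro: smooth_mult)

lemma test_functions_diff:
  assumes "f \<in> test_functions U" "g \<in> test_functions U"
  shows "(\<lambda>x. f x - g x) \<in> test_functions U"
  using test_functions_add[OF assms(1) test_functions_mult[of "\<lambda>x. -1", OF _ assms(2)]] by simp

lemma test_functions_sum:
  "(\<And>i. i \<in> I \<Longrightarrow> f i \<in> test_functions U) \<Longrightarrow> (\<lambda>x. \<Sum>i\<in>I. f i x) \<in> test_functions U"
  by (induction I rule: infinite_finite_induct) (auto intro: test_functions_add)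

lemma test_functions_partial:
  assumes "f \<in> test_functions U" "b \<in> Basis"
  shows "partial b f \<in> test_functions U"
proof -
  obtain K where K: "smooth f" "compact K" "K \<subseteq> U" "\<And>x. x \<notin> K \<Longrightarrow> f x = 0"
    using assms by (elim test_functionsE) blast
  then show ?thesis unfolding test_functions_iff
    using partial_outside_support[OF compact_imp_closed[OF K(2)], of f] assms(2)
    by (intro conjI smooth_partial exI[of _ K]) auto
qed

lemma test_functions_partials:
  "f \<in> test_functions U \<Longrightarrow> set bs \<subseteq> Basis \<Longrightarrow> partials bs f \<in> test_functions U"
  by (induction bs) (auto simp: partials_Cons test_functions_partial)

lemma test_functions_laplace:
  assumes "f \<in> test_functions U"
  shows "laplace f \<in> test_functions U"
proof -
  have "laplace f = (\<lambda>x. \<Sum>b\<in>Basis. partial b (partial b f) x)"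
    by (simp add: laplace_def fun_eq_iff)
  then show ?thesis using assms by (auto intro!: test_functions_sum test_functions_partial)
qed

lemma test_functions_laplace_power:
  "f \<in> test_functions U \<Longrightarrow> (laplace ^^ k) f \<in> test_functions U"
  by (induction k) (auto intro: test_functions_laplace)

subsection \<open>Bump functions\<close>

text \<open>The standard flat function exp(-1/t) is the case j = 0. The powers of 1/t are included
  because differentiation produces them: the family over all j is closed under it up to linear
  combinations.\<close>

definition flat :: "nat \<Rightarrow> real \<Rightarrow> real" where
  "flat j t = (if t > 0 then (1 / t) ^ j * exp (- (1 / t)) else 0)"

text \<open>With s = 1/t the right-hand limit is that of s^j / exp s at infinity.\<close>

lemma flat_at_0: "(flat j \<longlongrightarrow> 0) (at 0)"
proof -
  have "filterlim (\<lambda>t::real. 1 / t) at_top (at_right 0)" by real_asymp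
  from filterlim_compose[OF tendsto_power_div_exp_0 this]
  have "((\<lambda>t::real. (1 / t) ^ j / exp (1 / t)) \<longlongrightarrow> 0) (at_right 0)" .
  moreover have "eventually (\<lambda>t. (1 / t) ^ j / exp (1 / t) = flat j t) (at_right 0)"
    by (auto simp: flat_def exp_minus field_simps eventually_at_right_less intro!: eventually_mono[OF eventually_at_right_less])
  ultimately have "(flat j \<longlongrightarrow> 0) (at_right 0)" by (rule Lim_transform_eventually)
  moreover have "eventually (\<lambda>t. 0 = flat j t) (at_left 0)"
    by (auto simp: flat_def eventually_at_left_field intro!: exI[of _ "-1"])
  then have "(flat j \<longlongrightarrow> 0) (at_left 0)"
    using Lim_transform_eventually tendsto_const by blast
  ultimately show ?thesis by (simp add: filterlim_split_at)
qed

lemma flat_DERIV: "(flat j has_real_derivative (flat (j + 2) t - real j * flat (j + 1) t)) (at t)"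
proof -
  consider "t > 0" | "t < 0" | "t = 0" by linarith
  then show ?thesis
  proof cases
    case 1
    have inv: "((\<lambda>t. 1 / t) has_real_derivative - ((1 / t)\<^sup>2)) (at t)"
      using 1 by (auto intro!: derivative_eq_intros simp: power2_eq_square)
    have "((\<lambda>t. (1 / t) ^ j * exp (- (1 / t))) has_real_derivative
        (1 / t) ^ j * (exp (- (1 / t)) * (1 / t)\<^sup>2)
          + real j * (- ((1 / t)\<^sup>2) * (1 / t) ^ (j - Suc 0)) * exp (- (1 / t))) (at t)"
      using DERIV_mult[OF DERIV_power[OF inv, of j] DERIV_fun_exp[OF DERIV_minus[OF inv]]]
      by (simp add: mult_ac)
    \<comment> \<open>For j = 0 the truncated exponent \<open>j - Suc 0\<close> is harmless because
      of the factor \<open>real j\<close>.\<close>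
    also have "(1 / t) ^ j * (exp (- (1 / t)) * (1 / t)\<^sup>2)
          + real j * (- ((1 / t)\<^sup>2) * (1 / t) ^ (j - Suc 0)) * exp (- (1 / t))
        = flat (j + 2) t - real j * flat (j + 1) t"
      using 1 by (cases j) (auto simp: flat_def power2_eq_square algebra_simps)
    finally have "((\<lambda>t. (1 / t) ^ j * exp (- (1 / t))) has_real_derivative (flat (j + 2) t - real j * flat (j + 1) t)) (at t)" .
    then show ?thesis
      by (rule has_field_derivative_transform_within_open[of _ _ _ "{0<..}"]) (use 1 in \<open>auto simp: flat_def\<close>)
  next
    case 2
    have "((\<lambda>t. 0) has_real_derivative (flat (j + 2) t - real j * flat (j + 1) t)) (at t)"
      using 2 by (simp add: flat_def)
    then show ?thesis
      by (rule has_field_derivative_transform_within_open[of _ _ _ "{..<0}"]) (use 2 in \<open>auto simp: flat_def\<close>)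
  next
    case 3
    \<comment> \<open>At 0 the difference quotient is itself a member of the family, so its limit is
      already known; at h = 0 both sides are 0 by the convention for division.\<close>
    have "flat (j + 1) = (\<lambda>h. (flat j (0 + h) - flat j 0) / h)"
      by (auto simp: flat_def fun_eq_iff)
    with flat_at_0[of "j + 1"] have "((\<lambda>h. (flat j (0 + h) - flat j 0) / h) \<longlongrightarrow> 0) (at 0)" by simp
    with 3 show ?thesis by (simp add: DERIV_def flat_def)
  qed
qed

lemma smooth_flat_affine: "smooth (\<lambda>x::'a::euclidean_space. flat j (c \<bullet> x + d))"
proof -
  \<comment> \<open>All j are generators at once, since differentiating a single
    \<open>flat j\<close> leaves that index.\<close>
  define G where "G = {g. \<exists>j c d. g = (\<lambda>x::'a. flat j (c \<bullet> x + d))}"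
  have hd: "((\<lambda>x::'a. flat j (c \<bullet> x + d)) has_derivative
      (\<lambda>h. (flat (j + 2) (c \<bullet> x + d) - real j * flat (j + 1) (c \<bullet> x + d)) * (c \<bullet> h))) (at x)" for j c d x
    by (rule has_derivative_compose[OF _ flat_DERIV[unfolded has_field_derivative_def]])
      (auto intro!: derivative_eq_intros)
  show ?thesis
  proof (rule function_algebra_smooth[of G])
    show "g differentiable_on UNIV" if "g \<in> G" for g
      using that hd unfolding G_def differentiable_on_def differentiable_def by blast
    show "partial b g \<in> function_algebra G" if "g \<in> G" for g b
    proof -
      obtain j c d where g: "g = (\<lambda>x. flat j (c \<bullet> x + d))" using \<open>g \<in> G\<close> unfolding G_def by blast
      have "partial b g = (\<lambda>x. (flat (j + 2) (c \<bullet> x + d) + (- real j) * flat (j + 1) (c \<bullet> x + d)) * (c \<bullet> b))"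
        by (simp add: fun_eq_iff g has_derivative_partial[OF hd])
      also have "\<dots> \<in> function_algebra G"
        by (intro function_algebra.intros) (auto simp: G_def)
      finally show ?thesis .
    qed
  qed (auto intro!: function_algebra.gen simp: G_def)
qed

text \<open>Increasing n drives each \<open>flat 0\<close> factor to 1 inside the open box, so these
  functions converge to its indicator while staying in [0, 1]. This feeds dominated convergence in
  \<open>fundamental_lemma\<close>; the case n = 1 serves as a perturbation of v.\<close>

definition box_bump :: "nat \<Rightarrow> 'a::euclidean_space \<Rightarrow> 'a \<Rightarrow> 'a \<Rightarrow> real" where
  "box_bump n a b x =
     (\<Prod>i\<in>Basis. flat 0 (real n * (x \<bullet> i - a \<bullet> i)) * flat 0 (real n * (b \<bullet> i - x \<bullet> i)))"

lemma flat_0_bounds: "0 \<le> flat 0 t" "flat 0 t \<le> 1" "flat 0 t > 0 \<longleftrightarrow> t > 0"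
  by (auto simp: flat_def)

lemma box_bump_bounds: "0 \<le> box_bump n a b x" "box_bump n a b x \<le> 1"
  by (auto simp: box_bump_def flat_0_bounds intro!: prod_nonneg prod_le_1 mult_le_one)

lemma box_bump_pos: "n > 0 \<Longrightarrow> x \<in> box a b \<Longrightarrow> box_bump n a b x > 0"
  by (auto simp: box_bump_def flat_0_bounds mem_box intro!: prod_pos)

lemma box_bump_zero: "x \<notin> box a b \<Longrightarrow> box_bump n a b x = 0"
  by (force simp: box_bump_def mem_box flat_def prod_zero_iff mult_le_0_iff zero_less_mult_iff)

lemma box_bump_smooth: "smooth (box_bump n a b)"
proof -
  have *: "smooth (\<lambda>x. flat 0 (real n * (x \<bullet> i - a \<bullet> i)))" "smooth (\<lambda>x. flat 0 (real n * (b \<bullet> i - x \<bullet> i)))" for i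
    using smooth_flat_affine[of 0 "real n *\<^sub>R i" "- real n * (a \<bullet> i)"]
      smooth_flat_affine[of 0 "- real n *\<^sub>R i" "real n * (b \<bullet> i)"]
    by (simp_all add: algebra_simps inner_commute)
  have "box_bump n a b = (\<lambda>x. \<Prod>i\<in>Basis. flat 0 (real n * (x \<bullet> i - a \<bullet> i)) * flat 0 (real n * (b \<bullet> i - x \<bullet> i)))"
    by (simp add: fun_eq_iff box_bump_def)
  with * show ?thesis by (auto intro!: smooth_prod smooth_mult)
qed

lemma box_bump_test_function:
  assumes "cbox a b \<subseteq> U"
  shows "box_bump n a b \<in> test_functions U"
  unfolding test_functions_iff
  using assms box_bump_zero[of _ a b n] box_subset_cbox[of a b]
  by (intro conjI box_bump_smooth exI[of _ "cbox a b"]) auto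

lemma box_bump_tendsto: "(\<lambda>n. box_bump n a b x) \<longlonglongrightarrow> indicator (box a b) x"
proof (cases "x \<in> box a b")
  case True
  have f: "(\<lambda>n. flat 0 (real n * t)) \<longlonglongrightarrow> 1" if "t > 0" for t
  proof (rule Lim_transform_eventually)
    show "(\<lambda>n. exp (- (1 / (real n * t)))) \<longlonglongrightarrow> 1" using that by real_asymp
    show "eventually (\<lambda>n. exp (- (1 / (real n * t))) = flat 0 (real n * t)) sequentially"
      using eventually_gt_at_top[of 0] by eventually_elim (use that in \<open>simp add: flat_def\<close>)
  qed
  have "(\<lambda>n. box_bump n a b x) \<longlonglongrightarrow> (\<Prod>i\<in>(Basis::'a set). 1 * 1)"
    unfolding box_bump_def using True by (intro tendsto_prod tendsto_mult f) (auto simp: mem_box)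
  with True show ?thesis by simp
qed (simp add: box_bump_zero)

subsection \<open>Integration by parts\<close>

lemma compactly_supported_integrable:
  fixes f :: "'a::euclidean_space \<Rightarrow> real"
  assumes "continuous_on UNIV f" "bounded S" "\<And>x. x \<notin> S \<Longrightarrow> f x = 0"
  shows "integrable lborel f"
proof -
  have "integrable lborel (\<lambda>x. indicator (closure S) x *\<^sub>R f x)"
    using assms by (intro borel_integrable_compact) (auto intro: continuous_on_subset)
  also have "(\<lambda>x. indicator (closure S) x *\<^sub>R f x) = f"
    using assms(3) closure_subset[of S] by (force simp: indicator_def)
  finally show ?thesis .
qed

text \<open>This replaces the divergence theorem. Difference quotients along b integrate to 0 by
  translation invariance, and they converge to the derivative under an integrable majorant.\<close>

lemma integral_directional_derivative:
  fixes F :: "'a::euclidean_space \<Rightarrow> real"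
  assumes cont: "continuous_on UNIV F" "continuous_on UNIV F'"
    and bdd: "bounded S" "\<And>x. x \<notin> S \<Longrightarrow> F x = 0" "\<And>x. x \<notin> S \<Longrightarrow> F' x = 0"
    and deriv: "\<And>x. ((\<lambda>t. F (x + t *\<^sub>R b)) has_real_derivative F' x) (at 0)"
  shows "(LINT x|lborel. F' x) = 0"
proof -
  obtain R where R: "R > 0" "\<And>x. x \<in> S \<Longrightarrow> norm x \<le> R"
    using bdd(1) by (meson bounded_pos)
  have "bounded (F' ` closure S)"
    using bdd(1) cont(2) by (intro compact_imp_bounded compact_continuous_image) (auto intro: continuous_on_subset)
  then obtain B where B: "B > 0" "\<And>x. x \<in> S \<Longrightarrow> \<bar>F' x\<bar> \<le> B"
    using closure_subset[of S] by (auto simp: bounded_pos)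
  have B': "\<bar>F' x\<bar> \<le> B" for x using B bdd(3)[of x] by (cases "x \<in> S") auto
  have D: "((\<lambda>t. F (x + t *\<^sub>R b)) has_real_derivative F' (x + t *\<^sub>R b)) (at t)" for x t
    using deriv[of "x + t *\<^sub>R b"] DERIV_shift[of "\<lambda>s. F (x + s *\<^sub>R b)" "F' (x + t *\<^sub>R b)" 0 t]
    by (simp add: algebra_simps)
  \<comment> \<open>The mean value theorem bounds the quotients uniformly in n.\<close>
  have lip: "\<bar>F (x + h *\<^sub>R b) - F x\<bar> \<le> h * B" if "h > 0" for x h
  proof -
    obtain z where "F (x + h *\<^sub>R b) - F (x + 0 *\<^sub>R b) = (h - 0) * F' (x + z *\<^sub>R b)"
      using MVT2[OF \<open>h > 0\<close>, of "\<lambda>t. F (x + t *\<^sub>R b)" "\<lambda>t. F' (x + t *\<^sub>R b)"] D by blast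
    then show ?thesis using B' that by (simp add: abs_mult)
  qed
  define s where "s n x = real (Suc n) * (F (x + (1 / real (Suc n)) *\<^sub>R b) - F x)" for n x
  have Fi: "integrable lborel F" by (rule compactly_supported_integrable[OF cont(1) bdd(1,2)])
  have [measurable]: "F \<in> borel_measurable borel" "F' \<in> borel_measurable borel"
    using cont by (auto intro: borel_measurable_continuous_onI)
  have s0: "(LINT x|lborel. s n x) = 0" for n
  proof -
    define c where "c = (1 / real (Suc n)) *\<^sub>R b"
    have "integrable lborel (\<lambda>x. F (c + x))"
      using Fi lborel_distr_plus[of c] integrable_distr_eq[of "(+) c" lborel borel F] by simp
    moreover have "(LINT x|lborel. F (c + x)) = (LINT x|lborel. F x)"
      using lborel_distr_plus[of c] integral_distr[of "(+) c" lborel borel F] by simp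
    ultimately show ?thesis using Fi by (simp add: s_def c_def add.commute)
  qed
  have "(\<lambda>n. LINT x|lborel. s n x) \<longlonglongrightarrow> (LINT x|lborel. F' x)"
  proof (rule integral_dominated_convergence)
    \<comment> \<open>The steps 1 / Suc n are at most 1, so every quotient vanishes outside the
      enlarged ball.\<close>
    show "integrable lborel (\<lambda>x::'a. B * indicator (cball 0 (R + norm b)) x)"
      by (intro integrable_mult_right integrable_real_indicator) (use emeasure_bounded_finite[OF bounded_cball] in auto)
    show "AE x in lborel. (\<lambda>n. s n x) \<longlonglongrightarrow> F' x"
    proof (intro AE_I2)
      fix x
      have "((\<lambda>h. (F (x + h *\<^sub>R b) - F x) / h) \<longlongrightarrow> F' x) (at 0)"
        using deriv[of x] by (simp add: DERIV_def)
      moreover have "filterlim (\<lambda>n. 1 / real (Suc n)) (at 0) sequentially"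
        using LIMSEQ_inverse_real_of_nat by (simp add: filterlim_at inverse_eq_divide)
      ultimately have "(\<lambda>n. (F (x + (1 / real (Suc n)) *\<^sub>R b) - F x) / (1 / real (Suc n))) \<longlonglongrightarrow> F' x"
        by (rule filterlim_compose)
      then show "(\<lambda>n. s n x) \<longlonglongrightarrow> F' x" by (simp add: s_def mult.commute)
    qed
    show "AE x in lborel. norm (s n x) \<le> B * indicator (cball 0 (R + norm b)) x" for n
    proof (intro AE_I2)
      fix x
      define h where "h = 1 / real (Suc n)"
      have h: "h > 0" "h \<le> 1" by (auto simp: h_def)
      show "norm (s n x) \<le> B * indicator (cball 0 (R + norm b)) x"
      proof (cases "norm x \<le> R + norm b")
        case True
        have "norm (s n x) = \<bar>F (x + h *\<^sub>R b) - F x\<bar> / h" by (simp add: s_def h_def abs_mult)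
        also have "\<dots> \<le> B" using lip[OF h(1), of x] h by (simp add: field_simps)
        finally show ?thesis using True by simp
      next
        case False
        have "norm (h *\<^sub>R b) \<le> norm b" using h by (simp add: mult_left_le_one_le)
        then have "\<not> norm (x + h *\<^sub>R b) \<le> R"
          using False norm_triangle_ineq4[of "x + h *\<^sub>R b" "h *\<^sub>R b"] by auto
        moreover have "\<not> norm x \<le> R" using False norm_ge_zero[of b] by linarith
        ultimately have "F (x + h *\<^sub>R b) = 0" "F x = 0" using R(2) bdd(2) by blast+
        then show ?thesis using False by (simp add: s_def h_def)
      qed
    qed
  qed (auto simp: s_def)
  with s0 show ?thesis by (simp add: LIMSEQ_const_iff)
qed

lemma smooth_DERIV_0:
  assumes "smooth f"
  shows "((\<lambda>t. f (x + t *\<^sub>R b)) has_real_derivative partial b f x) (at 0)"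
  using smooth_DERIV[OF assms, of x b 0] by simp

lemma integration_by_parts:
  assumes f: "smooth f" and \<psi>: "\<psi> \<in> test_functions U" and b: "b \<in> Basis"
  shows "(LINT x|lborel. f x * partial b \<psi> x) = - (LINT x|lborel. partial b f x * \<psi> x)"
proof -
  obtain K where K: "smooth \<psi>" "compact K" "\<And>x. x \<notin> K \<Longrightarrow> \<psi> x = 0"
    using \<psi> by (elim test_functionsE) blast
  have p0: "partial b \<psi> x = 0" if "x \<notin> K" for x
    using partial_outside_support[OF compact_imp_closed[OF K(2)] K(3) that] by simp
  note cs = smooth_continuous[OF f] smooth_continuous[OF K(1)] smooth_continuous[OF smooth_partial[OF f b]]
    smooth_continuous[OF smooth_partial[OF K(1) b]]
  have i: "integrable lborel (\<lambda>x. f x * partial b \<psi> x)" "integrable lborel (\<lambda>x. partial b f x * \<psi> x)"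
    by (rule compactly_supported_integrable[OF _ compact_imp_bounded[OF K(2)]];
        auto simp: K p0 intro!: continuous_intros cs)+
  have "(LINT x|lborel. f x * partial b \<psi> x + partial b f x * \<psi> x) = 0"
  proof (rule integral_directional_derivative[OF _ _ compact_imp_bounded[OF K(2)]])
    show "((\<lambda>t. f (x + t *\<^sub>R b) * \<psi> (x + t *\<^sub>R b)) has_real_derivative f x * partial b \<psi> x + partial b f x * \<psi> x) (at 0)" for x
      using smooth_DERIV_0[OF f] smooth_DERIV_0[OF K(1)]
      by (auto intro!: derivative_eq_intros)
  qed (auto simp: K p0 intro!: continuous_intros cs)
  with i show ?thesis by simp
qed

subsection \<open>Poincare inequalities\<close>

text \<open>A convex approximation of \<open>\<bar>t\<bar>\<^sup>p\<close>, which for \<open>p < 2\<close> is not itself twice differentiable.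
  The primed functions are the derivatives.\<close>

definition abs_powr_approx :: "real \<Rightarrow> real \<Rightarrow> real \<Rightarrow> real" where
  "abs_powr_approx p e t = (t\<^sup>2 + e) powr (p / 2) - e powr (p / 2)"

definition abs_powr_approx' :: "real \<Rightarrow> real \<Rightarrow> real \<Rightarrow> real" where
  "abs_powr_approx' p e t = p * t * (t\<^sup>2 + e) powr (p / 2 - 1)"

definition abs_powr_approx'' :: "real \<Rightarrow> real \<Rightarrow> real \<Rightarrow> real" where
  "abs_powr_approx'' p e t =
     p * (t\<^sup>2 + e) powr (p / 2 - 1) + p * (p - 2) * t\<^sup>2 * (t\<^sup>2 + e) powr (p / 2 - 2)"

context
  fixes e :: real assumes e: "e > 0"
begin

lemma sq_plus_pos: "t\<^sup>2 + e > 0" for t :: real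
  using e by (simp add: add_nonneg_pos)

lemma abs_powr_approx_DERIV:
  "(abs_powr_approx p e has_real_derivative abs_powr_approx' p e t) (at t)"
  unfolding abs_powr_approx_def abs_powr_approx'_def
  using sq_plus_pos[of t] by (auto intro!: derivative_eq_intros simp: field_simps)

lemma abs_powr_approx'_DERIV:
  "(abs_powr_approx' p e has_real_derivative abs_powr_approx'' p e t) (at t)"
  unfolding abs_powr_approx'_def abs_powr_approx''_def
  using sq_plus_pos[of t]
  by (auto intro!: derivative_eq_intros simp: field_simps power2_eq_square)

text \<open>Convexity of the approximation: factoring out the common power leaves (p - 1) t^2 +
  e.\<close>

lemma abs_powr_approx''_nonneg:
  assumes "p \<ge> 1"
  shows "abs_powr_approx'' p e t \<ge> 0"
proof -
  have "(t\<^sup>2 + e) powr (p / 2 - 1) = (t\<^sup>2 + e) powr (p / 2 - 2) * (t\<^sup>2 + e)"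
    using powr_add[of "t\<^sup>2 + e" "p / 2 - 2" 1] sq_plus_pos[of t] by simp
  then have "abs_powr_approx'' p e t = p * (t\<^sup>2 + e) powr (p / 2 - 2) * ((p - 1) * t\<^sup>2 + e)"
    by (simp add: abs_powr_approx''_def algebra_simps)
  then show ?thesis using assms e by simp
qed

text \<open>From |t| <= (t^2 + e)^(1/2). The exponent is arranged so that the bound tends to p
  |t|^(p-1) as e tends to 0.\<close>

lemma abs_powr_approx'_bound:
  assumes "p \<ge> 1"
  shows "\<bar>abs_powr_approx' p e t\<bar> \<le> p * (t\<^sup>2 + e) powr ((p - 1) / 2)"
proof -
  have "\<bar>t\<bar> \<le> (t\<^sup>2 + e) powr (1 / 2)"
    using e sq_plus_pos[of t] by (simp add: powr_half_sqrt real_le_rsqrt)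
  then have "\<bar>t\<bar> * (t\<^sup>2 + e) powr (p / 2 - 1) \<le> (t\<^sup>2 + e) powr (1 / 2) * (t\<^sup>2 + e) powr (p / 2 - 1)"
    by (rule mult_right_mono) simp
  also have "\<dots> = (t\<^sup>2 + e) powr ((p - 1) / 2)"
    unfolding powr_add[symmetric] by (rule arg_cong[where f = "\<lambda>x. (t\<^sup>2 + e) powr x"]) (simp add: field_simps)
  finally show ?thesis
    using assms by (simp add: abs_powr_approx'_def abs_mult mult.assoc mult_left_mono)
qed

lemma abs_powr_approx_0 [simp]: "abs_powr_approx p e 0 = 0" "abs_powr_approx' p e 0 = 0"
  by (simp_all add: abs_powr_approx_def abs_powr_approx'_def)

lemma abs_powr_approx_continuous:
  assumes "continuous_on UNIV \<psi>"
  shows "continuous_on UNIV (\<lambda>x. abs_powr_approx p e (\<psi> x))"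
    "continuous_on UNIV (\<lambda>x. abs_powr_approx' p e (\<psi> x))"
    "continuous_on UNIV (\<lambda>x. abs_powr_approx'' p e (\<psi> x))"
    "continuous_on UNIV (\<lambda>x. ((\<psi> x)\<^sup>2 + e) powr r)"
  using sq_plus_pos less_imp_neq[OF sq_plus_pos] unfolding abs_powr_approx_def abs_powr_approx'_def abs_powr_approx''_def
  by (auto intro!: continuous_intros assms)

end

context
  fixes \<psi> :: "'a::euclidean_space \<Rightarrow> real" and K :: "'a set" and b :: 'a and p R :: real
  assumes smooth: "smooth \<psi>" and K: "compact K" "\<And>x. x \<notin> K \<Longrightarrow> \<psi> x = 0"
    and b: "b \<in> Basis" and R: "\<And>x. x \<in> K \<Longrightarrow> \<bar>x \<bullet> b\<bar> \<le> R" and p: "p > 1"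
begin

lemma partial_support:
  assumes "x \<notin> K" shows "partial c \<psi> x = 0" "partial d (partial c \<psi>) x = 0"
proof -
  have *: "partial c \<psi> x = 0" if "x \<notin> K" for x c
    using partial_outside_support[OF compact_imp_closed[OF K(1)] K(2) that] by simp
  show "partial c \<psi> x = 0" using * assms by simp
  show "partial d (partial c \<psi>) x = 0"
    using partial_outside_support[OF compact_imp_closed[OF K(1)], of "partial c \<psi>"] * assms by simp
qed

text \<open>The b-derivative of (x . b) times the approximation at \<psi> integrates to 0, and x . b
  has derivative 1 in direction b.\<close>

lemma approx_integral_partial:
  assumes e: "e > 0"
  shows "(LINT x|lborel. abs_powr_approx p e (\<psi> x))
      = - (LINT x|lborel. (x \<bullet> b) * (abs_powr_approx' p e (\<psi> x) * partial b \<psi> x))"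
    and "integrable lborel (\<lambda>x. abs_powr_approx p e (\<psi> x))"
    and "integrable lborel (\<lambda>x. (x \<bullet> b) * (abs_powr_approx' p e (\<psi> x) * partial b \<psi> x))"
proof -
  note cs = abs_powr_approx_continuous[OF e smooth_continuous[OF smooth]]
    smooth_continuous[OF smooth_partial[OF smooth b]]
  note ci = compactly_supported_integrable[OF _ compact_imp_bounded[OF K(1)]]
  show i: "integrable lborel (\<lambda>x. abs_powr_approx p e (\<psi> x))"
    by (rule ci) (auto simp: K(2) e intro!: cs)
  show j: "integrable lborel (\<lambda>x. (x \<bullet> b) * (abs_powr_approx' p e (\<psi> x) * partial b \<psi> x))"
    by (rule ci) (auto simp: K(2) e intro!: cs continuous_intros)
  have "(LINT x|lborel. abs_powr_approx p e (\<psi> x) + (x \<bullet> b) * (abs_powr_approx' p e (\<psi> x) * partial b \<psi> x)) = 0"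
  proof (rule integral_directional_derivative[OF _ _ compact_imp_bounded[OF K(1)]])
    show "((\<lambda>t. ((x + t *\<^sub>R b) \<bullet> b) * abs_powr_approx p e (\<psi> (x + t *\<^sub>R b))) has_real_derivative
      abs_powr_approx p e (\<psi> x) + (x \<bullet> b) * (abs_powr_approx' p e (\<psi> x) * partial b \<psi> x)) (at 0)" for x
      using b
      by (auto intro!: derivative_eq_intros DERIV_chain2[OF abs_powr_approx_DERIV[OF e]] smooth_DERIV_0[OF smooth]
          simp: inner_add_left)
  qed (auto simp: K(2) e intro!: cs continuous_intros)
  with i j show "(LINT x|lborel. abs_powr_approx p e (\<psi> x))
      = - (LINT x|lborel. (x \<bullet> b) * (abs_powr_approx' p e (\<psi> x) * partial b \<psi> x))" by simp
qed

text \<open>First-order counterpart for odd m, where one derivative remains beyond the powers of the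
  Laplacian.\<close>

lemma approx_poincare_partial:
  assumes e: "e > 0"
  shows "(LINT x|lborel. abs_powr_approx p e (\<psi> x))
      \<le> (R * p) * (LINT x|lborel. ((\<psi> x)\<^sup>2 + e) powr ((p - 1) / 2) * \<bar>partial b \<psi> x\<bar>)"
proof -
  note cs = abs_powr_approx_continuous[OF e smooth_continuous[OF smooth]]
    smooth_continuous[OF smooth_partial[OF smooth b]]
  have i: "integrable lborel (\<lambda>x. ((\<psi> x)\<^sup>2 + e) powr ((p - 1) / 2) * \<bar>partial b \<psi> x\<bar>)"
    by (rule compactly_supported_integrable[OF _ compact_imp_bounded[OF K(1)]])
      (auto simp: partial_support intro!: cs continuous_intros)
  have le: "- ((x \<bullet> b) * (abs_powr_approx' p e (\<psi> x) * partial b \<psi> x))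
      \<le> (R * p) * (((\<psi> x)\<^sup>2 + e) powr ((p - 1) / 2) * \<bar>partial b \<psi> x\<bar>)" for x
  proof (cases "x \<in> K")
    case True
    have "- ((x \<bullet> b) * (abs_powr_approx' p e (\<psi> x) * partial b \<psi> x))
        \<le> \<bar>x \<bullet> b\<bar> * (\<bar>abs_powr_approx' p e (\<psi> x)\<bar> * \<bar>partial b \<psi> x\<bar>)"
      unfolding abs_mult[symmetric] by simp
    also have "\<dots> \<le> R * ((p * ((\<psi> x)\<^sup>2 + e) powr ((p - 1) / 2)) * \<bar>partial b \<psi> x\<bar>)"
      using R[OF True] p abs_powr_approx'_bound[OF e, of p]
      by (intro mult_mono mult_right_mono mult_nonneg_nonneg order_trans[OF abs_ge_zero R[OF True]]) auto
    finally show ?thesis by (simp add: mult_ac)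
  qed (simp add: partial_support)
  have "(LINT x|lborel. - ((x \<bullet> b) * (abs_powr_approx' p e (\<psi> x) * partial b \<psi> x)))
      \<le> (LINT x|lborel. (R * p) * (((\<psi> x)\<^sup>2 + e) powr ((p - 1) / 2) * \<bar>partial b \<psi> x\<bar>))"
    using le i approx_integral_partial(3)[OF e] by (intro integral_mono) auto
  then show ?thesis using approx_integral_partial(1)[OF e] by simp
qed

text \<open>With \<Phi> the approximation, the c-derivative of \<rho> \<Phi>'(\<psi>) \<partial>_c
  \<psi> integrates to 0 for each c. In the sum over c the derivative of the weight contributes for
  c = b alone, and \<open>approx_integral_partial\<close> turns this contribution into the integral
  of \<Phi>(\<psi>). Convexity discards the terms with \<Phi>''.\<close>

lemma approx_poincare_laplace:
  assumes e: "e > 0"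
  shows "(LINT x|lborel. abs_powr_approx p e (\<psi> x))
      \<le> (R\<^sup>2 * p / 2) * (LINT x|lborel. ((\<psi> x)\<^sup>2 + e) powr ((p - 1) / 2) * \<bar>laplace \<psi> x\<bar>)"
proof -
  note cs = abs_powr_approx_continuous[OF e smooth_continuous[OF smooth]]
    smooth_continuous[OF smooth_partial[OF smooth]] smooth_continuous[OF smooth_laplace[OF smooth]]
    smooth_continuous[OF smooth_partial[OF smooth_partial[OF smooth]]]
  note ci = compactly_supported_integrable[OF _ compact_imp_bounded[OF K(1)]]
  define \<rho> where "\<rho> x = R\<^sup>2 - (x \<bullet> b)\<^sup>2" for x
  \<comment> \<open>\<open>T c\<close> is the c-derivative of \<Phi>'(\<psi>) \<partial>_c \<psi>,
    and \<open>V b\<close> is the integrand that \<open>approx_integral_partial\<close>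
    evaluates.\<close>
  define T where "T c x = abs_powr_approx'' p e (\<psi> x) * (partial c \<psi> x)\<^sup>2
    + abs_powr_approx' p e (\<psi> x) * partial c (partial c \<psi>) x" for c x
  define V where "V c x = (x \<bullet> b) * (abs_powr_approx' p e (\<psi> x) * partial c \<psi> x)" for c x
  have cont: "continuous_on UNIV (T c)" "continuous_on UNIV (V c)" "continuous_on UNIV (\<lambda>x. \<rho> x * T c x)"
    if "c \<in> Basis" for c
    unfolding T_def V_def \<rho>_def using that by (auto intro!: cs continuous_intros)
  have supp: "T c x = 0" "V c x = 0" if "x \<notin> K" for c x
    using that by (auto simp: T_def V_def partial_support)
  have int: "integrable lborel (\<lambda>x. \<rho> x * T c x)" "integrable lborel (V c)" if "c \<in> Basis" for c
    using that by (auto intro!: ci cont simp: supp)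
  have "(LINT x|lborel. \<rho> x * T c x - 2 * (c \<bullet> b) * V c x) = 0" if c: "c \<in> Basis" for c
  proof (rule integral_directional_derivative[OF _ _ compact_imp_bounded[OF K(1)]])
    show "((\<lambda>t. \<rho> (x + t *\<^sub>R c) * (abs_powr_approx' p e (\<psi> (x + t *\<^sub>R c)) * partial c \<psi> (x + t *\<^sub>R c)))
      has_real_derivative \<rho> x * T c x - 2 * (c \<bullet> b) * V c x) (at 0)" for x
      unfolding \<rho>_def T_def V_def
      by (auto intro!: derivative_eq_intros DERIV_chain2[OF abs_powr_approx'_DERIV[OF e]]
          smooth_DERIV_0[OF smooth] smooth_DERIV_0[OF smooth_partial[OF smooth c]]
          simp: inner_add_left power2_eq_square algebra_simps)
    show "continuous_on UNIV (\<lambda>x. \<rho> x * (abs_powr_approx' p e (\<psi> x) * partial c \<psi> x))"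
      using c by (auto simp: \<rho>_def intro!: cs continuous_intros)
  qed (auto simp: supp partial_support intro!: cont continuous_intros c)
  then have "(\<Sum>c\<in>Basis. (LINT x|lborel. \<rho> x * T c x) - 2 * (c \<bullet> b) * (LINT x|lborel. V c x)) = 0"
    using int by simp
  moreover have "(\<Sum>c\<in>Basis. 2 * (c \<bullet> b) * (LINT x|lborel. V c x)) = 2 * (LINT x|lborel. V b x)"
  proof -
    have "(\<Sum>c\<in>Basis. 2 * (c \<bullet> b) * (LINT x|lborel. V c x)) = (\<Sum>c\<in>Basis. if c = b then 2 * (LINT x|lborel. V c x) else 0)"
      using b by (intro sum.cong) (auto simp: inner_Basis)
    then show ?thesis using b by simp
  qed
  ultimately have "2 * (LINT x|lborel. V b x) = (\<Sum>c\<in>Basis. LINT x|lborel. \<rho> x * T c x)"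
    by (simp add: sum_subtractf)
  also have "\<dots> = (LINT x|lborel. (\<Sum>c\<in>Basis. \<rho> x * T c x))"
    using int by (simp add: Bochner_Integration.integral_sum)
  finally have eq: "2 * (LINT x|lborel. abs_powr_approx p e (\<psi> x)) = (LINT x|lborel. - (\<Sum>c\<in>Basis. \<rho> x * T c x))"
    using approx_integral_partial(1)[OF e] by (simp add: V_def)
  have l0: "laplace \<psi> x = 0" if "x \<notin> K" for x using that by (simp add: laplace_def partial_support)
  have "(LINT x|lborel. - (\<Sum>c\<in>Basis. \<rho> x * T c x))
      \<le> (LINT x|lborel. (R\<^sup>2 * p) * (((\<psi> x)\<^sup>2 + e) powr ((p - 1) / 2) * \<bar>laplace \<psi> x\<bar>))"
  proof (rule integral_mono)
    show "integrable lborel (\<lambda>x. (R\<^sup>2 * p) * (((\<psi> x)\<^sup>2 + e) powr ((p - 1) / 2) * \<bar>laplace \<psi> x\<bar>))"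
      by (intro integrable_mult_right ci) (auto simp: l0 intro!: cs continuous_intros)
    show "- (\<Sum>c\<in>Basis. \<rho> x * T c x) \<le> (R\<^sup>2 * p) * (((\<psi> x)\<^sup>2 + e) powr ((p - 1) / 2) * \<bar>laplace \<psi> x\<bar>)" for x
    proof (cases "x \<in> K")
      case True
      have \<rho>: "0 \<le> \<rho> x" "\<rho> x \<le> R\<^sup>2"
        using R[OF True] by (auto simp: \<rho>_def abs_le_square_iff[symmetric])
      have "(\<Sum>c\<in>Basis. T c x) = (\<Sum>c\<in>Basis. abs_powr_approx'' p e (\<psi> x) * (partial c \<psi> x)\<^sup>2) + abs_powr_approx' p e (\<psi> x) * laplace \<psi> x"
        by (simp add: T_def laplace_def sum.distrib sum_distrib_left)
      moreover have "(\<Sum>c\<in>Basis. abs_powr_approx'' p e (\<psi> x) * (partial c \<psi> x)\<^sup>2) \<ge> 0"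
        using abs_powr_approx''_nonneg[OF e, of p] p by (intro sum_nonneg) auto
      ultimately have "- (\<Sum>c\<in>Basis. T c x) \<le> \<bar>abs_powr_approx' p e (\<psi> x) * laplace \<psi> x\<bar>"
        by linarith
      also have "\<dots> \<le> (p * ((\<psi> x)\<^sup>2 + e) powr ((p - 1) / 2)) * \<bar>laplace \<psi> x\<bar>"
        unfolding abs_mult using abs_powr_approx'_bound[OF e, of p] p by (intro mult_right_mono) auto
      finally have "\<rho> x * (- (\<Sum>c\<in>Basis. T c x)) \<le> R\<^sup>2 * ((p * ((\<psi> x)\<^sup>2 + e) powr ((p - 1) / 2)) * \<bar>laplace \<psi> x\<bar>)"
        using \<rho> p by (intro order_trans[OF mult_left_mono mult_right_mono]) auto
      then show ?thesis by (simp add: sum_distrib_left mult_ac)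
    qed (simp add: supp l0)
  qed (use int in auto)
  with eq show ?thesis by simp
qed

text \<open>As e tends to 0, dominated convergence bounds the integral of |\<psi>|^p by that of
  |\<psi>|^(p-1) |g|; Hoelder's inequality separates the factors, and a power of the norm of \<psi>
  is cancelled. The function g stands for the Laplacian or a partial derivative.\<close>

lemma poincare_limit:
  assumes g: "continuous_on UNIV g" "\<And>x. x \<notin> K \<Longrightarrow> g x = 0" and C: "C \<ge> 0"
    and approx: "\<And>e. e > 0 \<Longrightarrow> (LINT x|lborel. abs_powr_approx p e (\<psi> x))
      \<le> C * (LINT x|lborel. ((\<psi> x)\<^sup>2 + e) powr ((p - 1) / 2) * \<bar>g x\<bar>)"
  shows "(LINT x|lborel. \<bar>\<psi> x\<bar> powr p) powr (1 / p) \<le> C * (LINT x|lborel. \<bar>g x\<bar> powr p) powr (1 / p)"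
proof -
  define e where "e n = 1 / real (Suc n)" for n
  have e: "0 < e n" "e n \<le> 1" for n by (auto simp: e_def)
  have elim: "e \<longlonglongrightarrow> 0" unfolding e_def by real_asymp
  note cs = abs_powr_approx_continuous[OF zero_less_one smooth_continuous[OF smooth]] smooth_continuous[OF smooth]
  have [measurable]: "\<psi> \<in> borel_measurable borel" "g \<in> borel_measurable borel"
    using smooth_continuous[OF smooth] g by (auto intro: borel_measurable_continuous_onI)
  have sq: "(t\<^sup>2 + 0) powr (r / 2) = \<bar>t\<bar> powr r" for t r :: real
  proof -
    have "t\<^sup>2 = \<bar>t\<bar> powr 2" by simp
    then show ?thesis by (simp only: powr_powr add_0_right) simp
  qed
  have tend: "(\<lambda>n. (t\<^sup>2 + e n) powr (r / 2)) \<longlonglongrightarrow> \<bar>t\<bar> powr r" if "r > 0" for t r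
    unfolding sq[of t r, symmetric] using that less_imp_le[OF e(1)]
    by (intro tendsto_powr' tendsto_intros elim) auto
  have "(\<lambda>n. LINT x|lborel. abs_powr_approx p (e n) (\<psi> x)) \<longlonglongrightarrow> (LINT x|lborel. \<bar>\<psi> x\<bar> powr p)"
  proof (rule integral_dominated_convergence)
    \<comment> \<open>All e are at most 1, so the value at e = 1 on K is a common majorant.\<close>
    show "integrable lborel (\<lambda>x. indicator K x *\<^sub>R (((\<psi> x)\<^sup>2 + 1) powr (p / 2)))"
      by (intro borel_integrable_compact K continuous_on_subset[OF cs(4) subset_UNIV])
    show "AE x in lborel. (\<lambda>n. abs_powr_approx p (e n) (\<psi> x)) \<longlonglongrightarrow> \<bar>\<psi> x\<bar> powr p"
    proof (intro AE_I2)
      fix x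
      have "(\<lambda>n. abs_powr_approx p (e n) (\<psi> x)) \<longlonglongrightarrow> \<bar>\<psi> x\<bar> powr p - \<bar>0\<bar> powr p"
        unfolding abs_powr_approx_def using tend[of p "\<psi> x"] tend[of p 0] p by (intro tendsto_diff) auto
      then show "(\<lambda>n. abs_powr_approx p (e n) (\<psi> x)) \<longlonglongrightarrow> \<bar>\<psi> x\<bar> powr p" using p by simp
    qed
    show "AE x in lborel. norm (abs_powr_approx p (e n) (\<psi> x)) \<le> indicator K x *\<^sub>R (((\<psi> x)\<^sup>2 + 1) powr (p / 2))" for n
    proof (intro AE_I2)
      fix x
      have "e n powr (p / 2) \<le> ((\<psi> x)\<^sup>2 + e n) powr (p / 2)" "((\<psi> x)\<^sup>2 + e n) powr (p / 2) \<le> ((\<psi> x)\<^sup>2 + 1) powr (p / 2)"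
        using e[of n] p by (auto intro!: powr_mono2)
      then have "norm (abs_powr_approx p (e n) (\<psi> x)) \<le> ((\<psi> x)\<^sup>2 + 1) powr (p / 2)"
        using powr_ge_zero[of "e n" "p / 2"] unfolding abs_powr_approx_def real_norm_def by linarith
      then show "norm (abs_powr_approx p (e n) (\<psi> x)) \<le> indicator K x *\<^sub>R (((\<psi> x)\<^sup>2 + 1) powr (p / 2))"
        using K(2)[of x] e[of n] by (cases "x \<in> K") auto
    qed
  qed (auto simp: abs_powr_approx_def)
  moreover have "(\<lambda>n. LINT x|lborel. ((\<psi> x)\<^sup>2 + e n) powr ((p - 1) / 2) * \<bar>g x\<bar>)
      \<longlonglongrightarrow> (LINT x|lborel. \<bar>\<psi> x\<bar> powr (p - 1) * \<bar>g x\<bar>)"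
  proof (rule integral_dominated_convergence)
    show "integrable lborel (\<lambda>x. indicator K x *\<^sub>R (((\<psi> x)\<^sup>2 + 1) powr ((p - 1) / 2) * \<bar>g x\<bar>))"
      by (intro borel_integrable_compact K continuous_intros continuous_on_subset[OF cs(4) subset_UNIV]
          continuous_on_subset[OF g(1) subset_UNIV])
    show "AE x in lborel. (\<lambda>n. ((\<psi> x)\<^sup>2 + e n) powr ((p - 1) / 2) * \<bar>g x\<bar>) \<longlonglongrightarrow> \<bar>\<psi> x\<bar> powr (p - 1) * \<bar>g x\<bar>"
      using p by (intro AE_I2 tendsto_mult tend tendsto_const) auto
    show "AE x in lborel. norm (((\<psi> x)\<^sup>2 + e n) powr ((p - 1) / 2) * \<bar>g x\<bar>)
        \<le> indicator K x *\<^sub>R (((\<psi> x)\<^sup>2 + 1) powr ((p - 1) / 2) * \<bar>g x\<bar>)" for n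
    proof (intro AE_I2)
      fix x
      have "((\<psi> x)\<^sup>2 + e n) powr ((p - 1) / 2) \<le> ((\<psi> x)\<^sup>2 + 1) powr ((p - 1) / 2)"
        using e[of n] p by (auto intro!: powr_mono2)
      then show "norm (((\<psi> x)\<^sup>2 + e n) powr ((p - 1) / 2) * \<bar>g x\<bar>)
          \<le> indicator K x *\<^sub>R (((\<psi> x)\<^sup>2 + 1) powr ((p - 1) / 2) * \<bar>g x\<bar>)"
        using g(2)[of x] by (cases "x \<in> K") (auto simp: abs_mult mult_right_mono)
    qed
  qed auto
  ultimately have "(LINT x|lborel. \<bar>\<psi> x\<bar> powr p) \<le> C * (LINT x|lborel. \<bar>\<psi> x\<bar> powr (p - 1) * \<bar>g x\<bar>)"
    using approx[OF e(1)] by (intro LIMSEQ_le[OF _ tendsto_mult_left]) auto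
  also have "(LINT x|lborel. \<bar>\<psi> x\<bar> powr (p - 1) * \<bar>g x\<bar>) \<le>
    (LINT x|lborel. (\<bar>\<psi> x\<bar> powr (p - 1)) powr (p / (p - 1))) powr (1 / (p / (p - 1))) * (LINT x|lborel. \<bar>g x\<bar> powr p) powr (1 / p)"
  proof (rule Hoelder_nonneg(2))
    have c: "continuous_on UNIV (\<lambda>x. \<bar>f x\<bar> powr p)" if "continuous_on UNIV f" for f :: "'a \<Rightarrow> real"
      using that p by (intro continuous_on_powr' continuous_on_rabs continuous_on_const) auto
    note ci = compactly_supported_integrable[OF c compact_imp_bounded[OF K(1)]]
    have "integrable lborel (\<lambda>x. \<bar>\<psi> x\<bar> powr p)"
      by (rule ci) (auto simp: K(2) smooth_continuous[OF smooth])
    then show "integrable lborel (\<lambda>x. (\<bar>\<psi> x\<bar> powr (p - 1)) powr (p / (p - 1)))"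
      using p by (simp add: powr_powr)
    show "integrable lborel (\<lambda>x. \<bar>g x\<bar> powr p)"
      by (rule ci) (auto simp: g)
  qed (use p in \<open>auto simp: field_simps\<close>)
  also have "(\<lambda>x. (\<bar>\<psi> x\<bar> powr (p - 1)) powr (p / (p - 1))) = (\<lambda>x. \<bar>\<psi> x\<bar> powr p)"
    using p by (simp add: powr_powr)
  finally have main: "(LINT x|lborel. \<bar>\<psi> x\<bar> powr p) \<le>
      C * ((LINT x|lborel. \<bar>\<psi> x\<bar> powr p) powr (1 / (p / (p - 1))) * (LINT x|lborel. \<bar>g x\<bar> powr p) powr (1 / p))"
    using C by (simp add: mult_left_mono)
  define A where "A = (LINT x|lborel. \<bar>\<psi> x\<bar> powr p)"
  show ?thesis
  proof (cases "A = 0")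
    case True
    with C show ?thesis by (simp add: A_def)
  next
    case False
    moreover have "A \<ge> 0" by (simp add: A_def)
    ultimately have A: "A > 0" by simp
    have e: "1 / p + 1 / (p / (p - 1)) = 1" using p by (simp add: field_simps)
    have "A powr (1 / p) * A powr (1 / (p / (p - 1))) = A"
      unfolding powr_add[symmetric] e using A by simp
    \<comment> \<open>The exponents add up to 1, so A splits into the wanted norm and the factor to
      be cancelled.\<close>
    then have "A powr (1 / p) * A powr (1 / (p / (p - 1)))
      \<le> (C * (LINT x|lborel. \<bar>g x\<bar> powr p) powr (1 / p)) * A powr (1 / (p / (p - 1)))"
      using main unfolding A_def by (simp add: mult_ac)
    then show ?thesis using A unfolding A_def[symmetric] by (simp add: mult_le_cancel_right)
  qed
qed

lemma poincare_laplace: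
  "(LINT x|lborel. \<bar>\<psi> x\<bar> powr p) powr (1 / p)
    \<le> (R\<^sup>2 * p / 2) * (LINT x|lborel. \<bar>laplace \<psi> x\<bar> powr p) powr (1 / p)"
  using p approx_poincare_laplace smooth_continuous[OF smooth_laplace[OF smooth]]
  by (intro poincare_limit) (auto simp: laplace_def partial_support)

lemma poincare_partial:
  assumes "R \<ge> 0"
  shows "(LINT x|lborel. \<bar>\<psi> x\<bar> powr p) powr (1 / p)
    \<le> (R * p) * (LINT x|lborel. \<bar>partial b \<psi> x\<bar> powr p) powr (1 / p)"
  using p assms approx_poincare_partial smooth_continuous[OF smooth_partial[OF smooth b]]
  by (intro poincare_limit) (auto simp: partial_support)

end

subsection \<open>Weak derivatives\<close>

lemma open_lebesgue [simp]: "open U \<Longrightarrow> U \<in> sets lebesgue"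
  by auto

lemma continuous_lebesgue_measurable:
  fixes f :: "'a::euclidean_space \<Rightarrow> 'b::euclidean_space"
  assumes "continuous_on UNIV f"
  shows "f \<in> borel_measurable lebesgue"
  using continuous_imp_measurable_on_sets_lebesgue[OF assms] by (simp add: lebesgue_on_UNIV_eq)

lemma AE_lebesgue_on_iff:
  assumes "U \<in> sets lebesgue"
  shows "(AE x in lebesgue_on U. P x) \<longleftrightarrow> (AE x in lebesgue. x \<in> U \<longrightarrow> P x)"
  using assms by (intro AE_restrict_space_iff) simp

text \<open>Lebesgue measure is complete. This makes derivatives chosen by \<open>SOME\<close>
  measurable, as they are known only up to null sets.\<close>

lemma borel_measurable_lebesgue_on_AE:
  fixes f g :: "'a::euclidean_space \<Rightarrow> 'b::euclidean_space"
  assumes U: "U \<in> sets lebesgue" and f: "f \<in> borel_measurable (lebesgue_on U)"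
    and eq: "AE x in lebesgue_on U. f x = g x"
  shows "g \<in> borel_measurable (lebesgue_on U)"
proof -
  have "(\<lambda>x. indicator U x *\<^sub>R g x) \<in> borel_measurable lebesgue"
  proof (rule borel_measurable_AE)
    show "(\<lambda>x. indicator U x *\<^sub>R f x) \<in> borel_measurable lebesgue"
      using f U by (subst (asm) borel_measurable_restrict_space_iff) auto
    show "AE x in lebesgue. indicator U x *\<^sub>R f x = indicator U x *\<^sub>R g x"
      using eq unfolding AE_lebesgue_on_iff[OF U] by eventually_elim (auto simp: indicator_def)
  qed
  then show ?thesis using U by (subst borel_measurable_restrict_space_iff) auto
qed

lemma Lp_AE:
  assumes "U \<in> sets lebesgue" "f \<in> Lp q U" "AE x in lebesgue_on U. f x = g x"
  shows "g \<in> Lp q U"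
  using Lp_cong_AE[OF assms(2,3)] borel_measurable_lebesgue_on_AE[OF assms(1) LpD(1)[OF assms(2)] assms(3)]
  by blast

lemma Lp_norm_AE:
  assumes "U \<in> sets lebesgue" "f \<in> Lp q U" "AE x in lebesgue_on U. f x = g x"
  shows "Lp_norm q U g = Lp_norm q U f"
proof -
  have "AE x in lebesgue_on U. norm (g x) = norm (f x)"
    using assms(3) by eventually_elim simp
  then show ?thesis
    using LpD(1)[OF Lp_AE[OF assms]] LpD(1)[OF assms(2)] by (intro Lp_norm_cong_AE)
qed

text \<open>Classical calculus is carried out in \<open>lborel\<close>, whereas the function spaces
  live on \<open>lebesgue_on U\<close>; this is the bridge for functions vanishing outside
  U.\<close>

lemma lebesgue_on_integral_eq_lborel:
  fixes f :: "'a::euclidean_space \<Rightarrow> real"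
  assumes "U \<in> sets lebesgue" "f \<in> borel_measurable borel" "\<And>x. x \<notin> U \<Longrightarrow> f x = 0"
  shows "(LINT x|lebesgue_on U. f x) = (LINT x|lborel. f x)"
    and "integrable (lebesgue_on U) f \<longleftrightarrow> integrable lborel f"
proof -
  have eq: "(\<lambda>x. indicator U x *\<^sub>R f x) = f"
    using assms(3) by (force simp: indicator_def)
  have 0: "U \<inter> space lebesgue \<in> sets lebesgue" using assms(1) by simp
  show "(LINT x|lebesgue_on U. f x) = (LINT x|lborel. f x)"
    unfolding integral_restrict_space[OF 0] eq using assms(2) by (simp add: integral_completion)
  show "integrable (lebesgue_on U) f \<longleftrightarrow> integrable lborel f"
    unfolding integrable_restrict_space[OF 0] eq using assms(2) by (simp add: integrable_completion)
qed

lemma locally_integrable_continuous: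
  fixes f :: "'a::euclidean_space \<Rightarrow> 'b::euclidean_space"
  assumes "continuous_on UNIV f"
  shows "locally_integrable U f"
  unfolding locally_integrable_def set_integrable_def
proof (intro allI impI)
  fix C :: "'a set" assume C: "compact C \<and> C \<subseteq> U"
  have "continuous_on C f" using assms by (rule continuous_on_subset) simp
  with C have "integrable lborel (\<lambda>x. indicator C x *\<^sub>R f x)"
    by (intro borel_integrable_compact) auto
  moreover have "(\<lambda>x. indicator C x *\<^sub>R f x) \<in> borel_measurable borel"
    using borel_measurable_continuous_onI[OF assms] C
    by (intro borel_measurable_scaleR borel_measurable_indicator) (auto intro: borel_closed compact_imp_closed)
  ultimately show "integrable lebesgue (\<lambda>x. indicator C x *\<^sub>R f x)"
    by (simp add: integrable_completion)
qed

lemma locally_integrable_diff: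
  "locally_integrable U f \<Longrightarrow> locally_integrable U g \<Longrightarrow> locally_integrable U (\<lambda>x. f x - g x)"
  unfolding locally_integrable_def by (auto intro: set_integral_diff)

lemma locally_integrable_sum:
  fixes f :: "'i \<Rightarrow> 'a::euclidean_space \<Rightarrow> 'b::euclidean_space"
  shows "(\<And>i. i \<in> I \<Longrightarrow> locally_integrable U (f i)) \<Longrightarrow> locally_integrable U (\<lambda>x. \<Sum>i\<in>I. f i x)"
proof (induction I rule: infinite_finite_induct)
  case (insert i I)
  then show ?case unfolding locally_integrable_def by (auto intro!: set_integral_add)
qed (auto intro: locally_integrable_continuous)

section \<open>Testing locally integrable functions\<close>

lemma locally_integrable_inner_integrable:
  fixes f T :: "'a::euclidean_space \<Rightarrow> 'b::euclidean_space"
  assumes U: "open U" and f: "locally_integrable U f" and T: "continuous_on UNIV T"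
    and K: "compact K" "K \<subseteq> U" "\<And>x. x \<notin> K \<Longrightarrow> T x = 0"
  shows "integrable (lebesgue_on U) (\<lambda>x. f x \<bullet> T x)"
proof -
  have fi: "integrable lebesgue (\<lambda>x. indicator K x *\<^sub>R f x)"
    using f K unfolding locally_integrable_def set_integrable_def by blast
  have "bounded (T ` K)"
    using T K by (intro compact_imp_bounded compact_continuous_image) (auto intro: continuous_on_subset)
  then obtain B where B: "B > 0" "\<And>x. x \<in> K \<Longrightarrow> norm (T x) \<le> B"
    by (auto simp: bounded_pos)
  note continuous_lebesgue_measurable[OF T, measurable]
  have "integrable lebesgue (\<lambda>x. (indicator K x *\<^sub>R f x) \<bullet> T x)"
  proof (rule Bochner_Integration.integrable_bound)
    show "integrable lebesgue (\<lambda>x. B * norm (indicator K x *\<^sub>R f x))"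
      by (rule integrable_mult_right[OF integrable_norm[OF fi]])
    have [measurable]: "(\<lambda>x. indicator K x *\<^sub>R f x) \<in> borel_measurable lebesgue" using fi by simp
    show "(\<lambda>x. (indicator K x *\<^sub>R f x) \<bullet> T x) \<in> borel_measurable lebesgue" by measurable
    show "AE x in lebesgue. norm ((indicator K x *\<^sub>R f x) \<bullet> T x) \<le> norm (B * norm (indicator K x *\<^sub>R f x))"
    proof (intro AE_I2)
      fix x
      show "norm ((indicator K x *\<^sub>R f x) \<bullet> T x) \<le> norm (B * norm (indicator K x *\<^sub>R f x))"
      proof (cases "x \<in> K")
        case True
        have "\<bar>f x \<bullet> T x\<bar> \<le> norm (f x) * norm (T x)" by (rule Cauchy_Schwarz_ineq2)
        also have "\<dots> \<le> norm (f x) * B" using B(2)[OF True] by (rule mult_left_mono) simp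
        finally show ?thesis using True B(1) by (simp add: mult.commute)
      qed simp
    qed
  qed
  also have "(\<lambda>x. (indicator K x *\<^sub>R f x) \<bullet> T x) = (\<lambda>x. indicator U x *\<^sub>R (f x \<bullet> T x))"
    using K(2,3) by (force simp: indicator_def)
  finally show ?thesis using U by (subst integrable_restrict_space) auto
qed

lemma locally_integrable_test_integrable:
  assumes "open U" "locally_integrable U g" "\<psi> \<in> test_functions U"
  shows "integrable (lebesgue_on U) (\<lambda>x. g x * \<psi> x)"
proof -
  obtain K where "smooth \<psi>" "compact K" "K \<subseteq> U" "\<And>x. x \<notin> K \<Longrightarrow> \<psi> x = 0"
    using assms(3) by (elim test_functionsE) blast
  then show ?thesis
    using locally_integrable_inner_integrable[OF assms(1,2), of \<psi> K] smooth_continuous[of \<psi>] by simp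
qed

text \<open>Testing with functions that approximate the indicator of a box shows that all box integrals
  vanish, and Lebesgue differentiation along boxes then gives the claim.\<close>

lemma fundamental_lemma:
  fixes g :: "'a::euclidean_space \<Rightarrow> real"
  assumes U: "open U" and g: "locally_integrable U g"
    and zero: "\<And>\<psi>. \<psi> \<in> test_functions U \<Longrightarrow> (LINT x|lebesgue_on U. g x * \<psi> x) = 0"
  shows "AE x in lebesgue_on U. g x = 0"
proof -
  have box0: "integral (cbox a b) g = 0" if ab: "cbox a b \<subseteq> U" for a b
  proof -
    have gi: "integrable lebesgue (\<lambda>x. indicator (cbox a b) x *\<^sub>R g x)"
      using g ab compact_cbox[of a b] by (simp add: locally_integrable_def set_integrable_def)
    then have gb: "g absolutely_integrable_on box a b"
      unfolding set_integrable_def[symmetric]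
      by (rule set_integrable_subset) (auto simp: box_subset_cbox)
    have [measurable]: "(\<lambda>x. indicator (cbox a b) x *\<^sub>R g x) \<in> borel_measurable lebesgue" using gi by simp
    have bm [measurable]: "box_bump n a b \<in> borel_measurable lebesgue" for n
      by (intro continuous_lebesgue_measurable smooth_continuous box_bump_smooth)
    have in_box: "box_bump n a b x * (indicator (cbox a b) x *\<^sub>R g x) = indicator U x *\<^sub>R (g x * box_bump n a b x)" for n x
    proof (cases "x \<in> box a b")
      case True
      with ab box_subset_cbox[of a b] have "x \<in> cbox a b" "x \<in> U" by auto
      then show ?thesis by simp
    qed (simp add: box_bump_zero)
    have "(\<lambda>n. LINT x|lebesgue. box_bump n a b x * (indicator (cbox a b) x *\<^sub>R g x))
        \<longlonglongrightarrow> (LINT x|lebesgue. indicator (box a b) x *\<^sub>R g x)"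
    proof (rule integral_dominated_convergence)
      show "integrable lebesgue (\<lambda>x. norm (indicator (cbox a b) x *\<^sub>R g x))" using gi by simp
      show "(\<lambda>x. indicator (box a b) x *\<^sub>R g x) \<in> borel_measurable lebesgue"
        using gb by (auto simp: set_integrable_def)
      show "AE x in lebesgue. (\<lambda>n. box_bump n a b x * (indicator (cbox a b) x *\<^sub>R g x)) \<longlonglongrightarrow> indicator (box a b) x *\<^sub>R g x"
      proof (intro AE_I2)
        fix x
        have "(\<lambda>n. box_bump n a b x * (indicator (cbox a b) x *\<^sub>R g x)) \<longlonglongrightarrow> indicator (box a b) x * (indicator (cbox a b) x *\<^sub>R g x)"
          by (intro tendsto_mult box_bump_tendsto tendsto_const)
        also have "indicator (box a b) x * (indicator (cbox a b) x *\<^sub>R g x) = indicator (box a b) x *\<^sub>R g x"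
          using box_subset_cbox[of a b] by (auto simp: indicator_def)
        finally show "(\<lambda>n. box_bump n a b x * (indicator (cbox a b) x *\<^sub>R g x)) \<longlonglongrightarrow> indicator (box a b) x *\<^sub>R g x" .
      qed
      show "AE x in lebesgue. norm (box_bump n a b x * (indicator (cbox a b) x *\<^sub>R g x)) \<le> norm (indicator (cbox a b) x *\<^sub>R g x)" for n
        using box_bump_bounds[of n a b] by (intro AE_I2) (auto simp: abs_mult intro!: mult_left_le_one_le)
    qed measurable
    moreover have "(LINT x|lebesgue. box_bump n a b x * (indicator (cbox a b) x *\<^sub>R g x)) = 0" for n
    proof -
      have "(LINT x|lebesgue_on U. g x * box_bump n a b x) = 0"
        by (rule zero[OF box_bump_test_function[OF ab]])
      then show ?thesis unfolding in_box using U by (subst (asm) integral_restrict_space) auto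
    qed
    ultimately have "(LINT x|lebesgue. indicator (box a b) x *\<^sub>R g x) = 0" by (simp add: LIMSEQ_const_iff)
    then show ?thesis
      using set_lebesgue_integral_eq_integral(2)[OF gb] integral_open_interval[of a b g]
      by (simp add: set_lebesgue_integral_def)
  qed
  have neg: "negligible {x \<in> cbox c d. g x \<noteq> 0}" if cd: "cbox c d \<subseteq> U" for c d
  proof -
    \<comment> \<open>Cutting off outside the box makes f integrable on every box, as
      differentiation along boxes requires.\<close>
    define f where "f x = (if x \<in> cbox c d then g x else 0)" for x
    have gcd: "g integrable_on cbox c d"
      using g cd compact_cbox[of c d] by (simp add: locally_integrable_def set_lebesgue_integral_eq_integral(1))
    have "f integrable_on cbox a b" for a b
      unfolding f_def integrable_restrict_Int Int_interval
      by (rule integrable_on_subcbox[OF gcd]) (auto simp: Int_interval[symmetric])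
    then obtain N where N: "negligible N" "\<And>x e. \<lbrakk>x \<notin> N; 0 < e\<rbrakk> \<Longrightarrow>
        \<exists>r>0. \<forall>h. 0 < h \<and> h < r \<longrightarrow> norm (integral (cbox x (x + h *\<^sub>R One)) f /\<^sub>R h ^ DIM('a) - f x) < e"
      using integrable_ccontinuous_explicit[of f] by metis
    have "g x = 0" if x: "x \<in> box c d" "x \<notin> N" for x
    proof (rule ccontr)
      assume "g x \<noteq> 0"
      have fx: "f x = g x" using x box_subset_cbox[of c d] by (auto simp: f_def)
      \<comment> \<open>The tolerance is |g x| itself: a vanishing box average would be off by
        exactly |f x| = |g x|.\<close>
      obtain r where r: "r > 0" "\<And>h. 0 < h \<Longrightarrow> h < r \<Longrightarrow>
          norm (integral (cbox x (x + h *\<^sub>R One)) f /\<^sub>R h ^ DIM('a) - f x) < \<bar>g x\<bar>"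
        using N(2)[OF x(2), of "\<bar>g x\<bar>"] \<open>g x \<noteq> 0\<close> by auto
      \<comment> \<open>The room between x and the upper faces, so that a cube of side h <= s with
        lower corner x stays in the box.\<close>
      define s where "s = Min ((\<lambda>i. d \<bullet> i - x \<bullet> i) ` Basis)"
      have s: "s > 0" "\<And>i. i \<in> Basis \<Longrightarrow> s \<le> d \<bullet> i - x \<bullet> i"
        using x(1) by (auto simp: s_def mem_box)
      define h where "h = min (r / 2) s"
      have h: "0 < h" "h < r" "h \<le> s" using r(1) s(1) by (auto simp: h_def)
      have sub: "cbox x (x + h *\<^sub>R One) \<subseteq> cbox c d"
        using x(1) s(2) h(3) by (force simp: subset_box mem_box inner_add_left algebra_simps intro: less_imp_le)
      have "integral (cbox x (x + h *\<^sub>R One)) f = integral (cbox x (x + h *\<^sub>R One)) g"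
        using sub by (intro integral_cong) (auto simp: f_def)
      also have "\<dots> = 0" using sub cd by (intro box0) auto
      finally show False using r(2)[OF h(1,2)] fx by simp
    qed
    then have "{x \<in> cbox c d. g x \<noteq> 0} \<subseteq> N \<union> (cbox c d - box c d)" by blast
    moreover have "negligible (N \<union> (cbox c d - box c d))"
      using N(1) negligible_frontier_interval by (rule negligible_Un)
    ultimately show ?thesis using negligible_subset by blast
  qed
  obtain \<D> where D: "countable \<D>" "\<D> \<subseteq> Pow U" "\<And>X. X \<in> \<D> \<Longrightarrow> \<exists>a b. X = cbox a b" "\<Union>\<D> = U"
  proof (rule open_countable_Union_open_cbox[OF U])
    fix \<D> :: "'a set set"
    assume "countable \<D>" "\<D> \<subseteq> Pow U" "\<And>X. X \<in> \<D> \<Longrightarrow> \<exists>a b. X = cbox a b" "\<Union>\<D> = U"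
    then show thesis by (rule that)
  qed
  have "negligible (\<Union>X\<in>\<D>. {x \<in> X. g x \<noteq> 0})"
  proof (rule negligible_countable_Union[OF countable_image[OF D(1)]])
    fix T assume "T \<in> (\<lambda>X. {x \<in> X. g x \<noteq> 0}) ` \<D>"
    then obtain X where X: "X \<in> \<D>" "T = {x \<in> X. g x \<noteq> 0}" by auto
    with D(3) obtain a b where "X = cbox a b" by meson
    with X neg[of a b] D(2) show "negligible T" by auto
  qed
  moreover have "(\<Union>X\<in>\<D>. {x \<in> X. g x \<noteq> 0}) = {x \<in> U. g x \<noteq> 0}" using D(4) by blast
  ultimately have "{x \<in> U. g x \<noteq> 0} \<in> null_sets lebesgue" by (simp add: negligible_iff_null_sets)
  then have "AE x in lebesgue. x \<in> U \<longrightarrow> g x = 0"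
    by (rule AE_I') auto
  then show ?thesis using U by (simp add: AE_lebesgue_on_iff)
qed

text \<open>Exactly what makes u . T \<psi> integrable for locally integrable u. It lets uniqueness
  be proved once for partial derivatives, Laplacian powers and Laplacian powers of a
  divergence.\<close>

definition admissible_operator ::
  "'a::euclidean_space set \<Rightarrow> (('a \<Rightarrow> real) \<Rightarrow> 'a \<Rightarrow> 'b::euclidean_space) \<Rightarrow> bool" where
  "admissible_operator U T \<longleftrightarrow> (\<forall>\<psi>\<in>test_functions U.
     continuous_on UNIV (T \<psi>) \<and> (\<exists>K. compact K \<and> K \<subseteq> U \<and> (\<forall>x. x \<notin> K \<longrightarrow> T \<psi> x = 0)))"

lemma admissible_operator_integrable:
  assumes "open U" "admissible_operator U T" "locally_integrable U u" "\<psi> \<in> test_functions U"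
  shows "integrable (lebesgue_on U) (\<lambda>x. u x \<bullet> T \<psi> x)"
  using assms locally_integrable_inner_integrable[OF assms(1,3)] unfolding admissible_operator_def by blast

lemma distributionally_diff:
  assumes U: "open U" and T: "admissible_operator U T"
    and u: "distributionally U T u g" and u': "distributionally U T u' g'"
  shows "distributionally U T (\<lambda>x. u x - u' x) (\<lambda>x. g x - g' x)"
proof -
  have li: "locally_integrable U u" "locally_integrable U g" "locally_integrable U u'" "locally_integrable U g'"
    using u u' by (auto simp: distributionally_def)
  show ?thesis
    using u u' admissible_operator_integrable[OF U T] locally_integrable_test_integrable[OF U] li
    by (auto simp: distributionally_def inner_diff_left left_diff_distrib intro!: locally_integrable_diff)
qed

text \<open>The difference of the two derivatives pairs to 0 with every test function, so the
  fundamental lemma applies. Starting from a.e. equal u and u' also shows that changing a function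
  on a null set does not affect its weak derivative.\<close>

lemma distributionally_unique:
  assumes U: "open U" and T: "admissible_operator U T"
    and u: "distributionally U T u g" and u': "distributionally U T u' g'"
    and eq: "AE x in lebesgue_on U. u x = u' x"
  shows "AE x in lebesgue_on U. g x = g' x"
proof -
  note d = distributionally_diff[OF U T u u']
  have "AE x in lebesgue_on U. g x - g' x = 0"
  proof (rule fundamental_lemma[OF U])
    show li: "locally_integrable U (\<lambda>x. g x - g' x)" using d by (auto simp: distributionally_def)
    fix \<psi> assume \<psi>: "\<psi> \<in> test_functions U"
    have "(LINT x|lebesgue_on U. (g x - g' x) * \<psi> x) = (LINT x|lebesgue_on U. (u x - u' x) \<bullet> T \<psi> x)"
      using d \<psi> by (auto simp: distributionally_def)
    also have "\<dots> = (LINT x|lebesgue_on U. 0)"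
    proof (rule integral_cong_AE)
      have "integrable (lebesgue_on U) (\<lambda>x. (u x - u' x) \<bullet> T \<psi> x)"
        using d \<psi> by (intro admissible_operator_integrable[OF U T]) (auto simp: distributionally_def)
      then show "(\<lambda>x. (u x - u' x) \<bullet> T \<psi> x) \<in> borel_measurable (lebesgue_on U)" by simp
      show "AE x in lebesgue_on U. (u x - u' x) \<bullet> T \<psi> x = 0"
        using eq by eventually_elim simp
    qed simp
    finally show "(LINT x|lebesgue_on U. (g x - g' x) * \<psi> x) = 0" by simp
  qed
  then show ?thesis by eventually_elim simp
qed

lemma admissible_operatorI:
  assumes "\<And>\<psi>. \<psi> \<in> test_functions U \<Longrightarrow> T \<psi> \<in> test_functions U"
  shows "admissible_operator U T"
  using assms unfolding admissible_operator_def by (metis smooth_continuous test_functionsE)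

lemma admissible_partials:
  assumes "set bs \<subseteq> Basis"
  shows "admissible_operator U (\<lambda>\<psi> x. (- 1) ^ length bs * partials bs \<psi> x)"
  using assms by (intro admissible_operatorI test_functions_mult test_functions_partials) auto

lemma admissible_laplace_power: "admissible_operator U (\<lambda>\<psi>. (laplace ^^ k) \<psi>)"
  by (intro admissible_operatorI test_functions_laplace_power)

lemma admissible_grad_laplace_power:
  "admissible_operator U (\<lambda>\<psi> x. - grad ((laplace ^^ k) \<psi>) x)"
  unfolding admissible_operator_def
proof (intro ballI conjI)
  fix \<psi> assume "\<psi> \<in> test_functions U"
  then have t: "(laplace ^^ k) \<psi> \<in> test_functions U" by (rule test_functions_laplace_power)
  then obtain K where K: "smooth ((laplace ^^ k) \<psi>)" "compact K" "K \<subseteq> U" "\<And>x. x \<notin> K \<Longrightarrow> (laplace ^^ k) \<psi> x = 0"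
    by (elim test_functionsE) blast
  show "continuous_on UNIV (\<lambda>x. - grad ((laplace ^^ k) \<psi>) x)"
    unfolding grad_def using K(1) by (intro continuous_intros smooth_continuous smooth_partial) auto
  show "\<exists>K. compact K \<and> K \<subseteq> U \<and> (\<forall>x. x \<notin> K \<longrightarrow> - grad ((laplace ^^ k) \<psi>) x = 0)"
    using K partial_outside_support[OF compact_imp_closed[OF K(2)] K(4)]
    by (intro exI[of _ K]) (auto simp: grad_def)
qed

text \<open>Any explicitly known weak derivative determines the one chosen by \<open>SOME\<close> up
  to a null set; the two lemmas below do the same for the other operators.\<close>

lemma weak_partials:
  assumes U: "open U" and bs: "set bs \<subseteq> Basis" and g: "has_weak_partials U bs u g"
  shows "has_weak_partials U bs u (weak_partials U bs u)"
    and "AE x in lebesgue_on U. g x = weak_partials U bs u x"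
proof -
  show h: "has_weak_partials U bs u (weak_partials U bs u)"
    unfolding weak_partials_def using g by (rule someI[of "has_weak_partials U bs u"])
  show "AE x in lebesgue_on U. g x = weak_partials U bs u x"
    using distributionally_unique[OF U admissible_partials[OF bs]] g h
    unfolding has_weak_partials_def by blast
qed

lemma weak_laplace_power:
  assumes U: "open U" and g: "has_weak_laplace_power U k u g"
  shows "has_weak_laplace_power U k u (weak_laplace_power U k u)"
    and "AE x in lebesgue_on U. g x = weak_laplace_power U k u x"
proof -
  show h: "has_weak_laplace_power U k u (weak_laplace_power U k u)"
    unfolding weak_laplace_power_def using g by (rule someI[of "has_weak_laplace_power U k u"])
  show "AE x in lebesgue_on U. g x = weak_laplace_power U k u x"
    using distributionally_unique[OF U admissible_laplace_power] g h
    unfolding has_weak_laplace_power_def by blast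
qed

lemma weak_laplace_power_div:
  assumes U: "open U" and g: "has_weak_laplace_power_div U k u g"
  shows "has_weak_laplace_power_div U k u (weak_laplace_power_div U k u)"
    and "AE x in lebesgue_on U. g x = weak_laplace_power_div U k u x"
proof -
  show h: "has_weak_laplace_power_div U k u (weak_laplace_power_div U k u)"
    unfolding weak_laplace_power_div_def using g by (rule someI[of "has_weak_laplace_power_div U k u"])
  show "AE x in lebesgue_on U. g x = weak_laplace_power_div U k u x"
    using distributionally_unique[OF U admissible_grad_laplace_power] g h
    unfolding has_weak_laplace_power_div_def by blast
qed

subsection \<open>Weak derivatives of smooth functions\<close>

lemma test_integral_eq_lborel:
  assumes "open U" "smooth f" "\<psi> \<in> test_functions U"
  shows "(LINT x|lebesgue_on U. f x * \<psi> x) = (LINT x|lborel. f x * \<psi> x)"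
proof (rule lebesgue_on_integral_eq_lborel)
  show "(\<lambda>x. f x * \<psi> x) \<in> borel_measurable borel"
    using smooth_continuous[OF smooth_mult[OF assms(2) test_functions_smooth[OF assms(3)]]]
    by (rule borel_measurable_continuous_onI)
  show "f x * \<psi> x = 0" if "x \<notin> U" for x
    using assms(3) that by (elim test_functionsE) auto
qed (use assms in auto)

text \<open>The outermost derivative on \<psi> is moved first and becomes the innermost one on f,
  hence the reversed list; symmetry of mixed partials does not enter.\<close>

lemma integration_by_parts_partials:
  assumes "smooth f" "\<psi> \<in> test_functions U" "set bs \<subseteq> Basis"
  shows "(LINT x|lborel. f x * partials bs \<psi> x) = (- 1) ^ length bs * (LINT x|lborel. partials (rev bs) f x * \<psi> x)"
  using assms
proof (induction bs arbitrary: f)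
  case (Cons b bs)
  have "(LINT x|lborel. f x * partials (b # bs) \<psi> x) = - (LINT x|lborel. partial b f x * partials bs \<psi> x)"
    using Cons.prems integration_by_parts[of f "partials bs \<psi>" U b]
    by (simp add: partials_Cons test_functions_partials)
  also have "\<dots> = - ((- 1) ^ length bs * (LINT x|lborel. partials (rev bs) (partial b f) x * \<psi> x))"
    using Cons.prems by (subst Cons.IH) (auto simp: smooth_partial)
  finally show ?case by (simp add: partials_snoc)
qed simp

lemma has_weak_partials_smooth:
  assumes "open U" "smooth f" "set bs \<subseteq> Basis"
  shows "has_weak_partials U bs f (partials (rev bs) f)"
  unfolding has_weak_partials_def distributionally_def
proof (intro conjI ballI)
  fix \<psi> assume \<psi>: "\<psi> \<in> test_functions U"
  have "(LINT x|lebesgue_on U. f x \<bullet> ((- 1) ^ length bs * partials bs \<psi> x))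
      = (LINT x|lebesgue_on U. (- 1) ^ length bs * (f x * partials bs \<psi> x))" by (simp add: mult_ac)
  also have "\<dots> = (- 1) ^ length bs * (LINT x|lborel. f x * partials bs \<psi> x)"
    using test_integral_eq_lborel[OF assms(1,2) test_functions_partials[OF \<psi> assms(3)]] by simp
  also have "\<dots> = (LINT x|lborel. partials (rev bs) f x * \<psi> x)"
    unfolding integration_by_parts_partials[OF assms(2) \<psi> assms(3)]
    by (simp flip: mult.assoc power_mult_distrib)
  also have "\<dots> = (LINT x|lebesgue_on U. partials (rev bs) f x * \<psi> x)"
    using assms \<psi> by (intro test_integral_eq_lborel[symmetric] smooth_partials) auto
  finally show "(LINT x|lebesgue_on U. f x \<bullet> ((- 1) ^ length bs * partials bs \<psi> x))
    = (LINT x|lebesgue_on U. partials (rev bs) f x * \<psi> x)" .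
qed (use assms in \<open>auto intro!: locally_integrable_continuous smooth_continuous smooth_partials\<close>)

lemma smooth_integral_laplace:
  assumes "smooth f" "\<psi> \<in> test_functions U"
  shows "(LINT x|lborel. f x * laplace \<psi> x) = (LINT x|lborel. laplace f x * \<psi> x)"
proof -
  have int: "integrable lborel (\<lambda>x. g x * \<phi> x)" if g: "smooth g" and \<phi>: "\<phi> \<in> test_functions U" for g \<phi> :: "'a \<Rightarrow> real"
  proof -
    obtain K where "smooth \<phi>" "compact K" "\<And>x. x \<notin> K \<Longrightarrow> \<phi> x = 0"
      using \<phi> by (elim test_functionsE) blast
    then show ?thesis
      using compactly_supported_integrable[of "\<lambda>x. g x * \<phi> x" K] smooth_continuous[OF smooth_mult[OF g]]
        compact_imp_bounded by force
  qed
  have "(LINT x|lborel. f x * laplace \<psi> x) = (\<Sum>b\<in>Basis. LINT x|lborel. f x * partials [b, b] \<psi> x)"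
    using assms by (simp add: laplace_def sum_distrib_left partials_Cons int test_functions_partial)
  \<comment> \<open>The list \<open>[b, b]\<close> equals its reverse and has even length.\<close>
  also have "\<dots> = (\<Sum>b\<in>Basis. LINT x|lborel. partials [b, b] f x * \<psi> x)"
    by (intro sum.cong refl) (subst integration_by_parts_partials[OF assms], auto)
  also have "\<dots> = (LINT x|lborel. laplace f x * \<psi> x)"
    using assms by (simp add: laplace_def sum_distrib_right partials_Cons int smooth_partial)
  finally show ?thesis .
qed

lemma has_weak_laplace_power_smooth:
  assumes "open U" "smooth f"
  shows "has_weak_laplace_power U k f ((laplace ^^ k) f)"
  unfolding has_weak_laplace_power_def distributionally_def
proof (intro conjI ballI)
  fix \<psi> assume \<psi>: "\<psi> \<in> test_functions U"
  have "(LINT x|lborel. f x * (laplace ^^ k) \<psi> x) = (LINT x|lborel. (laplace ^^ k) f x * \<psi> x)"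
    using assms(2)
  proof (induction k arbitrary: f)
    case (Suc k)
    have "(LINT x|lborel. f x * (laplace ^^ Suc k) \<psi> x) = (LINT x|lborel. laplace f x * (laplace ^^ k) \<psi> x)"
      using smooth_integral_laplace[OF Suc.prems test_functions_laplace_power[OF \<psi>], of k] by simp
    also have "\<dots> = (LINT x|lborel. (laplace ^^ k) (laplace f) x * \<psi> x)"
      by (rule Suc.IH[OF smooth_laplace[OF Suc.prems]])
    finally show ?case by (simp add: funpow_swap1)
  qed simp
  then show "(LINT x|lebesgue_on U. f x \<bullet> (laplace ^^ k) \<psi> x) = (LINT x|lebesgue_on U. (laplace ^^ k) f x * \<psi> x)"
    using assms \<psi> by (simp add: test_integral_eq_lborel test_functions_laplace_power smooth_laplace_power)
qed (use assms in \<open>auto intro!: locally_integrable_continuous smooth_continuous smooth_laplace_power\<close>)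

subsection \<open>Powers of the Laplacian as sums of iterated partial derivatives\<close>

text \<open>The lists b1 b1 b2 b2 ... bk bk, over which the iterated partials sum to the k-th power
  of the Laplacian. They link it to the weak partials of Sobolev functions, which are indexed by
  lists.\<close>

primrec laplace_lists :: "nat \<Rightarrow> 'a::euclidean_space list set" where
  "laplace_lists 0 = {[]}"
| "laplace_lists (Suc k) = (\<lambda>(b, c). b # b # c) ` (Basis \<times> laplace_lists k)"

lemma finite_laplace_lists [simp]: "finite (laplace_lists k)"
  by (induction k) auto

lemma laplace_listsD:
  assumes "c \<in> laplace_lists k"
  shows "set c \<subseteq> Basis" "length c = 2 * k"
proof -
  have "set c \<subseteq> Basis \<and> length c = 2 * k"
    using assms by (induction k arbitrary: c) fastforce+
  then show "set c \<subseteq> Basis" "length c = 2 * k" by auto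
qed

lemma laplace_power_eq_sum:
  assumes "smooth f"
  shows "(laplace ^^ k) f = (\<lambda>x. \<Sum>c\<in>laplace_lists k. partials c f x)"
proof (induction k)
  case (Suc k)
  have s: "smooth (partials c f)" if "c \<in> laplace_lists k" for c
    using smooth_partials[OF assms laplace_listsD(1)[OF that]] .
  have "(laplace ^^ Suc k) f x = (\<Sum>b\<in>Basis. \<Sum>c\<in>laplace_lists k. partials (b # b # c) f x)" for x
    using s by (simp add: Suc.IH laplace_def partial_sum smooth_partial partials_Cons)
  also have "\<dots> x = (\<Sum>(b, c)\<in>Basis \<times> laplace_lists k. partials (b # b # c) f x)" for x
    by (simp add: sum.cartesian_product)
  also have "\<dots> x = (\<Sum>c\<in>laplace_lists (Suc k). partials c f x)" for x
    by (simp add: sum.reindex inj_on_def case_prod_unfold)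
  finally show ?case by blast
qed simp

subsection \<open>Sobolev spaces\<close>

lemma Lp_Pair:
  assumes "f \<in> Lp q D"
  shows "(\<lambda>x. (f x, 0)) \<in> Lp q D" "(\<lambda>x. (0, f x)) \<in> Lp q D"
  using assms by (auto simp: Lp_def norm_Pair)

lemma Lp_norm_Pair:
  "Lp_norm q D (\<lambda>x. (f x, 0)) = Lp_norm q D f" "Lp_norm q D (\<lambda>x. (0, f x)) = Lp_norm q D f"
  by (auto simp: Lp_norm_def norm_Pair)

lemma Lp_scaleR_const:
  fixes f :: "'a::euclidean_space \<Rightarrow> real"
  assumes "f \<in> Lp q D"
  shows "(\<lambda>x. f x *\<^sub>R b) \<in> Lp q D"
  using assms by (auto simp: Lp_def powr_mult)

lemma Lp_norm_scaleR_Basis: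
  assumes "b \<in> Basis"
  shows "Lp_norm q D (\<lambda>x. f x *\<^sub>R b) = Lp_norm q D f"
  using assms by (simp add: Lp_norm_def)

lemma test_functions_Lp:
  assumes "open U" "\<psi> \<in> test_functions U" "q > 0"
  shows "\<psi> \<in> Lp q U"
    and "Lp_norm q U \<psi> = (LINT x|lborel. \<bar>\<psi> x\<bar> powr q) powr (1 / q)"
proof -
  obtain K where K: "smooth \<psi>" "compact K" "K \<subseteq> U" "\<And>x. x \<notin> K \<Longrightarrow> \<psi> x = 0"
    using assms(2) by (elim test_functionsE) blast
  have c: "continuous_on UNIV (\<lambda>x. \<bar>\<psi> x\<bar> powr q)"
    using assms(3) smooth_continuous[OF K(1), of UNIV]
    by (intro continuous_on_powr' continuous_on_rabs continuous_on_const) auto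
  have 0: "\<bar>\<psi> x\<bar> powr q = 0" if "x \<notin> U" for x using K(3,4) that by auto
  have i: "integrable lborel (\<lambda>x. \<bar>\<psi> x\<bar> powr q)"
    using K(4) by (intro compactly_supported_integrable[OF c compact_imp_bounded[OF K(2)]]) auto
  note eq = lebesgue_on_integral_eq_lborel[OF open_lebesgue[OF assms(1)] borel_measurable_continuous_onI[OF c] 0]
  have "\<psi> \<in> borel_measurable (lebesgue_on U)"
    using smooth_continuous[OF K(1)] assms(1) by (intro continuous_imp_measurable_on_sets_lebesgue) auto
  then show "\<psi> \<in> Lp q U" using eq(2) i by (simp add: Lp_def)
  show "Lp_norm q U \<psi> = (LINT x|lborel. \<bar>\<psi> x\<bar> powr q) powr (1 / q)"
    using eq(1) by (simp add: Lp_norm_def)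
qed

lemma sum_powr_le_powr_sum:
  fixes a :: "'i \<Rightarrow> real"
  assumes "r \<ge> 1" "\<And>i. i \<in> I \<Longrightarrow> a i \<ge> 0"
  shows "(\<Sum>i\<in>I. a i powr r) \<le> (\<Sum>i\<in>I. a i) powr r"
  using assms(2)
proof (induction I rule: infinite_finite_induct)
  case (insert i I)
  then have "(\<Sum>i\<in>insert i I. a i powr r) \<le> a i powr r + (\<Sum>i\<in>I. a i) powr r" by simp
  also have "\<dots> \<le> (\<Sum>i\<in>insert i I. a i) powr r"
    using insert powr_add_superadditive[of "a i" "\<Sum>i\<in>I. a i" r] assms(1) by (simp add: sum_nonneg)
  finally show ?case .
qed auto

context
  fixes U :: "'a::euclidean_space set" and p :: real and m :: nat
  assumes U: "open U" and p: "p > 1"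
begin

abbreviation (input) "\<P> \<equiv> weak_partials U"
abbreviation (input) "\<S> \<equiv> Sobolev_norm m p U"

lemma Omega_lebesgue: "U \<in> sets lebesgue"
  using U by simp

section \<open>Weak derivatives of Sobolev functions\<close>

lemma Sobolev_weak_partials:
  assumes u: "u \<in> Sobolev m p U" and bs: "set bs \<subseteq> Basis" "length bs \<le> m"
  shows "has_weak_partials U bs u (\<P> bs u)" "\<P> bs u \<in> Lp p U"
proof -
  obtain g where g: "g \<in> Lp p U" "has_weak_partials U bs u g"
    using u bs by (auto simp: Sobolev_def)
  show "has_weak_partials U bs u (\<P> bs u)" by (rule weak_partials(1)[OF U bs(1) g(2)])
  show "\<P> bs u \<in> Lp p U"
    by (rule Lp_AE[OF Omega_lebesgue g(1) weak_partials(2)[OF U bs(1) g(2)]])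
qed

lemma Sobolev_Lp: "u \<in> Sobolev m p U \<Longrightarrow> u \<in> Lp p U"
  by (simp add: Sobolev_def)

lemma Sobolev_diff:
  assumes u: "u \<in> Sobolev m p U" and u': "u' \<in> Sobolev m p U"
  shows "(\<lambda>x. u x - u' x) \<in> Sobolev m p U"
    and "\<And>bs. set bs \<subseteq> Basis \<Longrightarrow> length bs \<le> m \<Longrightarrow> AE x in lebesgue_on U.
      \<P> bs u x - \<P> bs u' x = \<P> bs (\<lambda>x. u x - u' x) x"
proof -
  have d: "has_weak_partials U bs (\<lambda>x. u x - u' x) (\<lambda>x. \<P> bs u x - \<P> bs u' x)"
    if "set bs \<subseteq> Basis" "length bs \<le> m" for bs
    using distributionally_diff[OF U admissible_partials] Sobolev_weak_partials(1)[OF u that]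
      Sobolev_weak_partials(1)[OF u' that] that(1) unfolding has_weak_partials_def by blast
  show "(\<lambda>x. u x - u' x) \<in> Sobolev m p U"
    unfolding Sobolev_def
  proof (intro CollectI conjI allI impI)
    show "(\<lambda>x. u x - u' x) \<in> Lp p U" using u u' p by (intro Lp_diff Sobolev_Lp) auto
    fix bs :: "'a list" assume bs: "set bs \<subseteq> Basis \<and> length bs \<le> m"
    show "\<exists>g\<in>Lp p U. has_weak_partials U bs (\<lambda>x. u x - u' x) g"
      using d bs p Lp_diff[OF _ Sobolev_weak_partials(2)[OF u] Sobolev_weak_partials(2)[OF u'], of bs bs]
      by (intro bexI[of _ "\<lambda>x. \<P> bs u x - \<P> bs u' x"]) auto
  qed
  show "AE x in lebesgue_on U.
      \<P> bs u x - \<P> bs u' x = \<P> bs (\<lambda>x. u x - u' x) x"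
    if "set bs \<subseteq> Basis" "length bs \<le> m" for bs
    using weak_partials(2)[OF U that(1) d[OF that]] .
qed

lemma test_functions_Sobolev:
  assumes "\<psi> \<in> test_functions U"
  shows "\<psi> \<in> Sobolev m p U"
  unfolding Sobolev_def
proof (intro CollectI conjI allI impI)
  show "\<psi> \<in> Lp p U" using assms p by (intro test_functions_Lp U) auto
  fix bs :: "'a list" assume bs: "set bs \<subseteq> Basis \<and> length bs \<le> m"
  have "partials (rev bs) \<psi> \<in> test_functions U" using assms bs by (intro test_functions_partials) auto
  then show "\<exists>g\<in>Lp p U. has_weak_partials U bs \<psi> g"
    using has_weak_partials_smooth[OF U test_functions_smooth[OF assms]] bs p test_functions_Lp(1)[OF U]
    by (intro bexI[of _ "partials (rev bs) \<psi>"]) auto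
qed

lemma Sobolev_integral_laplace_power:
  assumes u: "u \<in> Sobolev m p U" and k: "2 * k \<le> m" and \<psi>: "\<psi> \<in> test_functions U"
  shows "(LINT x|lebesgue_on U. u x * (laplace ^^ k) \<psi> x)
      = (\<Sum>c\<in>laplace_lists k. LINT x|lebesgue_on U. u x * partials c \<psi> x)"
proof -
  have "locally_integrable U u"
    using Sobolev_weak_partials(1)[OF u, of "[]"] by (auto simp: has_weak_partials_def distributionally_def)
  then have "integrable (lebesgue_on U) (\<lambda>x. u x * partials c \<psi> x)" if "c \<in> laplace_lists k" for c
    using that \<psi> by (intro locally_integrable_test_integrable U test_functions_partials laplace_listsD)
  then show ?thesis
    by (simp add: laplace_power_eq_sum[OF test_functions_smooth[OF \<psi>]] sum_distrib_left)
qed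

lemma Sobolev_integral_partials:
  assumes u: "u \<in> Sobolev m p U" and bs: "set bs \<subseteq> Basis" "length bs \<le> m" and \<psi>: "\<psi> \<in> test_functions U"
  shows "(LINT x|lebesgue_on U. u x * partials bs \<psi> x)
      = (- 1) ^ length bs * (LINT x|lebesgue_on U. \<P> bs u x * \<psi> x)"
proof -
  have "(LINT x|lebesgue_on U. (- 1) ^ length bs * (u x * partials bs \<psi> x))
      = (LINT x|lebesgue_on U. \<P> bs u x * \<psi> x)"
    using Sobolev_weak_partials(1)[OF u bs] \<psi>
    by (simp add: has_weak_partials_def distributionally_def mult.left_commute)
  then have "(- 1) ^ length bs * (LINT x|lebesgue_on U. u x * partials bs \<psi> x)
      = (LINT x|lebesgue_on U. \<P> bs u x * \<psi> x)" by simp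
  then show ?thesis by (cases "even (length bs)") auto
qed

lemma weak_partials_locally_integrable:
  assumes "u \<in> Sobolev m p U" "set bs \<subseteq> Basis" "length bs \<le> m"
  shows "locally_integrable U (\<P> bs u)"
  using Sobolev_weak_partials(1)[OF assms] by (simp add: has_weak_partials_def distributionally_def)

text \<open>The Laplacian power of \<psi> is expanded and each summand is moved onto u separately;
  the lists have even length, so no signs appear.\<close>

lemma Sobolev_has_weak_laplace_power:
  assumes u: "u \<in> Sobolev m p U" and k: "2 * k \<le> m"
  shows "has_weak_laplace_power U k u (\<lambda>x. \<Sum>c\<in>laplace_lists k. \<P> c u x)"
  unfolding has_weak_laplace_power_def distributionally_def
proof (intro conjI ballI)
  have li: "locally_integrable U (\<P> c u)" if "c \<in> laplace_lists k" for c
    using laplace_listsD[OF that] k by (intro weak_partials_locally_integrable[OF u]) auto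
  show "locally_integrable U u"
    using Sobolev_weak_partials(1)[OF u, of "[]"] by (auto simp: has_weak_partials_def distributionally_def)
  show "locally_integrable U (\<lambda>x. \<Sum>c\<in>laplace_lists k. \<P> c u x)"
    by (rule locally_integrable_sum[OF li])
  fix \<psi> assume \<psi>: "\<psi> \<in> test_functions U"
  have "(LINT x|lebesgue_on U. u x * (laplace ^^ k) \<psi> x)
      = (\<Sum>c\<in>laplace_lists k. LINT x|lebesgue_on U. \<P> c u x * \<psi> x)"
    unfolding Sobolev_integral_laplace_power[OF u k \<psi>]
  proof (intro sum.cong refl)
    fix c :: "'a list" assume "c \<in> laplace_lists k"
    then show "(LINT x|lebesgue_on U. u x * partials c \<psi> x) = (LINT x|lebesgue_on U. \<P> c u x * \<psi> x)"
      using k by (subst Sobolev_integral_partials[OF u _ _ \<psi>]) (auto simp: laplace_listsD)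
  qed
  also have "\<dots> = (LINT x|lebesgue_on U. (\<Sum>c\<in>laplace_lists k. \<P> c u x) * \<psi> x)"
    using locally_integrable_test_integrable[OF U li \<psi>] by (simp add: sum_distrib_right)
  finally show "(LINT x|lebesgue_on U. u x \<bullet> (laplace ^^ k) \<psi> x)
      = (LINT x|lebesgue_on U. (\<Sum>c\<in>laplace_lists k. \<P> c u x) * \<psi> x)" by simp
qed

text \<open>This provides the weak gradient in \<open>Dm\<close> for odd m. An arbitrary g is
  allowed so that the choice \<open>weak_laplace_power\<close> can be inserted.\<close>

lemma Sobolev_has_weak_partials_laplace_power:
  assumes u: "u \<in> Sobolev m p U" and k: "2 * k + 1 \<le> m" and b: "b \<in> Basis"
    and g: "has_weak_laplace_power U k u g"
  shows "has_weak_partials U [b] g (\<lambda>x. \<Sum>c\<in>laplace_lists k. \<P> (c @ [b]) u x)"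
  unfolding has_weak_partials_def distributionally_def
proof (intro conjI ballI)
  have cb: "set (c @ [b]) \<subseteq> Basis" "length (c @ [b]) \<le> m" "odd (length (c @ [b]))" if "c \<in> laplace_lists k" for c
    using laplace_listsD[OF that] k b by auto
  have li: "locally_integrable U (\<P> (c @ [b]) u)" if "c \<in> laplace_lists k" for c
    using cb[OF that] by (intro weak_partials_locally_integrable[OF u])
  show "locally_integrable U g"
    using g by (auto simp: has_weak_laplace_power_def distributionally_def)
  show "locally_integrable U (\<lambda>x. \<Sum>c\<in>laplace_lists k. \<P> (c @ [b]) u x)"
    by (rule locally_integrable_sum[OF li])
  fix \<psi> assume \<psi>: "\<psi> \<in> test_functions U"
  then have p\<psi>: "partial b \<psi> \<in> test_functions U" by (rule test_functions_partial[OF _ b])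
  \<comment> \<open>The weak equation for g is tested with \<open>partial b \<psi>\<close>, again a
    test function.\<close>
  have "(LINT x|lebesgue_on U. g x * partial b \<psi> x) = (LINT x|lebesgue_on U. u x * (laplace ^^ k) (partial b \<psi>) x)"
    using g p\<psi> by (simp add: has_weak_laplace_power_def distributionally_def)
  also have "\<dots> = (\<Sum>c\<in>laplace_lists k. LINT x|lebesgue_on U. u x * partials (c @ [b]) \<psi> x)"
    using k by (simp add: Sobolev_integral_laplace_power[OF u _ p\<psi>] partials_snoc)
  also have "\<dots> = (\<Sum>c\<in>laplace_lists k. - (LINT x|lebesgue_on U. \<P> (c @ [b]) u x * \<psi> x))"
  proof (intro sum.cong refl)
    fix c :: "'a list" assume c: "c \<in> laplace_lists k"
    show "(LINT x|lebesgue_on U. u x * partials (c @ [b]) \<psi> x)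
        = - (LINT x|lebesgue_on U. \<P> (c @ [b]) u x * \<psi> x)"
      unfolding Sobolev_integral_partials[OF u cb(1,2)[OF c] \<psi>] using cb(3)[OF c] by simp
  qed
  also have "\<dots> = - (LINT x|lebesgue_on U. (\<Sum>c\<in>laplace_lists k. \<P> (c @ [b]) u x) * \<psi> x)"
    using locally_integrable_test_integrable[OF U li \<psi>] by (simp add: sum_distrib_right sum_negf)
  finally show "(LINT x|lebesgue_on U. g x \<bullet> ((- 1) ^ length [b] * partials [b] \<psi> x))
      = (LINT x|lebesgue_on U. (\<Sum>c\<in>laplace_lists k. \<P> (c @ [b]) u x) * \<psi> x)"
    by (simp add: partials_Cons)
qed

text \<open>An explicit representative of \<open>Dm U m u\<close>, from which L^p membership, a.e.
  linearity and the bound by the Sobolev norm are read off.\<close>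

definition Dm_sum :: "('a \<Rightarrow> real) \<Rightarrow> 'a \<Rightarrow> real \<times> 'a" where
  "Dm_sum u x =
     (if even m then (\<Sum>c\<in>laplace_lists (m div 2). \<P> c u x, 0)
      else (0, \<Sum>b\<in>Basis. \<Sum>c\<in>laplace_lists (m div 2). \<P> (c @ [b]) u x *\<^sub>R b))"

lemma Dm_eq_sum:
  assumes u: "u \<in> Sobolev m p U"
  shows "AE x in lebesgue_on U. Dm_sum u x = Dm U m u x"
proof -
  define k where "k = m div 2"
  note l = Sobolev_has_weak_laplace_power[OF u, of k]
  show ?thesis
  proof (cases "even m")
    case True
    then show ?thesis
      using weak_laplace_power(2)[OF U l] by (simp add: Dm_def Dm_sum_def k_def)
  next
    case False
    then have m: "2 * k + 1 \<le> m" by (auto simp: k_def)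
    have "AE x in lebesgue_on U. (\<Sum>c\<in>laplace_lists k. \<P> (c @ [b]) u x)
        = \<P> [b] (weak_laplace_power U k u) x" if "b \<in> Basis" for b
      using m that by (intro weak_partials(2)[OF U]
          Sobolev_has_weak_partials_laplace_power[OF u m that weak_laplace_power(1)[OF U l]]) auto
    then have "AE x in lebesgue_on U. \<forall>b\<in>Basis. (\<Sum>c\<in>laplace_lists k. \<P> (c @ [b]) u x)
        = \<P> [b] (weak_laplace_power U k u) x"
      by (intro AE_finite_allI) auto
    then show ?thesis
      by eventually_elim (use False in \<open>simp add: Dm_def Dm_sum_def k_def weak_grad_def flip: scaleR_sum_left\<close>)
  qed
qed

lemma
  assumes u: "u \<in> Sobolev m p U"
  shows Dm_Lp: "Dm U m u \<in> Lp p U"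
    and Dm_norm_eq_sum: "Dm_norm U m p u = Lp_norm p U (Dm_sum u)"
proof -
  have "set c \<subseteq> Basis" "length c \<le> m" if "c \<in> laplace_lists (m div 2)" for c :: "'a list"
    using laplace_listsD[OF that] by auto
  then have "(\<lambda>x. \<Sum>c\<in>laplace_lists (m div 2). \<P> c u x) \<in> Lp p U"
    using p by (intro Lp_sum Sobolev_weak_partials(2)[OF u]) auto
  moreover have "(\<lambda>x. \<Sum>b\<in>Basis. \<Sum>c\<in>laplace_lists (m div 2). \<P> (c @ [b]) u x *\<^sub>R b) \<in> Lp p U" if "odd m"
  proof -
    have m: "2 * (m div 2) + 1 = m" using that by presburger
    have "set (c @ [b]) \<subseteq> Basis" "length (c @ [b]) \<le> m" if "c \<in> laplace_lists (m div 2)" "b \<in> Basis" for c and b :: 'a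
      using laplace_listsD[OF that(1)] that(2) m by auto
    then show ?thesis
      using p by (intro Lp_sum Lp_scaleR_const Sobolev_weak_partials(2)[OF u]) auto
  qed
  ultimately have "Dm_sum u \<in> Lp p U"
    unfolding Dm_sum_def[abs_def] by (cases "even m") (auto intro: Lp_Pair)
  then show "Dm U m u \<in> Lp p U" "Dm_norm U m p u = Lp_norm p U (Dm_sum u)"
    using Lp_AE[OF Omega_lebesgue _ Dm_eq_sum[OF u]] Lp_norm_AE[OF Omega_lebesgue _ Dm_eq_sum[OF u]]
    by (auto simp: Dm_norm_def)
qed

lemma Dm_diff:
  assumes u: "u \<in> Sobolev m p U" and u': "u' \<in> Sobolev m p U"
  shows "AE x in lebesgue_on U. Dm U m (\<lambda>x. u x - u' x) x = Dm U m u x - Dm U m u' x"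
proof -
  \<comment> \<open>The finitely many derivatives entering \<open>Dm_sum\<close>; finiteness lets
    their exceptional null sets be united.\<close>
  define L where "L = (if even m then laplace_lists (m div 2)
    else (\<lambda>(c, b). c @ [b]) ` (laplace_lists (m div 2) \<times> (Basis::'a set)))"
  have "AE x in lebesgue_on U. \<forall>bs\<in>L.
      \<P> bs u x - \<P> bs u' x = \<P> bs (\<lambda>x. u x - u' x) x"
  proof (rule AE_finite_allI)
    show "finite L" by (simp add: L_def)
    fix bs :: "'a list" assume "bs \<in> L"
    then have "set bs \<subseteq> Basis" "length bs \<le> m"
      by (force simp: L_def laplace_listsD split: if_splits dest: laplace_listsD)+
    then show "AE x in lebesgue_on U.
      \<P> bs u x - \<P> bs u' x = \<P> bs (\<lambda>x. u x - u' x) x"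
      by (rule Sobolev_diff(2)[OF u u'])
  qed
  with Dm_eq_sum[OF u] Dm_eq_sum[OF u'] Dm_eq_sum[OF Sobolev_diff(1)[OF u u']] show ?thesis
  proof eventually_elim
    case (elim x)
    have "Dm_sum (\<lambda>x. u x - u' x) x = Dm_sum u x - Dm_sum u' x"
    proof (cases "even m")
      case True
      then show ?thesis using elim(4) by (simp add: Dm_sum_def L_def sum_subtractf[symmetric])
    next
      case False
      then have "\<And>b c. b \<in> Basis \<Longrightarrow> c \<in> laplace_lists (m div 2) \<Longrightarrow>
        \<P> (c @ [b]) u x - \<P> (c @ [b]) u' x = \<P> (c @ [b]) (\<lambda>x. u x - u' x) x"
        using elim(4) by (auto simp: L_def)
      with False show ?thesis
        by (simp add: Dm_sum_def sum_subtractf[symmetric] scaleR_diff_left[symmetric])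
    qed
    with elim show ?case by simp
  qed
qed

lemma Dm_norm_diff:
  assumes u: "u \<in> Sobolev m p U" and u': "u' \<in> Sobolev m p U"
  shows "Dm_norm U m p (\<lambda>x. u x - u' x) = Lp_norm p U (\<lambda>x. Dm U m u x - Dm U m u' x)"
  unfolding Dm_norm_def
  using Lp_norm_AE[OF Omega_lebesgue Dm_Lp[OF Sobolev_diff(1)[OF u u']] Dm_diff[OF u u']] by simp

lemma Dm_smooth:
  assumes \<psi>: "\<psi> \<in> test_functions U"
  shows "AE x in lebesgue_on U. Dm U m \<psi> x =
    (if even m then ((laplace ^^ (m div 2)) \<psi> x, 0) else (0, grad ((laplace ^^ (m div 2)) \<psi>) x))"
proof -
  define k where "k = m div 2"
  define f where "f = (laplace ^^ k) \<psi>"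
  have u: "\<psi> \<in> Sobolev m p U" by (rule test_functions_Sobolev[OF \<psi>])
  have f: "smooth f" using test_functions_smooth[OF \<psi>] by (simp add: f_def smooth_laplace_power)
  have wl: "has_weak_laplace_power U k \<psi> f"
    unfolding f_def by (rule has_weak_laplace_power_smooth[OF U test_functions_smooth[OF \<psi>]])
  note wlf = weak_laplace_power[OF U wl]
  show ?thesis
  proof (cases "even m")
    case True
    show ?thesis using wlf(2) by eventually_elim (use True in \<open>simp add: Dm_def f_def k_def\<close>)
  next
    case False
    then have m: "2 * k + 1 \<le> m" by (auto simp: k_def)
    have "AE x in lebesgue_on U. partial b f x = \<P> [b] (weak_laplace_power U k \<psi>) x"
      if b: "b \<in> Basis" for b
    \<comment> \<open>The two differentiated functions agree only a.e.: one is the classical power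
      of the Laplacian, the other the chosen weak one.\<close>
    proof (rule distributionally_unique[OF U admissible_partials _ _ wlf(2)])
      show "set [b] \<subseteq> Basis" using b by simp
      show "distributionally U (\<lambda>\<psi> x. (- 1) ^ length [b] * partials [b] \<psi> x) f (partial b f)"
        using has_weak_partials_smooth[OF U f, of "[b]"] b by (simp add: has_weak_partials_def partials_Cons)
      show "distributionally U (\<lambda>\<psi> x. (- 1) ^ length [b] * partials [b] \<psi> x) (weak_laplace_power U k \<psi>)
          (\<P> [b] (weak_laplace_power U k \<psi>))"
        using weak_partials(1)[OF U _ Sobolev_has_weak_partials_laplace_power[OF u m b wlf(1)]] b
        by (simp add: has_weak_partials_def)
    qed
    then have "AE x in lebesgue_on U. \<forall>b\<in>Basis. partial b f x = \<P> [b] (weak_laplace_power U k \<psi>) x"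
      by (intro AE_finite_allI) auto
    then show ?thesis
      by eventually_elim (use False in \<open>simp add: Dm_def grad_def weak_grad_def flip: f_def k_def\<close>)
  qed
qed

subsection \<open>The closure of the test functions\<close>

definition Sobolev_lists :: "'a list set" where
  "Sobolev_lists = {bs. set bs \<subseteq> Basis \<and> length bs \<le> m}"

lemma finite_Sobolev_lists: "finite Sobolev_lists"
  unfolding Sobolev_lists_def by (rule finite_lists_length_le) simp

lemma weak_partials_le_Sobolev_norm:
  assumes "set bs \<subseteq> Basis" "length bs \<le> m"
  shows "Lp_norm p U (\<P> bs u) \<le> \<S> u"
proof -
  have "Lp_norm p U (\<P> bs u) = (Lp_norm p U (\<P> bs u) powr p) powr (1 / p)"
    using p by (simp add: powr_powr)
  also have "\<dots> \<le> (\<Sum>bs\<in>Sobolev_lists. Lp_norm p U (\<P> bs u) powr p) powr (1 / p)"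
    using p assms finite_Sobolev_lists
    by (intro powr_mono2 member_le_sum) (auto simp: Sobolev_lists_def)
  finally show ?thesis by (simp add: Sobolev_norm_def Sobolev_lists_def)
qed

lemma Sobolev_norm_le_sum:
  "\<S> u \<le> (\<Sum>bs\<in>Sobolev_lists. Lp_norm p U (\<P> bs u))"
proof -
  have "\<S> u \<le> ((\<Sum>bs\<in>Sobolev_lists. Lp_norm p U (\<P> bs u)) powr p) powr (1 / p)"
    unfolding Sobolev_norm_def Sobolev_lists_def
    using p by (intro powr_mono2 sum_powr_le_powr_sum sum_nonneg) auto
  then show ?thesis using p by (simp add: powr_powr sum_nonneg)
qed

text \<open>A triangle inequality up to a fixed factor, obtained by comparing with the sum of the
  single norms; a fixed factor is enough for closure arguments.\<close>

lemma Sobolev_norm_diff: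
  assumes u: "u \<in> Sobolev m p U" and u': "u' \<in> Sobolev m p U"
  shows "\<S> (\<lambda>x. u x - u' x)
    \<le> real (card Sobolev_lists) * (\<S> u + \<S> u')"
proof -
  have "Lp_norm p U (\<P> bs (\<lambda>x. u x - u' x)) \<le> \<S> u + \<S> u'"
    if "bs \<in> Sobolev_lists" for bs
  proof -
    have bs: "set bs \<subseteq> Basis" "length bs \<le> m" using that by (auto simp: Sobolev_lists_def)
    note L = Sobolev_weak_partials(2)[OF u bs] Sobolev_weak_partials(2)[OF u' bs]
    have "Lp_norm p U (\<P> bs (\<lambda>x. u x - u' x))
        = Lp_norm p U (\<lambda>x. \<P> bs u x - \<P> bs u' x)"
      using p by (intro Lp_norm_AE[OF Omega_lebesgue Lp_diff[OF _ L] Sobolev_diff(2)[OF u u' bs]]) auto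
    also have "\<dots> \<le> Lp_norm p U (\<P> bs u) + Lp_norm p U (\<P> bs u')"
      using p by (intro Lp_norm_diff_le L) auto
    also have "\<dots> \<le> \<S> u + \<S> u'"
      by (intro add_mono weak_partials_le_Sobolev_norm bs)
    finally show ?thesis .
  qed
  then have "(\<Sum>bs\<in>Sobolev_lists. Lp_norm p U (\<P> bs (\<lambda>x. u x - u' x)))
      \<le> real (card Sobolev_lists) * (\<S> u + \<S> u')"
    by (rule sum_bounded_above)
  then show ?thesis using Sobolev_norm_le_sum order_trans by blast
qed

lemma Sobolev0_Sobolev: "u \<in> Sobolev0 m p U \<Longrightarrow> u \<in> Sobolev m p U"
  by (simp add: Sobolev0_def)

lemma Sobolev0_diff:
  assumes u: "u \<in> Sobolev0 m p U" and u': "u' \<in> Sobolev0 m p U"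
  shows "(\<lambda>x. u x - u' x) \<in> Sobolev0 m p U"
  unfolding Sobolev0_def
proof (intro CollectI conjI allI impI)
  note S = Sobolev0_Sobolev[OF u] Sobolev0_Sobolev[OF u']
  show "(\<lambda>x. u x - u' x) \<in> Sobolev m p U" by (rule Sobolev_diff(1)[OF S])
  fix e :: real assume e: "e > 0"
  define n where "n = real (card (Sobolev_lists :: 'a list set))"
  \<comment> \<open>Makes 2 n d < e, also for n = 0.\<close>
  define d where "d = e / (2 * n + 1)"
  have n: "n \<ge> 0" by (simp add: n_def)
  have d: "d > 0" using e n by (simp add: d_def)
  obtain \<psi> \<psi>' where \<psi>: "\<psi> \<in> test_functions U" "\<S> (\<lambda>x. u x - \<psi> x) < d"
    "\<psi>' \<in> test_functions U" "\<S> (\<lambda>x. u' x - \<psi>' x) < d"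
    using u u' d unfolding Sobolev0_def by blast
  have "\<S> (\<lambda>x. (u x - u' x) - (\<psi> x - \<psi>' x)) = \<S> (\<lambda>x. (u x - \<psi> x) - (u' x - \<psi>' x))"
    by (simp add: algebra_simps)
  also have "\<dots> \<le> n * (\<S> (\<lambda>x. u x - \<psi> x) + \<S> (\<lambda>x. u' x - \<psi>' x))"
    unfolding n_def by (intro Sobolev_norm_diff Sobolev_diff(1) S test_functions_Sobolev \<psi>)
  also have "\<dots> \<le> n * (d + d)" using \<psi> n by (intro mult_left_mono) auto
  also have "\<dots> < (2 * n + 1) * d" using d by (simp add: algebra_simps)
  also have "\<dots> = e" using n by (simp add: d_def)
  finally show "\<exists>\<psi>\<in>test_functions U. \<S> (\<lambda>x. u x - u' x - \<psi> x) < e"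
    by (intro bexI[OF _ test_functions_diff[OF \<psi>(1,3)]])
qed

lemma test_functions_Sobolev0:
  assumes \<psi>: "\<psi> \<in> test_functions U"
  shows "\<psi> \<in> Sobolev0 m p U"
  unfolding Sobolev0_def
proof (intro CollectI conjI allI impI)
  show S: "\<psi> \<in> Sobolev m p U" by (rule test_functions_Sobolev[OF \<psi>])
  \<comment> \<open>The weak derivatives chosen for the zero function are themselves zero only
    a.e.\<close>
  have "Lp_norm p U (\<P> bs (\<lambda>x. \<psi> x - \<psi> x)) = Lp_norm p U (\<lambda>x. 0 :: real)"
    if "bs \<in> Sobolev_lists" for bs
    using Sobolev_diff(2)[OF S S] that Omega_lebesgue by (intro Lp_norm_AE) (auto simp: Sobolev_lists_def)
  then have "\<S> (\<lambda>x. \<psi> x - \<psi> x) \<le> 0"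
    using Sobolev_norm_le_sum[of "\<lambda>x. \<psi> x - \<psi> x"] by simp
  then show "\<exists>\<phi>\<in>test_functions U. \<S> (\<lambda>x. \<psi> x - \<phi> x) < e" if "e > 0" for e
    using \<psi> that by (intro bexI[of _ \<psi>]) auto
qed

lemma Dm_norm_le_Sobolev_norm:
  "\<exists>C\<ge>0. \<forall>u\<in>Sobolev m p U. Dm_norm U m p u \<le> C * \<S> u"
proof (cases "even m")
  case True
  have "Dm_norm U m p u \<le> real (card (laplace_lists (m div 2) :: 'a list set)) * \<S> u"
    if u: "u \<in> Sobolev m p U" for u
  proof -
    have L: "set c \<subseteq> Basis" "length c \<le> m" if "c \<in> laplace_lists (m div 2)" for c :: "'a list"
      using laplace_listsD[OF that] by auto
    have "Dm_norm U m p u = Lp_norm p U (\<lambda>x. \<Sum>c\<in>laplace_lists (m div 2). \<P> c u x)"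
      using True by (simp add: Dm_norm_eq_sum[OF u] Dm_sum_def[abs_def] Lp_norm_Pair)
    also have "\<dots> \<le> (\<Sum>c\<in>laplace_lists (m div 2). Lp_norm p U (\<P> c u))"
      using p L by (intro Lp_norm_sum_le Sobolev_weak_partials(2)[OF u]) auto
    also have "\<dots> \<le> real (card (laplace_lists (m div 2) :: 'a list set)) * \<S> u"
      using L by (intro sum_bounded_above weak_partials_le_Sobolev_norm) auto
    finally show ?thesis .
  qed
  then show ?thesis using of_nat_0_le_iff by blast
next
  case False
  let ?n = "real (card (laplace_lists (m div 2) :: 'a list set))"
  have "Dm_norm U m p u \<le> real DIM('a) * ?n * \<S> u"
    if u: "u \<in> Sobolev m p U" for u
  proof -
    have m: "2 * (m div 2) + 1 = m" using False by presburger
    have L: "set (c @ [b]) \<subseteq> Basis" "length (c @ [b]) \<le> m" if "c \<in> laplace_lists (m div 2)" "b \<in> Basis" for c and b :: 'a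
      using laplace_listsD[OF that(1)] that(2) m by auto
    have I: "(\<lambda>x. \<P> (c @ [b]) u x *\<^sub>R b) \<in> Lp p U" if "c \<in> laplace_lists (m div 2)" "b \<in> Basis" for c b
      using L[OF that] by (intro Lp_scaleR_const Sobolev_weak_partials(2)[OF u])
    have "Dm_norm U m p u = Lp_norm p U (\<lambda>x. \<Sum>b\<in>Basis. \<Sum>c\<in>laplace_lists (m div 2). \<P> (c @ [b]) u x *\<^sub>R b)"
      using False by (simp add: Dm_norm_eq_sum[OF u] Dm_sum_def[abs_def] Lp_norm_Pair)
    also have "\<dots> \<le> (\<Sum>b\<in>Basis. Lp_norm p U (\<lambda>x. \<Sum>c\<in>laplace_lists (m div 2). \<P> (c @ [b]) u x *\<^sub>R b))"
      using p I by (intro Lp_norm_sum_le Lp_sum) auto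
    also have "\<dots> \<le> real DIM('a) * (?n * \<S> u)"
    proof (rule sum_bounded_above)
      fix b :: 'a assume b: "b \<in> Basis"
      have "Lp_norm p U (\<lambda>x. \<Sum>c\<in>laplace_lists (m div 2). \<P> (c @ [b]) u x *\<^sub>R b)
        \<le> (\<Sum>c\<in>laplace_lists (m div 2). Lp_norm p U (\<lambda>x. \<P> (c @ [b]) u x *\<^sub>R b))"
        using p I b by (intro Lp_norm_sum_le) auto
      also have "\<dots> = (\<Sum>c\<in>laplace_lists (m div 2). Lp_norm p U (\<P> (c @ [b]) u))"
        using b by (simp add: Lp_norm_scaleR_Basis)
      also have "\<dots> \<le> ?n * \<S> u"
        using L b by (intro sum_bounded_above weak_partials_le_Sobolev_norm) blast+
      finally show "Lp_norm p U (\<lambda>x. \<Sum>c\<in>laplace_lists (m div 2). \<P> (c @ [b]) u x *\<^sub>R b)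
        \<le> ?n * \<S> u" .
    qed
    finally show ?thesis by (simp add: mult.assoc)
  qed
  then show ?thesis by (intro exI[of _ "real DIM('a) * ?n"]) auto
qed

lemma Lp_norm_le_Sobolev_norm:
  assumes u: "u \<in> Sobolev m p U"
  shows "Lp_norm p U u \<le> \<S> u"
proof -
  have h: "has_weak_partials U [] u u"
    using Sobolev_weak_partials(1)[OF u, of "[]"] by (simp add: has_weak_partials_def distributionally_def)
  have "Lp_norm p U (\<P> [] u) = Lp_norm p U u"
    by (rule Lp_norm_AE[OF Omega_lebesgue Sobolev_Lp[OF u] weak_partials(2)[OF U _ h]]) simp
  then show ?thesis using weak_partials_le_Sobolev_norm[of "[]" u] by simp
qed

lemma Sobolev0_approx:
  assumes u: "u \<in> Sobolev0 m p U" and e: "e > 0"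
  obtains \<psi> where "\<psi> \<in> test_functions U" "Lp_norm p U (\<lambda>x. u x - \<psi> x) < e"
    "Dm_norm U m p (\<lambda>x. u x - \<psi> x) < e"
proof -
  obtain C where C: "C \<ge> 0" "\<And>u. u \<in> Sobolev m p U \<Longrightarrow> Dm_norm U m p u \<le> C * \<S> u"
    using Dm_norm_le_Sobolev_norm by blast
  define d where "d = e / (C + 1)"
  have d: "d > 0" "d \<le> e" "C * d < e" using C e by (auto simp: d_def field_simps)
  obtain \<psi> where \<psi>: "\<psi> \<in> test_functions U" "\<S> (\<lambda>x. u x - \<psi> x) < d"
    using u d(1) unfolding Sobolev0_def by blast
  have S: "(\<lambda>x. u x - \<psi> x) \<in> Sobolev m p U"
    by (intro Sobolev_diff(1) Sobolev0_Sobolev u test_functions_Sobolev \<psi>)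
  show thesis
  proof (rule that[OF \<psi>(1)])
    show "Lp_norm p U (\<lambda>x. u x - \<psi> x) < e" using Lp_norm_le_Sobolev_norm[OF S] \<psi>(2) d(2) by linarith
    have "Dm_norm U m p (\<lambda>x. u x - \<psi> x) \<le> C * \<S> (\<lambda>x. u x - \<psi> x)" by (rule C(2)[OF S])
    also have "\<dots> \<le> C * d" using \<psi>(2) C(1) by (intro mult_left_mono) auto
    finally show "Dm_norm U m p (\<lambda>x. u x - \<psi> x) < e" using d(3) by linarith
  qed
qed

text \<open>Both sides are continuous in \<open>\<xi>\<close>, by Hoelder's inequality.\<close>

lemma Sobolev0_duality:
  assumes q: "q = p / (p - 1)" and \<eta>: "\<eta> \<in> Lp q U" and g: "g \<in> Lp q U"
    and test: "\<And>\<psi>. \<psi> \<in> test_functions U \<Longrightarrow>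
      (LINT x|lebesgue_on U. \<eta> x \<bullet> Dm U m \<psi> x) = (LINT x|lebesgue_on U. g x * \<psi> x)"
    and \<xi>: "\<xi> \<in> Sobolev0 m p U"
  shows "(LINT x|lebesgue_on U. \<eta> x \<bullet> Dm U m \<xi> x) = (LINT x|lebesgue_on U. g x * \<xi> x)"
proof -
  let ?I = "\<lambda>\<xi>. (LINT x|lebesgue_on U. \<eta> x \<bullet> Dm U m \<xi> x)" and ?J = "\<lambda>\<xi>. (LINT x|lebesgue_on U. g x * \<xi> x)"
  have S: "\<xi> \<in> Sobolev m p U" by (rule Sobolev0_Sobolev[OF \<xi>])
  have "\<bar>?I \<xi> - ?J \<xi>\<bar> \<le> 0 + e" if e: "e > 0" for e
  proof -
    \<comment> \<open>M collects the Hoelder factors of both pairings, so approximation up to e / M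
      costs at most e; the summand 1 keeps M positive.\<close>
    define M where "M = Lp_norm q U \<eta> + Lp_norm q U g + 1"
    have M: "M > 0" by (simp add: M_def add_nonneg_pos)
    obtain \<psi> where \<psi>: "\<psi> \<in> test_functions U" "Lp_norm p U (\<lambda>x. \<xi> x - \<psi> x) < e / M"
      "Dm_norm U m p (\<lambda>x. \<xi> x - \<psi> x) < e / M"
      using Sobolev0_approx[OF \<xi>, of "e / M"] e M by auto
    have T: "\<psi> \<in> Sobolev m p U" by (rule test_functions_Sobolev[OF \<psi>(1)])
    note D = Dm_Lp[OF S] Dm_Lp[OF T] Sobolev_Lp[OF S] Sobolev_Lp[OF T]
    have p1: "p \<ge> 1" using p by simp
    have "?I \<xi> - ?I \<psi> = (LINT x|lebesgue_on U. \<eta> x \<bullet> (Dm U m \<xi> x - Dm U m \<psi> x))"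
      using Hoelder_inner(1)[OF p q \<eta>] D by (simp add: inner_diff_right)
    also have "\<bar>\<dots>\<bar> \<le> Lp_norm q U \<eta> * Lp_norm p U (\<lambda>x. Dm U m \<xi> x - Dm U m \<psi> x)"
      by (rule Hoelder_inner(2)[OF p q \<eta> Lp_diff[OF p1 D(1,2)]])
    also have "\<dots> \<le> Lp_norm q U \<eta> * (e / M)"
      using \<psi>(3) unfolding Dm_norm_diff[OF S T] by (intro mult_left_mono) auto
    finally have 1: "\<bar>?I \<xi> - ?I \<psi>\<bar> \<le> Lp_norm q U \<eta> * (e / M)" .
    have "?J \<xi> - ?J \<psi> = (LINT x|lebesgue_on U. g x \<bullet> (\<xi> x - \<psi> x))"
      using Hoelder_inner(1)[OF p q g] D by (simp add: right_diff_distrib)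
    also have "\<bar>\<dots>\<bar> \<le> Lp_norm q U g * Lp_norm p U (\<lambda>x. \<xi> x - \<psi> x)"
      by (rule Hoelder_inner(2)[OF p q g Lp_diff[OF p1 D(3,4)]])
    also have "\<dots> \<le> Lp_norm q U g * (e / M)"
      using \<psi>(2) by (intro mult_left_mono) auto
    finally have 2: "\<bar>?J \<xi> - ?J \<psi>\<bar> \<le> Lp_norm q U g * (e / M)" .
    have "\<bar>?I \<xi> - ?J \<xi>\<bar> \<le> Lp_norm q U \<eta> * (e / M) + Lp_norm q U g * (e / M)"
      using 1 2 test[OF \<psi>(1)] by linarith
    also have "\<dots> \<le> M * (e / M)" unfolding distrib_right[symmetric] using e M by (intro mult_right_mono) (auto simp: M_def)
    finally show ?thesis using M by simp
  qed
  then have "\<bar>?I \<xi> - ?J \<xi>\<bar> \<le> 0" by (rule field_le_epsilon)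
  then show ?thesis by simp
qed

text \<open>Used in contrapositive form: if u - v has nonzero \<open>Dm_norm\<close>, then u is a
  competitor for v in the dual norm.\<close>

lemma Dm_norm_eq_0:
  assumes u: "u \<in> Sobolev m p U" and 0: "AE x in lebesgue_on U. u x = 0"
  shows "Dm_norm U m p u = 0"
proof -
  have "Lp_norm p U (\<P> bs u) = 0" if "bs \<in> Sobolev_lists" for bs
  proof -
    have bs: "set bs \<subseteq> Basis" "length bs \<le> m" using that by (auto simp: Sobolev_lists_def)
    have z: "distributionally U (\<lambda>\<psi> x. (- 1) ^ length bs * partials bs \<psi> x) (\<lambda>x. 0) (\<lambda>x. 0)"
      by (simp add: distributionally_def locally_integrable_continuous)
    have "AE x in lebesgue_on U. \<P> bs u x = 0"
      using distributionally_unique[OF U admissible_partials[OF bs(1)] _ z 0] Sobolev_weak_partials(1)[OF u bs]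
      by (simp add: has_weak_partials_def)
    then show ?thesis using Lp_norm_eq_0_iff[OF Sobolev_weak_partials(2)[OF u bs]] by simp
  qed
  then have "\<S> u \<le> 0" using Sobolev_norm_le_sum[of u] by simp
  moreover obtain C where "C \<ge> 0" "Dm_norm U m p u \<le> C * \<S> u"
    using Dm_norm_le_Sobolev_norm u by blast
  ultimately have "Dm_norm U m p u \<le> 0" by (meson mult_nonneg_nonpos order_trans)
  then show ?thesis by (simp add: Dm_norm_def order_antisym)
qed

subsection \<open>The embedding constant\<close>

text \<open>The Laplacian inequality is iterated m div 2 times, since Laplacians of test functions
  are test functions; for odd m a single step with one partial derivative follows.\<close>

lemma test_functions_poincare:
  assumes "bounded U"
  shows "\<exists>C\<ge>0. \<forall>\<psi>\<in>test_functions U. Lp_norm p U \<psi> \<le> C * Dm_norm U m p \<psi>"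
proof -
  obtain R where R: "R > 0" "\<And>x. x \<in> U \<Longrightarrow> norm x \<le> R"
    using assms by (meson bounded_pos)
  obtain b :: 'a where b: "b \<in> Basis" using nonempty_Basis by blast
  have Rb: "\<bar>x \<bullet> b\<bar> \<le> R" if "x \<in> U" for x
    using Basis_le_norm[OF b, of x] R(2)[OF that] by simp
  define c where "c = R\<^sup>2 * p / 2"
  have c: "c \<ge> 0" using p by (simp add: c_def)
  have p0: "p > 0" using p by simp
  have l: "Lp_norm p U \<psi> \<le> c * Lp_norm p U (laplace \<psi>)"
    and g: "Lp_norm p U \<psi> \<le> (R * p) * Lp_norm p U (partial b \<psi>)"
    if \<psi>: "\<psi> \<in> test_functions U" for \<psi>
  proof -
    obtain K where K: "smooth \<psi>" "compact K" "K \<subseteq> U" "\<And>x. x \<notin> K \<Longrightarrow> \<psi> x = 0"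
      using \<psi> by (elim test_functionsE) blast
    have RK: "\<bar>x \<bullet> b\<bar> \<le> R" if "x \<in> K" for x using Rb K(3) that by blast
    show "Lp_norm p U \<psi> \<le> c * Lp_norm p U (laplace \<psi>)"
      unfolding test_functions_Lp(2)[OF U \<psi> p0] test_functions_Lp(2)[OF U test_functions_laplace[OF \<psi>] p0] c_def
      by (rule poincare_laplace[OF K(1,2,4) b RK p])
    show "Lp_norm p U \<psi> \<le> (R * p) * Lp_norm p U (partial b \<psi>)"
      unfolding test_functions_Lp(2)[OF U \<psi> p0] test_functions_Lp(2)[OF U test_functions_partial[OF \<psi> b] p0]
      using R(1) by (intro poincare_partial[OF K(1,2,4) b RK p]) auto
  qed
  have lk: "Lp_norm p U \<psi> \<le> c ^ k * Lp_norm p U ((laplace ^^ k) \<psi>)" if \<psi>: "\<psi> \<in> test_functions U" for \<psi> k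
  proof (induction k)
    case (Suc k)
    note Suc.IH
    also have "c ^ k * Lp_norm p U ((laplace ^^ k) \<psi>) \<le> c ^ k * (c * Lp_norm p U ((laplace ^^ Suc k) \<psi>))"
      using l[OF test_functions_laplace_power[OF \<psi>], of k] c by (intro mult_left_mono) auto
    finally show ?case by (simp add: mult_ac)
  qed simp
  define k where "k = m div 2"
  have "Lp_norm p U \<psi> \<le> (c ^ k * (if even m then 1 else R * p)) * Dm_norm U m p \<psi>"
    if \<psi>: "\<psi> \<in> test_functions U" for \<psi>
  proof -
    define f where "f = (laplace ^^ k) \<psi>"
    have f: "f \<in> test_functions U" unfolding f_def by (rule test_functions_laplace_power[OF \<psi>])
    note DL = Dm_Lp[OF test_functions_Sobolev[OF \<psi>]]
    have "Lp_norm p U f \<le> (if even m then 1 else R * p) * Dm_norm U m p \<psi>"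
    proof (cases "even m")
      case True
      have "Dm_norm U m p \<psi> = Lp_norm p U (\<lambda>x. (f x, 0 :: 'a))"
        using Dm_smooth[OF \<psi>] True unfolding Dm_norm_def
        by (intro Lp_norm_AE[OF Omega_lebesgue DL, symmetric]) (simp add: f_def k_def)
      with True show ?thesis by (simp add: Lp_norm_Pair)
    next
      case False
      have AE: "AE x in lebesgue_on U. Dm U m \<psi> x = (0, grad f x)"
        using Dm_smooth[OF \<psi>] False by (simp add: f_def k_def)
      have "Lp_norm p U (partial b f) \<le> Lp_norm p U (\<lambda>x. (0 :: real, grad f x))"
        unfolding Lp_norm_def
      proof (intro powr_mono2 integral_mono)
        show "integrable (lebesgue_on U) (\<lambda>x. norm (partial b f x) powr p)"
          by (rule LpD(2)[OF test_functions_Lp(1)[OF U test_functions_partial[OF f b] p0]])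
        show "integrable (lebesgue_on U) (\<lambda>x. norm (0 :: real, grad f x) powr p)"
          by (rule LpD(2)[OF Lp_AE[OF Omega_lebesgue DL AE]])
        fix x
        \<comment> \<open>One component is enough to bound the gradient norm from below.\<close>
        have "grad f x \<bullet> b = partial b f x"
          using b by (simp add: grad_def inner_sum_left inner_Basis if_distrib cong: if_cong)
        then show "norm (partial b f x) \<le> norm (0 :: real, grad f x)"
          using Basis_le_norm[OF b, of "grad f x"] by (simp add: norm_Pair)
      qed (use p in auto)
      also have "\<dots> = Dm_norm U m p \<psi>"
        unfolding Dm_norm_def by (rule Lp_norm_AE[OF Omega_lebesgue DL AE])
      finally have "(R * p) * Lp_norm p U (partial b f) \<le> (R * p) * Dm_norm U m p \<psi>"
        using R(1) p by (intro mult_left_mono) auto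
      with g[OF f] False show ?thesis by simp
    qed
    then have "c ^ k * Lp_norm p U f \<le> c ^ k * ((if even m then 1 else R * p) * Dm_norm U m p \<psi>)"
      using c by (intro mult_left_mono) auto
    with lk[OF \<psi>, of k] show ?thesis by (simp add: f_def mult.assoc)
  qed
  moreover have "c ^ k * (if even m then 1 else R * p) \<ge> 0" using c R(1) p by auto
  ultimately show ?thesis by blast
qed

lemma Sobolev0_poincare:
  assumes "bounded U"
  shows "\<exists>C\<ge>0. \<forall>u\<in>Sobolev0 m p U. Lp_norm p U u \<le> C * Dm_norm U m p u"
proof -
  obtain C where C: "C \<ge> 0" "\<And>\<psi>. \<psi> \<in> test_functions U \<Longrightarrow> Lp_norm p U \<psi> \<le> C * Dm_norm U m p \<psi>"
    using test_functions_poincare[OF assms] by blast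
  have "Lp_norm p U u \<le> C * Dm_norm U m p u" if u: "u \<in> Sobolev0 m p U" for u
  proof (rule field_le_epsilon)
    fix e :: real assume e: "e > 0"
    \<comment> \<open>Both the L^p error d and the derivative error, multiplied by C, must fit into
      e.\<close>
    define d where "d = e / (1 + C)"
    have "(1 + C) * d = e" using C(1) by (simp add: d_def)
    then have d: "d + C * d = e" by (simp add: algebra_simps)
    have d0: "d > 0" using e C(1) by (simp add: d_def)
    obtain \<psi> where \<psi>: "\<psi> \<in> test_functions U" "Lp_norm p U (\<lambda>x. u x - \<psi> x) < d"
      "Dm_norm U m p (\<lambda>x. u x - \<psi> x) < d"
      using Sobolev0_approx[OF u d0] .
    have S: "u \<in> Sobolev m p U" "\<psi> \<in> Sobolev m p U"
      using Sobolev0_Sobolev[OF u] test_functions_Sobolev[OF \<psi>(1)] by auto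
    have p1: "p \<ge> 1" using p by simp
    have "Lp_norm p U (\<lambda>x. (u x - \<psi> x) + \<psi> x) \<le> Lp_norm p U (\<lambda>x. u x - \<psi> x) + Lp_norm p U \<psi>"
      by (intro Minkowski p1 Lp_diff Sobolev_Lp S)
    then have 1: "Lp_norm p U u \<le> d + C * Dm_norm U m p \<psi>" using \<psi>(2) C(2)[OF \<psi>(1)] by simp
    have "Lp_norm p U (\<lambda>x. Dm U m u x - (Dm U m u x - Dm U m \<psi> x)) \<le>
        Lp_norm p U (Dm U m u) + Lp_norm p U (\<lambda>x. Dm U m u x - Dm U m \<psi> x)"
      by (intro Lp_norm_diff_le p1 Lp_diff Dm_Lp S)
    then have "Dm_norm U m p \<psi> \<le> Dm_norm U m p u + d"
      using \<psi>(3) unfolding Dm_norm_diff[OF S] by (simp add: Dm_norm_def)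
    then have "C * Dm_norm U m p \<psi> \<le> C * (Dm_norm U m p u + d)"
      using C(1) by (rule mult_left_mono)
    with 1 d show "Lp_norm p U u \<le> C * Dm_norm U m p u + e" by (simp add: algebra_simps)
  qed
  with C(1) show ?thesis by blast
qed

text \<open>The infimum is attained. If the derivative norm is positive, the quotient of the norms
  lies below every valid constant, hence below the infimum; if it is 0, one valid constant already
  forces the left side to 0.\<close>

lemma
  assumes "bounded U"
  shows embedding_const_nonneg: "embedding_const U m p \<ge> 0"
    and embedding_const_bound: "\<And>u. u \<in> Sobolev0 m p U \<Longrightarrow> Lp_norm p U u \<le> embedding_const U m p * Dm_norm U m p u"
proof -
  define A where "A = {C. 0 \<le> C \<and> (\<forall>u\<in>Sobolev0 m p U. Lp_norm p U u \<le> C * Dm_norm U m p u)}"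
  have ne: "A \<noteq> {}" using Sobolev0_poincare[OF assms] by (auto simp: A_def)
  have eq: "embedding_const U m p = Inf A" by (simp add: embedding_const_def A_def)
  show "embedding_const U m p \<ge> 0" unfolding eq by (rule cInf_greatest[OF ne]) (simp add: A_def)
  show "Lp_norm p U u \<le> embedding_const U m p * Dm_norm U m p u" if u: "u \<in> Sobolev0 m p U" for u
  proof (cases "Dm_norm U m p u = 0")
    case True
    obtain C where "C \<in> A" using ne by blast
    with u True show ?thesis by (auto simp: A_def)
  next
    case False
    then have pos: "Dm_norm U m p u > 0" by (simp add: Dm_norm_def order_less_le)
    have "Lp_norm p U u / Dm_norm U m p u \<le> Inf A"
      using u pos by (intro cInf_greatest[OF ne]) (auto simp: A_def field_simps)
    then show ?thesis using pos by (simp add: eq field_simps)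
  qed
qed

end

subsection \<open>The obstacle problem\<close>

lemma open_contains_nonempty_box:
  fixes U :: "'a::euclidean_space set"
  assumes "open U" "U \<noteq> {}"
  obtains a b where "box a b \<noteq> {}" "cbox a b \<subseteq> U"
proof -
  obtain x where "x \<in> U" using assms(2) by blast
  then obtain a b where "x \<in> box a b" "cbox a b \<subseteq> U"
    using open_contains_cbox[OF assms(1)] by metis
  then show thesis using that by blast
qed

lemma Lp_subset:
  assumes D: "D \<in> sets lebesgue" "U \<in> sets lebesgue" "D \<subseteq> U" and q: "q > 0" and f: "f \<in> Lp q U"
  shows "f \<in> Lp q D" "Lp_norm q D f \<le> Lp_norm q U f"
proof -
  have 0: "D \<inter> space lebesgue \<in> sets lebesgue" "U \<inter> space lebesgue \<in> sets lebesgue" using D by auto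
  have "f \<in> borel_measurable (lebesgue_on D)"
    using measurable_restrict_mono[OF LpD(1)[OF f] D(3)] .
  have i: "integrable lebesgue (\<lambda>x. indicator U x *\<^sub>R (norm (f x) powr q))"
    using LpD(2)[OF f] by (rule integrable_restrict_space[OF 0(2), THEN iffD1])
  have "integrable lebesgue (\<lambda>x. indicator D x *\<^sub>R (indicator U x *\<^sub>R (norm (f x) powr q)))"
    by (rule integrable_mult_indicator[OF D(1) i])
  also have "(\<lambda>x. indicator D x *\<^sub>R (indicator U x *\<^sub>R (norm (f x) powr q))) = (\<lambda>x. indicator D x *\<^sub>R (norm (f x) powr q))"
    using D(3) by (auto simp: indicator_def fun_eq_iff)
  finally have j: "integrable lebesgue (\<lambda>x. indicator D x *\<^sub>R (norm (f x) powr q))" .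
  show "f \<in> Lp q D"
    using \<open>f \<in> borel_measurable (lebesgue_on D)\<close> j integrable_restrict_space[OF 0(1), of "\<lambda>x. norm (f x) powr q"]
    by (simp add: Lp_def)
  show "Lp_norm q D f \<le> Lp_norm q U f"
    unfolding Lp_norm_def integral_restrict_space[OF 0(1)] integral_restrict_space[OF 0(2)]
    using q D(3) i j by (intro powr_mono2 integral_mono) (auto simp: indicator_def)
qed

lemma Lp_pos_part:
  fixes f :: "'a::euclidean_space \<Rightarrow> real"
  assumes "f \<in> Lp q D" "q > 0"
  shows "(\<lambda>x. max 0 (f x)) \<in> Lp q D"
proof -
  note [measurable] = LpD(1)[OF assms(1)]
  have "integrable (lebesgue_on D) (\<lambda>x. norm (max 0 (f x)) powr q)"
    using assms(2)
    by (intro Bochner_Integration.integrable_bound[OF LpD(2)[OF assms(1)]])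
      (auto intro!: AE_I2 powr_mono2)
  then show ?thesis by (simp add: Lp_def)
qed

context
  fixes U :: "'a::euclidean_space set"
    and p q :: real and m :: nat
    and h \<phi> :: "'a \<Rightarrow> real"
  assumes p: "p > 1" and q: "q = p / (p - 1)"
    and U: "open U" "bounded U" "U \<noteq> {}"
    and h: "h \<in> Lp q U"
begin

abbreviation (input) "\<L> \<equiv> lebesgue_on U"
abbreviation (input) "\<N> \<equiv> Dm_norm U m p"
abbreviation (input) "\<R> \<equiv> dual_residual_norm U m p \<phi> h"
abbreviation (input) "monotonicity_gap u v \<equiv>
  (LINT x|\<L>. (pow_dual p (Dm U m u x) - pow_dual p (Dm U m v x)) \<bullet> (Dm U m u x - Dm U m v x))"

abbreviation (input) "K \<equiv> admissible U m p \<phi>"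
abbreviation (input) "C_F \<equiv> embedding_const U m p"

lemma q_gt_1: "q > 1"
  by (rule conjugate_exponent(1)[OF p q])

lemma admissible_Sobolev0: "v \<in> K \<Longrightarrow> v \<in> Sobolev0 m p U"
  by (simp add: admissible_def)

lemma admissible_Sobolev: "v \<in> K \<Longrightarrow> v \<in> Sobolev m p U"
  by (rule Sobolev0_Sobolev[OF U(1) p admissible_Sobolev0])

lemmas sobolev_rules = Sobolev_Lp[OF U(1) p] Dm_Lp[OF U(1) p] Sobolev_diff(1)[OF U(1) p]

section \<open>The residual and its dual norm\<close>

lemma residual_diff:
  assumes v: "v \<in> Sobolev m p U" and a: "a \<in> Sobolev m p U" and b: "b \<in> Sobolev m p U"
  shows "residual U m p h v (\<lambda>x. a x - b x) =
    (LINT x|\<L>. pow_dual p (Dm U m v x) \<bullet> Dm U m a x)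
    - (LINT x|\<L>. pow_dual p (Dm U m v x) \<bullet> Dm U m b x)
    - ((LINT x|\<L>. h x * a x) - (LINT x|\<L>. h x * b x))"
proof -
  note L = sobolev_rules(1)[OF a] sobolev_rules(1)[OF b] sobolev_rules(2)[OF a] sobolev_rules(2)[OF b]
  note P = pow_dual_Lp(1)[OF p q sobolev_rules(2)[OF v]]
  have "(LINT x|\<L>. pow_dual p (Dm U m v x) \<bullet> Dm U m (\<lambda>x. a x - b x) x)
    = (LINT x|\<L>. pow_dual p (Dm U m v x) \<bullet> Dm U m a x - pow_dual p (Dm U m v x) \<bullet> Dm U m b x)"
  proof (rule integral_cong_AE)
    show "AE x in \<L>. pow_dual p (Dm U m v x) \<bullet> Dm U m (\<lambda>x. a x - b x) x
      = pow_dual p (Dm U m v x) \<bullet> Dm U m a x - pow_dual p (Dm U m v x) \<bullet> Dm U m b x"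
      using Dm_diff[OF U(1) p a b] by eventually_elim (simp add: inner_diff_right)
    show "(\<lambda>x. pow_dual p (Dm U m v x) \<bullet> Dm U m (\<lambda>x. a x - b x) x) \<in> borel_measurable (\<L>)"
      using LpD(1)[OF P] LpD(1)[OF sobolev_rules(2)[OF sobolev_rules(3)[OF a b]]] by simp
    show "(\<lambda>x. pow_dual p (Dm U m v x) \<bullet> Dm U m a x - pow_dual p (Dm U m v x) \<bullet> Dm U m b x) \<in> borel_measurable (\<L>)"
      using LpD(1)[OF P] LpD(1)[OF L(3)] LpD(1)[OF L(4)] by simp
  qed
  then show ?thesis
    using Hoelder_inner(1)[OF p q P L(3)] Hoelder_inner(1)[OF p q P L(4)]
      Hoelder_inner(1)[OF p q h L(1)] Hoelder_inner(1)[OF p q h L(2)]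
    by (simp add: residual_def right_diff_distrib)
qed

lemma residual_swap:
  assumes u: "u \<in> Sobolev m p U" and v: "v \<in> Sobolev m p U"
  shows "- residual U m p h v (\<lambda>x. u x - v x) = residual U m p h u (\<lambda>x. v x - u x)
    + monotonicity_gap u v"
proof -
  note L = sobolev_rules(2)[OF u] sobolev_rules(2)[OF v]
  note P = pow_dual_Lp(1)[OF p q L(1)] pow_dual_Lp(1)[OF p q L(2)]
  show ?thesis
    unfolding residual_diff[OF u v u] residual_diff[OF v u v]
    using Hoelder_inner(1)[OF p q P(1) L(1)] Hoelder_inner(1)[OF p q P(1) L(2)]
      Hoelder_inner(1)[OF p q P(2) L(1)] Hoelder_inner(1)[OF p q P(2) L(2)]
    by (simp add: inner_diff_left inner_diff_right)
qed

text \<open>Bounds the quotients of the dual norm uniformly in w, so that the supremum is a genuine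
  one.\<close>

lemma residual_bound:
  assumes v: "v \<in> Sobolev m p U" and \<xi>: "\<xi> \<in> Sobolev0 m p U"
  shows "\<bar>residual U m p h v \<xi>\<bar>
    \<le> (Lp_norm q U (\<lambda>x. pow_dual p (Dm U m v x)) + C_F * Lp_norm q U h) * \<N> \<xi>"
proof -
  note S = Sobolev0_Sobolev[OF U(1) p \<xi>]
  have "\<bar>LINT x|\<L>. pow_dual p (Dm U m v x) \<bullet> Dm U m \<xi> x\<bar>
      \<le> Lp_norm q U (\<lambda>x. pow_dual p (Dm U m v x)) * \<N> \<xi>"
    unfolding Dm_norm_def by (intro Hoelder_inner(2)[OF p q] pow_dual_Lp(1)[OF p q] sobolev_rules(2) v S)
  moreover have "\<bar>LINT x|\<L>. h x * \<xi> x\<bar> \<le> Lp_norm q U h * Lp_norm p U \<xi>"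
    using Hoelder_inner(2)[OF p q h sobolev_rules(1)[OF S]] by simp
  moreover have "Lp_norm q U h * Lp_norm p U \<xi> \<le> Lp_norm q U h * (C_F * \<N> \<xi>)"
    using embedding_const_bound[OF U(1) p U(2) \<xi>] by (rule mult_left_mono) simp
  ultimately show ?thesis unfolding residual_def by (simp add: algebra_simps)
qed

text \<open>By the embedding inequality a vanishing \<open>Dm_norm\<close> would make the L^p norm
  of w - v vanish.\<close>

lemma Dm_norm_pos:
  assumes w: "w \<in> Sobolev0 m p U" and v: "v \<in> Sobolev0 m p U" and ne: "\<not> (AE x in \<L>. w x = v x)"
  shows "\<N> (\<lambda>x. w x - v x) > 0"
proof -
  have S0: "(\<lambda>x. w x - v x) \<in> Sobolev0 m p U" by (rule Sobolev0_diff[OF U(1) p w v])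
  have "Lp_norm p U (\<lambda>x. w x - v x) \<noteq> 0"
    using ne Lp_norm_eq_0_iff[OF sobolev_rules(1)[OF Sobolev0_Sobolev[OF U(1) p S0]]] by simp
  with embedding_const_bound[OF U(1) p U(2) S0] have "\<N> (\<lambda>x. w x - v x) \<noteq> 0"
    using Lp_norm_nonneg[of p U "\<lambda>x. w x - v x"] by (metis mult_zero_right order_antisym)
  then show ?thesis by (simp add: Dm_norm_def order_less_le)
qed

definition competitors :: "('a \<Rightarrow> real) \<Rightarrow> ('a \<Rightarrow> real) set" where
  "competitors v = {w \<in> K. \<not> (AE x in \<L>. w x = v x)}"

text \<open>A nonnegative bump added to v respects the obstacle and changes v on a box of positive
  measure. A supremum over the empty set would have no usable value.\<close>

lemma competitors_nonempty:
  assumes v: "v \<in> K"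
  shows "competitors v \<noteq> {}"
proof -
  obtain a b where ab: "box a b \<noteq> {}" "cbox a b \<subseteq> U"
    using open_contains_nonempty_box[OF U(1,3)] .
  define \<psi> where "\<psi> = box_bump 1 a b"
  have \<psi>: "(\<lambda>x. 0 - \<psi> x) \<in> test_functions U"
    unfolding \<psi>_def by (intro test_functions_diff test_functions_zero box_bump_test_function ab)
  \<comment> \<open>The sum v + \<psi> in the form of a difference, to which
    \<open>Sobolev0_diff\<close> applies.\<close>
  define w where "w x = v x - (0 - \<psi> x)" for x
  have "w \<in> Sobolev0 m p U"
    unfolding w_def by (intro Sobolev0_diff[OF U(1) p] admissible_Sobolev0 v test_functions_Sobolev0[OF U(1) p] \<psi>)
  moreover have "AE x in \<L>. \<phi> x \<le> w x"
  proof -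
    have "AE x in \<L>. \<phi> x \<le> v x" using v by (simp add: admissible_def)
    then show ?thesis by eventually_elim (use box_bump_bounds(1)[of 1 a b] in \<open>auto simp: w_def \<psi>_def intro: add_increasing2\<close>)
  qed
  moreover have "\<not> (AE x in \<L>. w x = v x)"
  proof
    assume "AE x in \<L>. w x = v x"
    then have "AE x in lebesgue. x \<in> U \<longrightarrow> w x = v x"
      using U(1) by (simp add: AE_lebesgue_on_iff)
    then have "AE x in lebesgue. x \<notin> box a b"
    proof eventually_elim
      case (elim x)
      show ?case
      proof
        assume x: "x \<in> box a b"
        then have "\<psi> x > 0" unfolding \<psi>_def by (intro box_bump_pos) auto
        moreover have "x \<in> U" using x ab(2) box_subset_cbox by blast
        ultimately show False using elim by (simp add: w_def)
      qed
    qed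
    then have "box a b \<in> null_sets lebesgue" by (simp add: AE_iff_null_sets)
    then show False using open_not_negligible[OF open_box ab(1)] by (simp add: negligible_iff_null_sets)
  qed
  ultimately show ?thesis by (auto simp: competitors_def admissible_def)
qed

lemma dual_residual_norm_upper:
  assumes v: "v \<in> K" and w: "w \<in> competitors v"
  shows "max 0 (- residual U m p h v (\<lambda>x. w x - v x)) / \<N> (\<lambda>x. w x - v x)
    \<le> \<R> v"
proof -
  have "max 0 (- residual U m p h v (\<lambda>x. w x - v x)) / \<N> (\<lambda>x. w x - v x)
    \<le> Lp_norm q U (\<lambda>x. pow_dual p (Dm U m v x)) + C_F * Lp_norm q U h" (is "_ \<le> ?M")
    if "w \<in> competitors v" for w
  proof -
    have w: "w \<in> K" "\<not> (AE x in \<L>. w x = v x)" using that by (auto simp: competitors_def)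
    have M: "?M \<ge> 0" using embedding_const_nonneg[OF U(1) p U(2)] by simp
    have pos: "\<N> (\<lambda>x. w x - v x) > 0"
      by (intro Dm_norm_pos admissible_Sobolev0 v w)
    have "\<bar>residual U m p h v (\<lambda>x. w x - v x)\<bar> \<le> ?M * \<N> (\<lambda>x. w x - v x)"
      by (intro residual_bound Sobolev0_diff[OF U(1) p] admissible_Sobolev0 admissible_Sobolev v w)
    then have "max 0 (- residual U m p h v (\<lambda>x. w x - v x)) \<le> ?M * \<N> (\<lambda>x. w x - v x)"
      using M pos by (auto simp: max_def)
    then show ?thesis using pos by (simp add: pos_divide_le_eq)
  qed
  then have "bdd_above ((\<lambda>w. max 0 (- residual U m p h v (\<lambda>x. w x - v x)) / \<N> (\<lambda>x. w x - v x)) ` competitors v)"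
    by (auto intro!: bdd_aboveI2)
  then show ?thesis
    using w unfolding dual_residual_norm_def competitors_def by (intro cSUP_upper) auto
qed

lemma dual_residual_norm_nonneg:
  assumes v: "v \<in> K"
  shows "\<R> v \<ge> 0"
proof -
  obtain w where w: "w \<in> competitors v" using competitors_nonempty[OF v] by blast
  have "0 \<le> max 0 (- residual U m p h v (\<lambda>x. w x - v x)) / \<N> (\<lambda>x. w x - v x)"
    by (simp add: Dm_norm_def)
  with dual_residual_norm_upper[OF v w] show ?thesis by linarith
qed

lemma dual_residual_norm_lower:
  assumes u: "u \<in> K" and v: "v \<in> K" and "\<N> (\<lambda>x. u x - v x) \<noteq> 0"
  shows "(residual U m p h u (\<lambda>x. v x - u x)
      + monotonicity_gap u v)
      / \<N> (\<lambda>x. u x - v x)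
    \<le> \<R> v"
proof -
  have "\<not> (AE x in \<L>. u x = v x)"
    using assms(3) Dm_norm_eq_0[OF U(1) p sobolev_rules(3)[OF admissible_Sobolev[OF u] admissible_Sobolev[OF v]]] by auto
  then have "u \<in> competitors v" using u by (simp add: competitors_def)
  from dual_residual_norm_upper[OF v this] show ?thesis
    unfolding residual_swap[OF admissible_Sobolev[OF u] admissible_Sobolev[OF v], symmetric]
    by (rule order_trans[rotated]) (intro divide_right_mono, auto simp: Dm_norm_def)
qed

section \<open>Lower bounds for the dual norm\<close>

lemma error_lower_bound_ge_2:
  assumes u: "u \<in> K" and v: "v \<in> K" and p2: "p \<ge> 2"
  shows "2 powr (2 - p) * \<N> (\<lambda>x. u x - v x) powr (p - 1)
      + residual U m p h u (\<lambda>x. v x - u x) / \<N> (\<lambda>x. u x - v x)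
    \<le> \<R> v"
proof (cases "\<N> (\<lambda>x. u x - v x) = 0")
  case True
  \<comment> \<open>Division by 0 yields 0, in accordance with the convention for v = u.\<close>
  then show ?thesis using dual_residual_norm_nonneg[OF v] by simp
next
  case False
  define d where "d = \<N> (\<lambda>x. u x - v x)"
  have d: "d > 0" using False by (simp add: d_def Dm_norm_def order_less_le)
  note S = admissible_Sobolev[OF u] admissible_Sobolev[OF v]
  note L = sobolev_rules(2)[OF S(1)] sobolev_rules(2)[OF S(2)]
  have dd: "Lp_norm p U (\<lambda>x. Dm U m u x - Dm U m v x) = d"
    by (simp add: d_def Dm_norm_diff[OF U(1) p S])
  have LD: "(\<lambda>x. Dm U m u x - Dm U m v x) \<in> Lp p U" using p by (intro Lp_diff L) auto
  have "2 powr (2 - p) * d powr p = (LINT x|\<L>. 2 powr (2 - p) * norm (Dm U m u x - Dm U m v x) powr p)"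
    unfolding dd[symmetric] using p by (simp add: Lp_norm_powr)
  also have "\<dots> \<le> monotonicity_gap u v"
    using LpD(2)[OF LD] q_gt_1
    by (intro integral_mono pow_dual_monotone_ge_2[OF p2] Hoelder_inner(1)[OF p q] LD Lp_diff pow_dual_Lp(1)[OF p q] L) auto
  finally have "(residual U m p h u (\<lambda>x. v x - u x) + 2 powr (2 - p) * d powr p) / d
      \<le> (residual U m p h u (\<lambda>x. v x - u x)
        + monotonicity_gap u v) / d"
    using d by (intro divide_right_mono add_left_mono) auto
  also have "\<dots> \<le> \<R> v"
    unfolding d_def by (rule dual_residual_norm_lower[OF u v False])
  finally have "(residual U m p h u (\<lambda>x. v x - u x) + 2 powr (2 - p) * d powr p) / d \<le> \<R> v" .
  moreover have "d powr p = d powr (p - 1) * d" using d powr_add[of d "p - 1" 1] by simp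
  ultimately show ?thesis using d unfolding d_def[symmetric] by (simp add: add_divide_distrib add.commute)
qed

text \<open>The variational inequality at w, with Hoelder's and Young's inequalities for the mixed
  term, compares the energies of u and w. Estimating the linear term by the embedding leaves t^p <=
  A + p H t for t the norm of u, and the two entries of \<open>C3\<close> are what rules out a
  larger t.\<close>

lemma solution_energy_bound:
  assumes u: "u \<in> K" and w: "w \<in> K"
    and var: "residual U m p h u (\<lambda>x. w x - u x) \<ge> 0"
  shows "\<N> u \<le> C3 U m p q h w"
proof -
  note S = admissible_Sobolev[OF u] admissible_Sobolev[OF w]
  note L = sobolev_rules(2)[OF S(1)] sobolev_rules(2)[OF S(2)]
  note P = pow_dual_Lp[OF p q L(1)]
  define t W H A where "t = \<N> u" and "W = \<N> w"
    and "H = C_F * Lp_norm q U h"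
    and "A = W powr p - p * (LINT x|\<L>. h x * w x)"
  have nn: "t \<ge> 0" "W \<ge> 0" "H \<ge> 0"
    using embedding_const_nonneg[OF U(1) p U(2)] by (auto simp: t_def W_def H_def Dm_norm_def)
  have "pow_dual p a \<bullet> a = norm a powr p" for a :: "real \<times> 'a"
  proof (cases "a = 0")
    case False
    then have "norm a powr (p - 2) * norm a powr 2 = norm a powr p" unfolding powr_add[symmetric] by simp
    with False show ?thesis by (simp add: pow_dual_def power2_norm_eq_inner[symmetric])
  qed (use p in simp)
  then have uu: "(LINT x|\<L>. pow_dual p (Dm U m u x) \<bullet> Dm U m u x) = t powr p"
    using p by (simp add: t_def Dm_norm_def Lp_norm_powr)
  have "(LINT x|\<L>. pow_dual p (Dm U m u x) \<bullet> Dm U m w x) \<le> t powr (p - 1) * W"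
    using Hoelder_inner(2)[OF p q P(1) L(2)] unfolding P(2) by (simp add: t_def W_def Dm_norm_def)
  also have "\<dots> \<le> (t powr (p - 1)) powr q / q + W powr p / p"
    using conjugate_exponent(1,2)[OF p q] p nn by (intro Youngs_inequality) auto
  also have "(t powr (p - 1)) powr q = t powr p"
    using conjugate_exponent(3)[OF p q] by (simp add: powr_powr)
  finally have uw: "(LINT x|\<L>. pow_dual p (Dm U m u x) \<bullet> Dm U m w x) \<le> t powr p / q + W powr p / p" .
  have hu: "(LINT x|\<L>. h x * u x) \<le> H * t"
  proof -
    have "(LINT x|\<L>. h x * u x) \<le> Lp_norm q U h * Lp_norm p U u"
      using Hoelder_inner(2)[OF p q h sobolev_rules(1)[OF S(1)]] by simp
    also have "\<dots> \<le> Lp_norm q U h * (C_F * t)"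
      unfolding t_def by (intro mult_left_mono embedding_const_bound[OF U(1) p U(2)] admissible_Sobolev0[OF u]) simp
    finally show ?thesis by (simp add: H_def mult_ac)
  qed
  have "1 / p = 1 - 1 / q" using conjugate_exponent(2)[OF p q] by linarith
  then have "t powr p * (1 / p) = t powr p * (1 - 1 / q)" by simp
  then have "t powr p - t powr p / q = t powr p / p" by (simp add: right_diff_distrib)
  then have "t powr p / p \<le> W powr p / p - (LINT x|\<L>. h x * w x) + H * t"
    using var uu uw hu unfolding residual_diff[OF S(1) S(2) S(1)] by linarith
  then have "p * (t powr p / p) \<le> p * (W powr p / p - (LINT x|\<L>. h x * w x) + H * t)"
    using p by (intro mult_left_mono) auto
  then have en: "t powr p \<le> A + p * H * t"
    using p by (simp add: A_def algebra_simps)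
  have C3: "C3 U m p q h w = max ((p * H + 1) powr (1 / (p - 1))) A"
    by (simp add: C3_def A_def W_def H_def mult.assoc)
  have "t \<le> C3 U m p q h w"
  proof (rule ccontr)
    \<comment> \<open>If t exceeds both entries, then t^(p-1) >= p H + 1, so t^p >= p H t + t > p H
      t + A. The summand 1 inside \<open>C3\<close> thus absorbs A.\<close>
    assume "\<not> t \<le> C3 U m p q h w"
    then have less: "(p * H + 1) powr (1 / (p - 1)) < t" "A < t" by (auto simp: C3)
    have t: "t > 0" using less(1) powr_ge_zero le_less_trans by blast
    have "p * H + 1 = ((p * H + 1) powr (1 / (p - 1))) powr (p - 1)"
      using p nn by (simp add: powr_powr)
    also have "\<dots> \<le> t powr (p - 1)" using less(1) p by (intro powr_mono2) auto
    finally have "(p * H + 1) * t \<le> t powr (p - 1) * t" using t by (intro mult_right_mono) auto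
    also have "\<dots> = t powr p" using t powr_add[of t "p - 1" 1] by simp
    finally show False using en less(2) by (simp add: algebra_simps)
  qed
  then show ?thesis by (simp add: t_def)
qed

lemma C3_pos: "C3 U m p q h w > 0"
proof -
  have "p * C_F * Lp_norm q U h + 1 > 0"
    using embedding_const_nonneg[OF U(1) p U(2)] p by (intro add_nonneg_pos mult_nonneg_nonneg) auto
  then show ?thesis by (simp add: C3_def less_max_iff_disj)
qed

lemma error_lower_bound_less_2:
  assumes u: "u \<in> K" and v: "v \<in> K" and w: "w \<in> K" and p2: "p < 2"
    and var: "residual U m p h u (\<lambda>x. w x - u x) \<ge> 0"
  shows "(p - 1) * 2 powr ((p - 2) / p)
      / (C3 U m p q h w powr p + \<N> v powr p) powr ((2 - p) / p) * \<N> (\<lambda>x. u x - v x)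
      + residual U m p h u (\<lambda>x. v x - u x) / \<N> (\<lambda>x. u x - v x)
    \<le> \<R> v"
proof (cases "\<N> (\<lambda>x. u x - v x) = 0")
  case True
  then show ?thesis using dual_residual_norm_nonneg[OF v] by simp
next
  case False
  define d where "d = \<N> (\<lambda>x. u x - v x)"
  have d: "d > 0" using False by (simp add: d_def Dm_norm_def order_less_le)
  define I where "I = monotonicity_gap u v"
  define T where "T = C3 U m p q h w powr p + \<N> v powr p"
  have T: "T > 0" unfolding T_def using C3_pos[of w] by (intro add_pos_nonneg) auto
  note S = admissible_Sobolev[OF u] admissible_Sobolev[OF v]
  note L = sobolev_rules(2)[OF S(1)] sobolev_rules(2)[OF S(2)]
  have dd: "Lp_norm p U (\<lambda>x. Dm U m u x - Dm U m v x) = d"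
    by (simp add: d_def Dm_norm_diff[OF U(1) p S])
  have I: "I \<ge> 0"
    unfolding I_def
  proof (intro Bochner_Integration.integral_nonneg)
    show "0 \<le> (pow_dual p (Dm U m u x) - pow_dual p (Dm U m v x)) \<bullet> (Dm U m u x - Dm U m v x)" for x
      by (rule order_trans[OF _ pow_dual_monotone_less_2[OF p p2]]) (use p in simp)
  qed
  have "(p - 1) * d\<^sup>2 \<le> (\<N> u powr p + \<N> v powr p) powr ((2 - p) / p) * I"
    using integral_pow_dual_monotone_less_2[OF p p2 L] unfolding dd I_def by (simp add: Dm_norm_def)
  \<comment> \<open>T already dominates the sum; doubling it produces the factor 2^((p-2)/p) of the
    stated constant.\<close>
  also have "\<dots> \<le> (2 * T) powr ((2 - p) / p) * I"
  proof (intro mult_right_mono powr_mono2 I)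
    have "\<N> u powr p \<le> C3 U m p q h w powr p"
      using solution_energy_bound[OF u w var] p by (intro powr_mono2) (auto simp: Dm_norm_def)
    then have "\<N> u powr p + \<N> v powr p \<le> T"
      unfolding T_def by (rule add_right_mono)
    with T show "\<N> u powr p + \<N> v powr p \<le> 2 * T" by linarith
  qed (use p p2 in auto)
  also have "\<dots> = 2 powr ((2 - p) / p) * T powr ((2 - p) / p) * I" using T by (simp add: powr_mult)
  finally have main: "(p - 1) * d\<^sup>2 \<le> 2 powr ((2 - p) / p) * T powr ((2 - p) / p) * I" .
  have inv: "2 powr ((p - 2) / p) = inverse (2 powr ((2 - p) / p) :: real)"
    unfolding powr_minus[symmetric] by (simp add: minus_divide_left)
  have "(p - 1) * 2 powr ((p - 2) / p) / T powr ((2 - p) / p) * d \<le> I / d"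
    unfolding inv using main d T by (simp add: field_simps power2_eq_square)
  moreover have "I / d + residual U m p h u (\<lambda>x. v x - u x) / d \<le> \<R> v"
    using dual_residual_norm_lower[OF u v False] unfolding I_def[symmetric] d_def[symmetric]
    by (simp add: add_divide_distrib add.commute)
  ultimately show ?thesis unfolding d_def[symmetric] T_def[symmetric] by linarith
qed

section \<open>Upper bounds for the dual norm\<close>

text \<open>Common form of the even and odd case: g is the formal adjoint of \<open>Dm\<close>
  applied to \<eta>, that is, the Laplacian power of \<eta> for even m and minus the Laplacian power
  of its divergence for odd m. The residual splits into a flux error and the pairing of h - g with w
  - v, where on the contact set only the positive part counts.\<close>

lemma dual_residual_norm_upper_bound:
  assumes v: "v \<in> K" and \<phi>: "\<phi> \<in> borel_measurable (\<L>)"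
    and \<eta>: "\<eta> \<in> Lp q U" and g: "g \<in> Lp q U"
    and test: "\<And>\<psi>. \<psi> \<in> test_functions U \<Longrightarrow>
      (LINT x|\<L>. \<eta> x \<bullet> Dm U m \<psi> x) = (LINT x|\<L>. g x * \<psi> x)"
  shows "\<R> v \<le> Lp_norm q U (\<lambda>x. pow_dual p (Dm U m v x) - \<eta> x)
    + C_F * Lp_norm q (noncontact_set U \<phi> v) (\<lambda>x. g x - h x)
    + C_F * Lp_norm q (contact_set U \<phi> v) (\<lambda>x. max 0 (h x - g x))" (is "_ \<le> ?R")
proof -
  define N Z where "N = noncontact_set U \<phi> v" and "Z = contact_set U \<phi> v"
  have q1: "q \<ge> 1" "q > 0" using q_gt_1 by auto
  have CF: "C_F \<ge> 0" by (rule embedding_const_nonneg[OF U(1) p U(2)])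
  have lO: "U \<in> sets lebesgue" using U(1) by simp
  note Sv = admissible_Sobolev[OF v]
  \<comment> \<open>Measurability of the obstacle enters here and allows splitting the integral over
    U.\<close>
  have "Z \<in> sets lebesgue"
  proof -
    note [measurable] = LpD(1)[OF sobolev_rules(1)[OF Sv]] \<phi>
    have "{x \<in> space (\<L>). v x = \<phi> x} \<in> sets (\<L>)" by measurable
    then show ?thesis using lO by (simp add: Z_def contact_set_def sets_restrict_space_iff)
  qed
  then have sets: "Z \<in> sets lebesgue" "N \<in> sets lebesgue" using lO by (auto simp: N_def Z_def noncontact_set_def)
  have sub: "Z \<subseteq> U" "N \<subseteq> U" by (auto simp: N_def Z_def noncontact_set_def contact_set_def)
  have gh: "(\<lambda>x. g x - h x) \<in> Lp q U" and hg: "(\<lambda>x. max 0 (h x - g x)) \<in> Lp q U"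
    by (intro Lp_diff q1 g h Lp_pos_part)+
  show ?thesis
    unfolding dual_residual_norm_def
  proof (rule cSUP_least)
    show "{w \<in> K. \<not> (AE x in \<L>. w x = v x)} \<noteq> {}"
      using competitors_nonempty[OF v] by (simp add: competitors_def)
    fix w assume "w \<in> {w \<in> K. \<not> (AE x in \<L>. w x = v x)}"
    then have w: "w \<in> K" "\<not> (AE x in \<L>. w x = v x)" by auto
    define \<xi> where "\<xi> x = w x - v x" for x
    have \<xi>: "\<xi> \<in> Sobolev0 m p U"
      unfolding \<xi>_def by (intro Sobolev0_diff[OF U(1) p] admissible_Sobolev0 w v)
    note S\<xi> = Sobolev0_Sobolev[OF U(1) p \<xi>]
    note L = sobolev_rules(1)[OF S\<xi>] sobolev_rules(2)[OF S\<xi>]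
    note P = pow_dual_Lp(1)[OF p q sobolev_rules(2)[OF Sv]]
    define d where "d = \<N> \<xi>"
    have d: "d > 0" unfolding d_def \<xi>_def by (intro Dm_norm_pos admissible_Sobolev0 v w)
    \<comment> \<open>The embedding is available on U only, so each of the two pieces is charged
      with the norm over all of U.\<close>
    have \<xi>d: "Lp_norm p D \<xi> \<le> C_F * d" if "D \<in> sets lebesgue" "D \<subseteq> U" for D
      using Lp_subset(2)[OF that(1) lO that(2) _ L(1)] p embedding_const_bound[OF U(1) p U(2) \<xi>]
      by (simp add: d_def)
    have \<xi>L: "\<xi> \<in> Lp p D" if "D \<in> sets lebesgue" "D \<subseteq> U" for D
      using Lp_subset(1)[OF that(1) lO that(2) _ L(1)] p by simp
    have "- residual U m p h v \<xi> =
        - (LINT x|\<L>. (pow_dual p (Dm U m v x) - \<eta> x) \<bullet> Dm U m \<xi> x) + (LINT x|\<L>. (h x - g x) * \<xi> x)"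
      using Hoelder_inner(1)[OF p q P L(2)] Hoelder_inner(1)[OF p q \<eta> L(2)]
        Hoelder_inner(1)[OF p q h L(1)] Hoelder_inner(1)[OF p q g L(1)]
        Sobolev0_duality[OF U(1) p q \<eta> g test \<xi>]
      by (simp add: residual_def inner_diff_left left_diff_distrib)
    moreover have "- (LINT x|\<L>. (pow_dual p (Dm U m v x) - \<eta> x) \<bullet> Dm U m \<xi> x)
        \<le> Lp_norm q U (\<lambda>x. pow_dual p (Dm U m v x) - \<eta> x) * d"
      using Hoelder_inner(2)[OF p q Lp_diff[OF q1(1) P \<eta>] L(2)] by (simp add: d_def Dm_norm_def)
    moreover have "(LINT x|\<L>. (h x - g x) * \<xi> x) \<le>
        C_F * Lp_norm q N (\<lambda>x. g x - h x) * d + C_F * Lp_norm q Z (\<lambda>x. max 0 (h x - g x)) * d"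
    proof -
      have ae: "AE x in lebesgue. x \<in> U \<longrightarrow> \<phi> x \<le> w x"
        using w(1) lO by (simp add: admissible_def AE_lebesgue_on_iff)
      have 0: "U \<inter> space lebesgue \<in> sets lebesgue" "N \<inter> space lebesgue \<in> sets lebesgue" "Z \<inter> space lebesgue \<in> sets lebesgue"
        using lO sets by auto
      note HN = Hoelder[OF p q Lp_subset(1)[OF sets(2) lO sub(2) q1(2) gh] \<xi>L[OF sets(2) sub(2)]]
      note HZ = Hoelder[OF p q Lp_subset(1)[OF sets(1) lO sub(1) q1(2) hg] \<xi>L[OF sets(1) sub(1)]]
      have "(LINT x|\<L>. (h x - g x) * \<xi> x) = (LINT x|lebesgue. indicator U x *\<^sub>R ((h x - g x) * \<xi> x))"
        by (rule integral_restrict_space[OF 0(1)])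
      also have "\<dots> \<le> (LINT x|lebesgue. indicator N x *\<^sub>R (norm (g x - h x) * norm (\<xi> x))
          + indicator Z x *\<^sub>R (norm (max 0 (h x - g x)) * norm (\<xi> x)))"
      proof (rule integral_mono_AE)
        show "integrable lebesgue (\<lambda>x. indicator U x *\<^sub>R ((h x - g x) * \<xi> x))"
          unfolding integrable_restrict_space[OF 0(1), symmetric]
          using Hoelder_inner(1)[OF p q Lp_diff[OF q1(1) h g] L(1)] by simp
        show "integrable lebesgue (\<lambda>x. indicator N x *\<^sub>R (norm (g x - h x) * norm (\<xi> x))
          + indicator Z x *\<^sub>R (norm (max 0 (h x - g x)) * norm (\<xi> x)))"
          using HN(1) HZ(1) unfolding integrable_restrict_space[OF 0(2)] integrable_restrict_space[OF 0(3)]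
          by (rule Bochner_Integration.integrable_add)
        show "AE x in lebesgue. indicator U x *\<^sub>R ((h x - g x) * \<xi> x) \<le>
          indicator N x *\<^sub>R (norm (g x - h x) * norm (\<xi> x)) + indicator Z x *\<^sub>R (norm (max 0 (h x - g x)) * norm (\<xi> x))"
          using ae
        proof eventually_elim
          case (elim x)
          consider "x \<notin> U" | "x \<in> N" "x \<notin> Z" "x \<in> U" | "x \<in> Z" "x \<notin> N" "x \<in> U" "v x = \<phi> x"
            by (auto simp: N_def Z_def noncontact_set_def contact_set_def)
          then show ?case
          proof cases
            case 1
            then have "x \<notin> N" "x \<notin> Z" using sub by auto
            with 1 show ?thesis by simp
          next
            case 2
            have "(h x - g x) * \<xi> x \<le> \<bar>g x - h x\<bar> * \<bar>\<xi> x\<bar>"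
              by (metis abs_ge_self abs_minus_commute abs_mult)
            with 2 show ?thesis by simp
          next
            case 3
            \<comment> \<open>On the contact set v equals the obstacle, which lies below w.\<close>
            then have "\<xi> x \<ge> 0" using elim by (simp add: \<xi>_def)
            then have "(h x - g x) * \<xi> x \<le> max 0 (h x - g x) * \<xi> x" by (intro mult_right_mono) auto
            with 3 \<open>\<xi> x \<ge> 0\<close> show ?thesis by simp
          qed
        qed
      qed
      also have "\<dots> = (LINT x|lebesgue_on N. norm (g x - h x) * norm (\<xi> x)) + (LINT x|lebesgue_on Z. norm (max 0 (h x - g x)) * norm (\<xi> x))"
        using HN(1) HZ(1)
        unfolding integral_restrict_space[OF 0(2)] integral_restrict_space[OF 0(3)]
          integrable_restrict_space[OF 0(2)] integrable_restrict_space[OF 0(3)]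
        by (rule Bochner_Integration.integral_add)
      also have "\<dots> \<le> Lp_norm q N (\<lambda>x. g x - h x) * (C_F * d) + Lp_norm q Z (\<lambda>x. max 0 (h x - g x)) * (C_F * d)"
        by (intro add_mono order_trans[OF HN(2)] order_trans[OF HZ(2)] mult_left_mono \<xi>d sets sub Lp_norm_nonneg)
      finally show ?thesis by (simp add: mult_ac)
    qed
    ultimately have "- residual U m p h v \<xi> \<le> ?R * d"
      unfolding N_def[symmetric] Z_def[symmetric] distrib_right by linarith
    moreover have "0 \<le> ?R * d" using d CF by (intro mult_nonneg_nonneg add_nonneg_nonneg) auto
    ultimately show "max 0 (- residual U m p h v (\<lambda>x. w x - v x)) / \<N> (\<lambda>x. w x - v x) \<le> ?R"
      using d unfolding \<xi>_def[symmetric] d_def[symmetric] by (simp add: pos_divide_le_eq)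
  qed
qed

text \<open>Needed, as is the odd version below, to bound the infimum of the theorem from below; the
  zero function is a member.\<close>

lemma Q_even_nonempty: "Q_even U k q \<noteq> {}"
proof -
  have "(\<lambda>x. 0) \<in> Q_even U k q"
    by (auto simp: Q_even_def has_weak_laplace_power_def distributionally_def locally_integrable_continuous
        intro!: bexI[of _ "\<lambda>x. 0"])
  then show ?thesis by blast
qed

lemma Q_odd_nonempty: "Q_odd U k q \<noteq> {}"
proof -
  have "(\<lambda>x. 0) \<in> Q_odd U k q"
    by (auto simp: Q_odd_def has_weak_laplace_power_div_def distributionally_def locally_integrable_continuous
        intro!: bexI[of _ "\<lambda>x. 0"])
  then show ?thesis by blast
qed

lemma error_upper_bound_even:
  assumes v: "v \<in> K" and \<phi>: "\<phi> \<in> borel_measurable (\<L>)" and m: "m = 2 * k"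
    and \<eta>: "\<eta> \<in> Q_even U k q"
  shows "\<R> v \<le> Lp_norm q U (\<lambda>x. pow_dual p (weak_laplace_power U k v x) - \<eta> x)
    + C_F * Lp_norm q (noncontact_set U \<phi> v) (\<lambda>x. weak_laplace_power U k \<eta> x - h x)
    + C_F * Lp_norm q (contact_set U \<phi> v) (\<lambda>x. max 0 (h x - weak_laplace_power U k \<eta> x))"
proof -
  obtain g where g: "\<eta> \<in> Lp q U" "g \<in> Lp q U" "has_weak_laplace_power U k \<eta> g"
    using \<eta> by (auto simp: Q_even_def)
  note W = weak_laplace_power[OF U(1) g(3)]
  have WL: "weak_laplace_power U k \<eta> \<in> Lp q U" using Lp_AE[OF _ g(2) W(2)] U(1) by simp
  have "(LINT x|\<L>. (\<eta> x, 0 :: 'a) \<bullet> Dm U m \<psi> x) = (LINT x|\<L>. weak_laplace_power U k \<eta> x * \<psi> x)"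
    if \<psi>: "\<psi> \<in> test_functions U" for \<psi>
  proof -
    have "(LINT x|\<L>. (\<eta> x, 0 :: 'a) \<bullet> Dm U m \<psi> x) = (LINT x|\<L>. \<eta> x \<bullet> (laplace ^^ k) \<psi> x)"
    proof (rule integral_cong_AE)
      show "AE x in \<L>. (\<eta> x, 0 :: 'a) \<bullet> Dm U m \<psi> x = \<eta> x \<bullet> (laplace ^^ k) \<psi> x"
        using Dm_smooth[OF U(1) p \<psi>, of m] by eventually_elim (simp add: m)
      show "(\<lambda>x. (\<eta> x, 0 :: 'a) \<bullet> Dm U m \<psi> x) \<in> borel_measurable (\<L>)"
        using Hoelder_inner(1)[OF p q Lp_Pair(1)[OF g(1)] sobolev_rules(2)[OF test_functions_Sobolev[OF U(1) p \<psi>]]] by simp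
      show "(\<lambda>x. \<eta> x \<bullet> (laplace ^^ k) \<psi> x) \<in> borel_measurable (\<L>)"
        using Hoelder_inner(1)[OF p q g(1) test_functions_Lp(1)[OF U(1) test_functions_laplace_power[OF \<psi>, of k]]] p by simp
    qed
    then show ?thesis using W(1) \<psi> by (simp add: has_weak_laplace_power_def distributionally_def)
  qed
  from dual_residual_norm_upper_bound[OF v \<phi> Lp_Pair(1)[OF g(1)] WL this]
  show ?thesis by (simp add: m Dm_def pow_dual_def norm_Pair Lp_norm_Pair)
qed

lemma error_upper_bound_odd:
  assumes v: "v \<in> K" and \<phi>: "\<phi> \<in> borel_measurable (\<L>)" and m: "m = 2 * k + 1"
    and \<eta>: "\<eta> \<in> Q_odd U k q"
  shows "\<R> v
    \<le> Lp_norm q U (\<lambda>x. pow_dual p (weak_grad U (weak_laplace_power U k v) x) - \<eta> x)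
    + C_F * Lp_norm q (noncontact_set U \<phi> v) (\<lambda>x. weak_laplace_power_div U k \<eta> x + h x)
    + C_F * Lp_norm q (contact_set U \<phi> v) (\<lambda>x. max 0 (weak_laplace_power_div U k \<eta> x + h x))"
proof -
  obtain g where g: "\<eta> \<in> Lp q U" "g \<in> Lp q U" "has_weak_laplace_power_div U k \<eta> g"
    using \<eta> by (auto simp: Q_odd_def)
  note W = weak_laplace_power_div[OF U(1) g(3)]
  define G where "G = weak_laplace_power_div U k \<eta>"
  \<comment> \<open>Moving the gradient onto \<eta> changes the sign, so -G plays the role of g and
    h - g becomes G + h.\<close>
  have GL: "(\<lambda>x. - G x) \<in> Lp q U" using Lp_AE[OF _ g(2) W(2)] U(1) by (simp add: G_def Lp_minus)
  have "(LINT x|\<L>. (0 :: real, \<eta> x) \<bullet> Dm U m \<psi> x) = (LINT x|\<L>. - G x * \<psi> x)"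
    if \<psi>: "\<psi> \<in> test_functions U" for \<psi>
  proof -
    have AE: "AE x in \<L>. Dm U m \<psi> x = (0, grad ((laplace ^^ k) \<psi>) x)"
      using Dm_smooth[OF U(1) p \<psi>, of m] by (simp add: m)
    have "(LINT x|\<L>. (0 :: real, \<eta> x) \<bullet> Dm U m \<psi> x) = (LINT x|\<L>. - (\<eta> x \<bullet> (- grad ((laplace ^^ k) \<psi>) x)))"
    proof (rule integral_cong_AE)
      show "AE x in \<L>. (0 :: real, \<eta> x) \<bullet> Dm U m \<psi> x = - (\<eta> x \<bullet> (- grad ((laplace ^^ k) \<psi>) x))"
        using AE by eventually_elim simp
      show m1: "(\<lambda>x. (0 :: real, \<eta> x) \<bullet> Dm U m \<psi> x) \<in> borel_measurable (\<L>)"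
        using Hoelder_inner(1)[OF p q Lp_Pair(2)[OF g(1)] sobolev_rules(2)[OF test_functions_Sobolev[OF U(1) p \<psi>]]] by simp
      have "integrable (\<L>) (\<lambda>x. \<eta> x \<bullet> (- grad ((laplace ^^ k) \<psi>) x))"
        using g(3) unfolding has_weak_laplace_power_div_def distributionally_def
        by (intro admissible_operator_integrable[OF U(1) admissible_grad_laplace_power _ \<psi>]) auto
      then show "(\<lambda>x. - (\<eta> x \<bullet> (- grad ((laplace ^^ k) \<psi>) x))) \<in> borel_measurable (\<L>)" by simp
    qed
    also have "\<dots> = - (LINT x|\<L>. \<eta> x \<bullet> (- grad ((laplace ^^ k) \<psi>) x))"
      by (rule Bochner_Integration.integral_minus)
    also have "\<dots> = - (LINT x|\<L>. G x * \<psi> x)"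
      using W(1) \<psi> unfolding G_def has_weak_laplace_power_div_def distributionally_def by simp
    finally show ?thesis by simp
  qed
  from dual_residual_norm_upper_bound[OF v \<phi> Lp_Pair(2)[OF g(1)] GL this]
  have "\<R> v
    \<le> Lp_norm q U (\<lambda>x. pow_dual p (weak_grad U (weak_laplace_power U k v) x) - \<eta> x)
    + C_F * Lp_norm q (noncontact_set U \<phi> v) (\<lambda>x. - G x - h x)
    + C_F * Lp_norm q (contact_set U \<phi> v) (\<lambda>x. max 0 (G x + h x))"
    by (simp add: m Dm_def pow_dual_def norm_Pair Lp_norm_Pair add.commute)
  also have "Lp_norm q (noncontact_set U \<phi> v) (\<lambda>x. - G x - h x) = Lp_norm q (noncontact_set U \<phi> v) (\<lambda>x. G x + h x)"
    using Lp_norm_minus[of q "noncontact_set U \<phi> v" "\<lambda>x. G x + h x"] by (simp add: minus_add)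
  finally show ?thesis by (simp add: G_def)
qed

lemma error_bound:
  assumes u: "u \<in> K" and v: "v \<in> K" and w: "w \<in> K"
    and var: "\<And>z. z \<in> K \<Longrightarrow> residual U m p h u (\<lambda>x. z x - u x) \<ge> 0"
  shows "\<N> (\<lambda>x. u x - v x)
    \<le> (if p \<ge> 2 then 2 powr ((p - 2) / (p - 1))
        else inverse (p - 1) * 2 powr ((2 - p) / p)
               * (C3 U m p q h w powr p + \<N> v powr p) powr ((2 - p) / p))
       * \<R> v powr (1 / max 1 (p - 1))"
proof -
  define d R where "d = \<N> (\<lambda>x. u x - v x)" and "R = \<R> v"
  have d: "d \<ge> 0" by (simp add: d_def Dm_norm_def)
  have R: "R \<ge> 0" unfolding R_def by (rule dual_residual_norm_nonneg[OF v])
  \<comment> \<open>Holds also for d = 0, where the quotient is 0; dropping this term turns the two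
    lower bounds into error estimates.\<close>
  have r: "residual U m p h u (\<lambda>x. v x - u x) / d \<ge> 0" using var[OF v] d by simp
  show ?thesis
  proof (cases "p \<ge> 2")
    case True
    have "2 powr (2 - p) * d powr (p - 1) \<le> R"
      using error_lower_bound_ge_2[OF u v True] r unfolding d_def R_def by linarith
    then have "2 powr (p - 2) * (2 powr (2 - p) * d powr (p - 1)) \<le> 2 powr (p - 2) * R"
      by (intro mult_left_mono) auto
    moreover have "2 powr (p - 2) * 2 powr (2 - p) = (1 :: real)" unfolding powr_add[symmetric] by simp
    ultimately have "d powr (p - 1) \<le> 2 powr (p - 2) * R" by (simp flip: mult.assoc)
    then have "(d powr (p - 1)) powr (1 / (p - 1)) \<le> (2 powr (p - 2) * R) powr (1 / (p - 1))"
      using p by (intro powr_mono2) auto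
    then have "d \<le> 2 powr ((p - 2) / (p - 1)) * R powr (1 / (p - 1))"
      using p d R by (simp add: powr_powr powr_mult)
    with True show ?thesis unfolding d_def[symmetric] R_def[symmetric] by (simp add: max_def)
  next
    case False
    define T where "T = (C3 U m p q h w powr p + \<N> v powr p) powr ((2 - p) / p)"
    have T: "T > 0" unfolding T_def using add_pos_nonneg[of "C3 U m p q h w powr p" "\<N> v powr p"] C3_pos[of w]
      by simp
    have inv: "2 powr ((p - 2) / p) = inverse (2 powr ((2 - p) / p) :: real)"
      unfolding powr_minus[symmetric] by (simp add: minus_divide_left)
    have "(p - 1) * 2 powr ((p - 2) / p) / T * d \<le> R"
      using error_lower_bound_less_2[OF u v w _ var[OF w]] False r unfolding d_def R_def T_def by linarith
    then have "d \<le> inverse (p - 1) * 2 powr ((2 - p) / p) * T * R"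
      using p T unfolding inv by (simp add: field_simps)
    with False R show ?thesis unfolding d_def[symmetric] R_def[symmetric] T_def[symmetric] by (simp add: max_def)
  qed
qed

end

(* Even case of the second conjunct: the positive part is taken of h - Delta^k eta, the sign for
   which the estimate holds. With the opposite sign it fails: take v = phi = eta = 0 and h = 1. *)

theorem theorem6p1:
  fixes \<Omega> :: "'a::euclidean_space set"
    and p q :: real and m :: nat
    and h \<phi> u v w :: "'a \<Rightarrow> real"
  assumes "p > 1" and "q = p / (p - 1)" and "m \<ge> 2"
    and "open \<Omega>" and "connected \<Omega>" and "bounded \<Omega>" and "\<Omega> \<noteq> {}"
    and "h \<in> Lp q \<Omega>" and "\<not> (AE x in lebesgue_on \<Omega>. h x = 0)"
    and "\<phi> \<in> Lp 1 \<Omega>" and "admissible \<Omega> m p \<phi> \<noteq> {}"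
    and "u \<in> admissible \<Omega> m p \<phi>"
    and "\<And>z. z \<in> admissible \<Omega> m p \<phi> \<Longrightarrow> residual \<Omega> m p h u (\<lambda>x. z x - u x) \<ge> 0"
    and "w \<in> admissible \<Omega> m p \<phi>"
    and "v \<in> admissible \<Omega> m p \<phi>"
  shows
    "((p \<ge> 2 \<longrightarrow>
         2 powr (2 - p) * Dm_norm \<Omega> m p (\<lambda>x. u x - v x) powr (p - 1)
           + residual \<Omega> m p h u (\<lambda>x. v x - u x) / Dm_norm \<Omega> m p (\<lambda>x. u x - v x)
         \<le> dual_residual_norm \<Omega> m p \<phi> h v) \<and>
      (p < 2 \<longrightarrow>
         (p - 1) * 2 powr ((p - 2) / p)
             / (C3 \<Omega> m p q h w powr p + Dm_norm \<Omega> m p v powr p) powr ((2 - p) / p)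
             * Dm_norm \<Omega> m p (\<lambda>x. u x - v x)
           + residual \<Omega> m p h u (\<lambda>x. v x - u x) / Dm_norm \<Omega> m p (\<lambda>x. u x - v x)
         \<le> dual_residual_norm \<Omega> m p \<phi> h v))
     \<and>
     ((\<forall>k. m = 2 * k \<longrightarrow>
         dual_residual_norm \<Omega> m p \<phi> h v
         \<le> (INF \<eta>\<in>Q_even \<Omega> k q.
              Lp_norm q \<Omega> (\<lambda>x. pow_dual p (weak_laplace_power \<Omega> k v x) - \<eta> x)
              + embedding_const \<Omega> m p
                  * Lp_norm q (noncontact_set \<Omega> \<phi> v) (\<lambda>x. weak_laplace_power \<Omega> k \<eta> x - h x)
              + embedding_const \<Omega> m p
                  * Lp_norm q (contact_set \<Omega> \<phi> v)
                      (\<lambda>x. max 0 (h x - weak_laplace_power \<Omega> k \<eta> x)))) \<and>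
      (\<forall>k. m = 2 * k + 1 \<longrightarrow>
         dual_residual_norm \<Omega> m p \<phi> h v
         \<le> (INF \<eta>\<in>Q_odd \<Omega> k q.
              Lp_norm q \<Omega>
                (\<lambda>x. pow_dual p (weak_grad \<Omega> (weak_laplace_power \<Omega> k v) x) - \<eta> x)
              + embedding_const \<Omega> m p
                  * Lp_norm q (noncontact_set \<Omega> \<phi> v)
                      (\<lambda>x. weak_laplace_power_div \<Omega> k \<eta> x + h x)
              + embedding_const \<Omega> m p
                  * Lp_norm q (contact_set \<Omega> \<phi> v)
                      (\<lambda>x. max 0 (weak_laplace_power_div \<Omega> k \<eta> x + h x)))))
     \<and>
     Dm_norm \<Omega> m p (\<lambda>x. u x - v x)
       \<le> (if p \<ge> 2 then 2 powr ((p - 2) / (p - 1))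
           else inverse (p - 1) * 2 powr ((2 - p) / p)
                  * (C3 \<Omega> m p q h w powr p + Dm_norm \<Omega> m p v powr p) powr ((2 - p) / p))
          * dual_residual_norm \<Omega> m p \<phi> h v powr (1 / max 1 (p - 1))"
proof -
  note ctx = assms(1,2,4,6,7,8)
  note u = assms(12) and var = assms(13) and w = assms(14) and v = assms(15)
  have \<phi>: "\<phi> \<in> borel_measurable (lebesgue_on \<Omega>)" using LpD(1)[OF assms(10)] .
  show ?thesis
    by (intro conjI impI allI cINF_greatest Q_even_nonempty[OF ctx] Q_odd_nonempty[OF ctx]
        error_lower_bound_ge_2[OF ctx u v] error_lower_bound_less_2[OF ctx u v w _ var[OF w]]
        error_upper_bound_even[OF ctx v \<phi>] error_upper_bound_odd[OF ctx v \<phi>]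
        error_bound[OF ctx u v w var])
qed

end
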